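(* Let $u$ be the weak solution of the elliptic interface problem $$-\nabla\cdot(a\nabla u)+cu=f\ \text{ in }\Omega,\qquad [u]=0,\quad [a\nabla u\cdot\mathbf n]=0\ \text{ on }\Gamma,\qquad u=g\ \text{ on }\partial\Omega,$$ and let $\mathbf p=a\nabla u$. Then $(u,\mathbf p)\in X$ and it satisfies the following mixed variational formulation: for all $(v,\mathbf q)\in X$, $$\left\{\begin{aligned} (a\nabla u-\mathbf p,\nabla v)+(-\nabla\cdot\mathbf p+cu,v)&=(f,v),\\ (a^{-1}\mathbf p,\mathbf q)+\big((1+c)^{-1}\nabla\cdot\mathbf p+(1+c)^{-1}u,\nabla\cdot\mathbf q\big)&=\langle g,\mathbf q\cdot\mathbf n_{\partial\Omega}\rangle-\big((1+c)^{-1}f,\nabla\cdot\mathbf q\big). \end{aligned}\right.$$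
   Context: Setting: $\Omega\subset\mathbb R^d$ is an open bounded domain with Lipschitz boundary, partitioned into two disjoint connected subdomains $\Omega_1,\Omega_2$ with $\overline\Omega=\overline\Omega_1\cup\overline\Omega_2$ and interface $\Gamma=\overline\Omega_1\cap\overline\Omega_2$. For a function $u$ on $\Omega$, $u_k=u|_{\Omega_k}$. $[\cdot]$ is the jump across $\Gamma$, $\mathbf n$ is the unit normal to $\Gamma$ pointing from $\Omega_1$ to $\Omega_2$, and $\mathbf n_{\partial\Omega}$ is the unit outward normal to $\partial\Omega$. The coefficient $a$ is piecewise constant, $a|_{\Omega_k}=a_k>0$ for $k=1,2$; $0\le c\in L^\infty(\Omega)$; $f\in L^2(\Omega)$; $g\in H^{1/2}(\partial\Omega)$. Weak solution of the interface problem: the unique $u\in H^1(\Omega)$ with trace $g$ on $\partial\Omega$ such that $\int_\Omega a\nabla u\cdot\nabla w+cuw\,dx=\int_\Omega fw\,dx$ for all $w\in H_0^1(\Omega)$. Function spaces: $V=\{u: u_k\in H^1(\Omega_k),\ k=1,2\}$ with $\|u\|_V^2=\|u_1\|_{H^1(\Omega_1)}^2+\|u_2\|_{H^1(\Omega_2)}^2$; for $u\in V$ the gradient $\nabla u$ is understood piecewise, $\nabla u|_{\Omega_k}=\nabla u_k$. $H_{\rm div}(\Omega)=\{\mathbf p\in L^2(\Omega)^d:\nabla\cdot\mathbf p\in L^2(\Omega)\}$. $X=V\times H_{\rm div}(\Omega)$ with $\|(u,\mathbf p)\|_X^2=\|u\|_V^2+\|\mathbf p\|_{L^2(\Omega)^d}^2+\|\nabla\cdot\mathbf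 p\|_{L^2(\Omega)}^2$. $(\cdot,\cdot)$ is the $L^2(\Omega)$ inner product (scalar or vector valued), and $\langle\cdot,\cdot\rangle$ is the duality pairing between $H^{1/2}(\partial\Omega)$ and $H^{-1/2}(\partial\Omega)$. *)

theory Defs
  imports "HOL-Analysis.Analysis"
begin

section \<open>Lebesgue spaces\<close>

text \<open>Elements of Lebesgue and Sobolev spaces on a set \<open>\<Omega>\<close> are represented by functions on the whole
  type; all notions below depend only on their values on \<open>\<Omega>\<close>.\<close>

definition L2 :: "'a measure \<Rightarrow> ('a \<Rightarrow> 'b::euclidean_space) set" where
  "L2 M = {u. u \<in> borel_measurable M \<and> integrable M (\<lambda>x. (norm (u x))\<^sup>2)}"

definition L_infty :: "'a measure \<Rightarrow> ('a \<Rightarrow> 'b::euclidean_space) set" where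
  "L_infty M = {u. u \<in> borel_measurable M \<and> (\<exists>C. AE x in M. norm (u x) \<le> C)}"

text \<open>For real-valued functions \<open>\<bullet>\<close> is multiplication, so this covers scalars and vectors.\<close>

definition L2_inner :: "'a::euclidean_space set \<Rightarrow> ('a \<Rightarrow> 'b::euclidean_space) \<Rightarrow> ('a \<Rightarrow> 'b) \<Rightarrow> real"
  where "L2_inner \<Omega> f g = (\<integral>x. f x \<bullet> g x \<partial>lebesgue_on \<Omega>)"

definition locally_integrable ::
    "'a::euclidean_space set \<Rightarrow> ('a \<Rightarrow> 'b::euclidean_space) \<Rightarrow> bool" where
  "locally_integrable \<Omega> u \<longleftrightarrow> (\<forall>K. compact K \<and> K \<subseteq> \<Omega> \<longrightarrow> integrable (lebesgue_on K) u)"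

section \<open>Smooth functions and weak derivatives\<close>

primrec Ck :: "nat \<Rightarrow> ('a::euclidean_space \<Rightarrow> real) \<Rightarrow> bool" where
  "Ck 0 f \<longleftrightarrow> continuous_on UNIV f"
| "Ck (Suc k) f \<longleftrightarrow> (\<forall>x. f differentiable (at x)) \<and>
     (\<forall>b\<in>Basis. Ck k (\<lambda>x. frechet_derivative f (at x) b))"

definition smooth :: "('a::euclidean_space \<Rightarrow> real) \<Rightarrow> bool" where
  "smooth f \<longleftrightarrow> (\<forall>k. Ck k f)"

definition test_functions :: "'a::euclidean_space set \<Rightarrow> ('a \<Rightarrow> real) set" where
  "test_functions \<Omega> = {\<phi>. smooth \<phi> \<and> compact (closure {x. \<phi> x \<noteq> 0}) \<and> closure {x. \<phi> x \<noteq> 0} \<subseteq> \<Omega>}"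

definition gradient :: "('a::euclidean_space \<Rightarrow> real) \<Rightarrow> 'a \<Rightarrow> 'a" where
  "gradient \<phi> x = (\<Sum>b\<in>Basis. frechet_derivative \<phi> (at x) b *\<^sub>R b)"

definition has_weak_gradient ::
    "'a::euclidean_space set \<Rightarrow> ('a \<Rightarrow> real) \<Rightarrow> ('a \<Rightarrow> 'a) \<Rightarrow> bool" where
  "has_weak_gradient \<Omega> u G \<longleftrightarrow> locally_integrable \<Omega> u \<and> locally_integrable \<Omega> G \<and>
     (\<forall>\<phi>\<in>test_functions \<Omega>. \<forall>b\<in>Basis.
        (\<integral>x. u x * (gradient \<phi> x \<bullet> b) \<partial>lebesgue_on \<Omega>) = - (\<integral>x. (G x \<bullet> b) * \<phi> x \<partial>lebesgue_on \<Omega>))"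

definition has_weak_divergence ::
    "'a::euclidean_space set \<Rightarrow> ('a \<Rightarrow> 'a) \<Rightarrow> ('a \<Rightarrow> real) \<Rightarrow> bool" where
  "has_weak_divergence \<Omega> p D \<longleftrightarrow> locally_integrable \<Omega> p \<and> locally_integrable \<Omega> D \<and>
     (\<forall>\<phi>\<in>test_functions \<Omega>.
        (\<integral>x. p x \<bullet> gradient \<phi> x \<partial>lebesgue_on \<Omega>) = - (\<integral>x. D x * \<phi> x \<partial>lebesgue_on \<Omega>))"

text \<open>Weak derivatives on an open set are unique almost everywhere there; the choice operator picks
  a representative.\<close>

definition weak_gradient :: "'a::euclidean_space set \<Rightarrow> ('a \<Rightarrow> real) \<Rightarrow> 'a \<Rightarrow> 'a" where
  "weak_gradient \<Omega> u = (SOME G. has_weak_gradient \<Omega> u G)"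

definition weak_divergence :: "'a::euclidean_space set \<Rightarrow> ('a \<Rightarrow> 'a) \<Rightarrow> 'a \<Rightarrow> real" where
  "weak_divergence \<Omega> p = (SOME D. has_weak_divergence \<Omega> p D)"

section \<open>Sobolev spaces\<close>

definition H1 :: "'a::euclidean_space set \<Rightarrow> ('a \<Rightarrow> real) set" where
  "H1 \<Omega> = {u \<in> L2 (lebesgue_on \<Omega>). \<exists>G\<in>L2 (lebesgue_on \<Omega>). has_weak_gradient \<Omega> u G}"

definition H1_norm :: "'a::euclidean_space set \<Rightarrow> ('a \<Rightarrow> real) \<Rightarrow> real" where
  "H1_norm \<Omega> u = sqrt (L2_inner \<Omega> u u + L2_inner \<Omega> (weak_gradient \<Omega> u) (weak_gradient \<Omega> u))"

text \<open>The closure of the test functions in the \<open>H1\<close> norm.\<close>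

definition H1_0 :: "'a::euclidean_space set \<Rightarrow> ('a \<Rightarrow> real) set" where
  "H1_0 \<Omega> = {w \<in> H1 \<Omega>. \<exists>\<phi>::nat \<Rightarrow> 'a \<Rightarrow> real. (\<forall>n. \<phi> n \<in> test_functions \<Omega>) \<and>
     (\<lambda>n. H1_norm \<Omega> (\<lambda>x. \<phi> n x - w x)) \<longlonglongrightarrow> 0}"

definition Hdiv :: "'a::euclidean_space set \<Rightarrow> ('a \<Rightarrow> 'a) set" where
  "Hdiv \<Omega> = {p \<in> L2 (lebesgue_on \<Omega>). \<exists>D\<in>L2 (lebesgue_on \<Omega>). has_weak_divergence \<Omega> p D}"

definition broken_H1 :: "'a::euclidean_space set \<Rightarrow> 'a set \<Rightarrow> ('a \<Rightarrow> real) set" where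
  "broken_H1 \<Omega>1 \<Omega>2 = {u. u \<in> H1 \<Omega>1 \<and> u \<in> H1 \<Omega>2}"

definition broken_gradient ::
    "'a::euclidean_space set \<Rightarrow> 'a set \<Rightarrow> ('a \<Rightarrow> real) \<Rightarrow> 'a \<Rightarrow> 'a" where
  "broken_gradient \<Omega>1 \<Omega>2 u x =
     (if x \<in> \<Omega>1 then weak_gradient \<Omega>1 u x else if x \<in> \<Omega>2 then weak_gradient \<Omega>2 u x else 0)"

definition mixed_space ::
    "'a::euclidean_space set \<Rightarrow> 'a set \<Rightarrow> 'a set \<Rightarrow> (('a \<Rightarrow> real) \<times> ('a \<Rightarrow> 'a)) set" where
  "mixed_space \<Omega> \<Omega>1 \<Omega>2 = broken_H1 \<Omega>1 \<Omega>2 \<times> Hdiv \<Omega>"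

section \<open>The boundary\<close>

text \<open>Near each boundary point the set is the strict subgraph of a Lipschitz function over a
  hyperplane \<open>e \<bullet> y = 0\<close>.\<close>

definition lipschitz_boundary :: "'a::euclidean_space set \<Rightarrow> bool" where
  "lipschitz_boundary \<Omega> \<longleftrightarrow> (\<forall>x\<in>frontier \<Omega>. \<exists>r>0. \<exists>e. norm e = 1 \<and>
     (\<exists>\<gamma> :: 'a \<Rightarrow> real. \<exists>L. lipschitz_on L {y. e \<bullet> y = 0} \<gamma> \<and>
        \<Omega> \<inter> ball x r = {y \<in> ball x r. e \<bullet> y < \<gamma> (y - (e \<bullet> y) *\<^sub>R e)}))"

text \<open>The \<open>s\<close>-dimensional Hausdorff measure, normalised to agree with Lebesgue measure. The empty set
  needs a separate case since \<open>0 ^ 0 = 1\<close>, and boundedness is required since \<open>diameter\<close> carries no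
  information on unbounded sets.\<close>

definition hausdorff_size :: "nat \<Rightarrow> 'a::metric_space set \<Rightarrow> ennreal" where
  "hausdorff_size s C =
     (if C = {} then 0 else ennreal (unit_ball_vol (real s) * (diameter C / 2) ^ s))"

definition hausdorff_content :: "nat \<Rightarrow> real \<Rightarrow> 'a::metric_space set \<Rightarrow> ennreal" where
  "hausdorff_content s \<delta> A =
     (INF C \<in> {C :: nat \<Rightarrow> 'a set. A \<subseteq> (\<Union>i. C i) \<and> (\<forall>i. bounded (C i) \<and> diameter (C i) \<le> \<delta>)}.
        \<Sum>i. hausdorff_size s (C i))"

definition hausdorff_outer :: "nat \<Rightarrow> 'a::metric_space set \<Rightarrow> ennreal" where
  "hausdorff_outer s A = (SUP \<delta>\<in>{0<..}. hausdorff_content s \<delta> A)"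

definition hausdorff_measure :: "nat \<Rightarrow> 'a::metric_space measure" where
  "hausdorff_measure s =
     measure_of UNIV (lambda_system UNIV (Pow UNIV) (hausdorff_outer s)) (hausdorff_outer s)"

definition boundary_measure :: "'a::euclidean_space set \<Rightarrow> 'a measure" where
  "boundary_measure \<Omega> = restrict_space (hausdorff_measure (DIM('a) - 1)) (frontier \<Omega>)"

text \<open>The trace operator is the continuous extension, from \<open>H1 \<Omega>\<close> to the square integrable functions
  on the boundary, of the restriction to the boundary of functions smooth on the whole space. Its
  graph is the closure of the graph of that restriction. The boundary values \<open>g\<close> are determined
  almost everywhere with respect to surface measure.\<close>

definition has_trace :: "'a::euclidean_space set \<Rightarrow> ('a \<Rightarrow> real) \<Rightarrow> ('a \<Rightarrow> real) \<Rightarrow> bool" where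
  "has_trace \<Omega> u g \<longleftrightarrow> u \<in> H1 \<Omega> \<and> g \<in> L2 (boundary_measure \<Omega>) \<and>
     (\<exists>\<phi>::nat \<Rightarrow> 'a \<Rightarrow> real. (\<forall>n. smooth (\<phi> n)) \<and>
        (\<lambda>n. H1_norm \<Omega> (\<lambda>x. \<phi> n x - u x)) \<longlonglongrightarrow> 0 \<and>
        (\<lambda>n. \<integral>\<^sup>+x. ennreal ((\<phi> n x - g x)\<^sup>2) \<partial>boundary_measure \<Omega>) \<longlonglongrightarrow> 0)"

definition H_half :: "'a::euclidean_space set \<Rightarrow> ('a \<Rightarrow> real) set" where
  "H_half \<Omega> = {g. \<exists>w\<in>H1 \<Omega>. has_trace \<Omega> w g}"

text \<open>For \<open>q\<close> in \<open>Hdiv \<Omega>\<close> the normal component on the boundary, with respect to the outward unit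
  normal, is the functional on \<open>H_half \<Omega>\<close> given by Green's formula. Its value at \<open>g\<close> is the number
  obtained from every extension \<open>w\<close> of \<open>g\<close>.\<close>

definition normal_trace :: "'a::euclidean_space set \<Rightarrow> ('a \<Rightarrow> 'a) \<Rightarrow> ('a \<Rightarrow> real) \<Rightarrow> real" where
  "normal_trace \<Omega> q g = (THE r. \<forall>w. has_trace \<Omega> w g \<longrightarrow>
     r = L2_inner \<Omega> q (weak_gradient \<Omega> w) + L2_inner \<Omega> (weak_divergence \<Omega> q) w)"

definition duality_pairing :: "('a \<Rightarrow> real) \<Rightarrow> (('a \<Rightarrow> real) \<Rightarrow> real) \<Rightarrow> real" where
  "duality_pairing g l = l g"

section \<open>The interface problem\<close>

text \<open>The conditions \<open>[u] = 0\<close> and \<open>[a \<nabla>u \<bullet> n] = 0\<close> on the interface are contained in \<open>u \<in> H1 \<Omega>\<close> and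
  in the test functions being supported across the interface.\<close>

definition weak_solution ::
    "'a::euclidean_space set \<Rightarrow> ('a \<Rightarrow> real) \<Rightarrow> ('a \<Rightarrow> real) \<Rightarrow> ('a \<Rightarrow> real) \<Rightarrow> ('a \<Rightarrow> real) \<Rightarrow>
      ('a \<Rightarrow> real) \<Rightarrow> bool" where
  "weak_solution \<Omega> a c f g u \<longleftrightarrow> u \<in> H1 \<Omega> \<and> has_trace \<Omega> u g \<and>
     (\<forall>w\<in>H1_0 \<Omega>.
        (\<integral>x. a x *\<^sub>R weak_gradient \<Omega> u x \<bullet> weak_gradient \<Omega> w x + c x * u x * w x \<partial>lebesgue_on \<Omega>)
          = (\<integral>x. f x * w x \<partial>lebesgue_on \<Omega>))"

end

theory Submission
  imports Defs "HOL-Computational_Algebra.Polynomial"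
begin

text \<open>The mixed equations are the weak formulation read in terms of the flux. Testing the weak solution
  with smooth functions of compact support says that \<open>p = a \<nabla>u\<close> has the weak divergence \<open>c u - f\<close>,
  which is square integrable, so \<open>p\<close> lies in \<open>Hdiv\<close>. The two pieces fill the domain up to a null set, so
  the piecewise gradient of \<open>u\<close> is its gradient and \<open>a \<nabla>u - p\<close> vanishes almost everywhere; the first
  equation is then \<open>- div p + c u = f\<close> multiplied by \<open>v\<close>. In the second one \<open>p / a = \<nabla>u\<close> and
  \<open>(div p + u) / (1 + c) = u - f / (1 + c)\<close>, so that it reduces to
  \<open>(\<nabla>u, q) + (u, div q) = \<langle>g, q \<bullet> n\<rangle>\<close>, which is how the right-hand side is defined.

  Two facts have to be supplied. First, weak derivatives are picked by a choice operator, so they must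
  be unique almost everywhere (\<open>fundamental_lemma\<close>). Second, the pairing with the normal trace is a
  definite description: its value makes sense only if \<open>(\<nabla>w, q) + (w, div q)\<close> is the same for all \<open>w\<close>
  with the same trace (\<open>normal_trace_eq\<close>). The second fact is the substance of the development. It
  amounts to showing that the expression vanishes for the difference \<open>w\<close> of two functions with equal
  trace, that is, for a limit of smooth functions that tend to zero in \<open>L2\<close> of the boundary.

  The first step is that the extension of \<open>w\<close> by zero has the extension of \<open>\<nabla>w\<close> by zero as its weak
  gradient on the whole space (\<open>same_trace_zero_extension\<close>). For smooth \<open>\<phi>\<close> this is a bound of
  \<open>\<integral>\<^sub>\<Omega> \<partial>\<^sub>b \<phi>\<close> by the integral of \<open>\<bar>\<phi>\<bar>\<close> over the boundary with respect to Hausdorff measure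
  (\<open>boundary_integral_bound\<close>). Write the derivative as a limit of difference quotients with step \<open>s\<close>
  and move the translation from \<open>\<phi>\<close> to \<open>\<Omega>\<close>: the integrand then lives where \<open>\<Omega>\<close> and its translate
  differ, inside the tube of segments of length \<open>s\<close> issuing from the boundary in direction \<open>b\<close>. A piece
  of the boundary of diameter \<open>r \<le> s\<close> carries a tube of volume at most a constant times \<open>s r\<^sup>d\<^sup>-\<^sup>1\<close>,
  and summing over a cover produces \<open>s\<close> times Hausdorff measure (\<open>tube_cover\<close>). This requires Borel
  sets to be Hausdorff measurable and the boundary to have finite measure
  (\<open>lipschitz_boundary_finite_measure\<close>).

  The second step pairs such a \<open>w\<close> with \<open>q\<close> (\<open>zero_extension_pairing\<close>). Near a boundary point, a
  cone of small translations maps \<open>\<Omega>\<close> into itself (\<open>inward_cone\<close>). Take a smooth kernel \<open>\<eta>\<close> supported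
  in that cone and consider the double integral of \<open>\<eta> (y - x) (q(x) \<bullet> \<nabla>w(y) + div q(x) w(y))\<close>. For
  fixed \<open>x\<close> the zero extension of \<open>w\<close> may be tested with \<open>\<eta> (\<cdot> - x)\<close>; for fixed \<open>y\<close> the function
  \<open>\<eta> (y - \<cdot>)\<close> is supported inside \<open>\<Omega>\<close> and may be tested against \<open>q\<close>. The two contributions cancel,
  so the double integral is zero, while shrinking the kernel makes it converge to the pairing, by
  continuity of translations (\<open>mollified_pairing_error\<close>).\<close>

section \<open>Smooth functions\<close>

lemma frechet_derivative_eqI:
  "(f has_derivative f') (at x) \<Longrightarrow> frechet_derivative f (at x) = f'"
  using frechet_derivative_at by metis

lemma frechet_derivative_worksI:
  "f differentiable (at x) \<Longrightarrow> (f has_derivative frechet_derivative f (at x)) (at x)"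
  by (simp add: frechet_derivative_works)

lemma Ck_SucD: "Ck (Suc k) f \<Longrightarrow> Ck k f"
proof (induction k arbitrary: f)
  case 0
  then show ?case
    by (auto simp: continuous_on_eq_continuous_at differentiable_imp_continuous_within)
next
  case (Suc k)
  then show ?case by simp
qed

lemma Ck_const: "Ck k (\<lambda>x. c)"
proof (induction k arbitrary: c)
  case (Suc k)
  have "frechet_derivative (\<lambda>x. c) (at x) = (\<lambda>_. 0)" for x :: 'a
    by (rule frechet_derivative_eqI) simp
  with Suc show ?case by simp
qed simp

lemma Ck_inner: "Ck k (\<lambda>x. x \<bullet> v)"
proof (cases k)
  case (Suc m)
  have d: "((\<lambda>x. x \<bullet> v) has_derivative (\<lambda>h. h \<bullet> v)) (at x)" for x
    by (auto intro!: derivative_eq_intros)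
  have "frechet_derivative (\<lambda>x. x \<bullet> v) (at x) = (\<lambda>h. h \<bullet> v)" for x
    by (rule frechet_derivative_eqI[OF d])
  then show ?thesis
    using d Suc by (auto simp: differentiable_def Ck_const)
qed (auto intro!: continuous_intros)

lemma Ck_add: "Ck k f \<Longrightarrow> Ck k g \<Longrightarrow> Ck k (\<lambda>x. f x + g x)"
proof (induction k arbitrary: f g)
  case (Suc k)
  have d: "f differentiable (at x)" "g differentiable (at x)" for x
    using Suc.prems by auto
  have "frechet_derivative (\<lambda>x. f x + g x) (at x) =
      (\<lambda>h. frechet_derivative f (at x) h + frechet_derivative g (at x) h)" for x
    using d by (intro frechet_derivative_eqI)
       (auto intro!: derivative_eq_intros frechet_derivative_worksI)
  with Suc d show ?case by (auto intro!: Suc.IH)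
qed (auto intro!: continuous_intros)

lemma Ck_mult: "Ck k f \<Longrightarrow> Ck k g \<Longrightarrow> Ck k (\<lambda>x. f x * g x)"
proof (induction k arbitrary: f g)
  case (Suc k)
  have d: "f differentiable (at x)" "g differentiable (at x)" for x
    using Suc.prems by auto
  have "frechet_derivative (\<lambda>x. f x * g x) (at x) =
      (\<lambda>h. f x * frechet_derivative g (at x) h + frechet_derivative f (at x) h * g x)" for x
    using d by (intro frechet_derivative_eqI)
       (auto intro!: derivative_eq_intros frechet_derivative_worksI)
  moreover have "Ck k f" "Ck k g"
    using Suc.prems by (auto intro: Ck_SucD)
  ultimately show ?case
    using Suc d by (auto intro!: Suc.IH Ck_add)
qed (auto intro!: continuous_intros)

text \<open>The derivative of \<open>1 / f\<close> is again a product of a derivative of \<open>f\<close> with powers of \<open>1 / f\<close>, which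
  closes the induction.\<close>
lemma Ck_inverse:
  assumes nz: "\<And>x. f x \<noteq> 0"
  shows "Ck k f \<Longrightarrow> Ck k (\<lambda>x. inverse (f x))"
proof (induction k)
  case 0
  then show ?case using nz by (auto intro!: continuous_intros)
next
  case (Suc k)
  have d: "f differentiable (at x)" for x
    using Suc.prems by auto
  have D: "((\<lambda>x. inverse (f x)) has_derivative
      (\<lambda>h. (-1) * (frechet_derivative f (at x) h * (inverse (f x) * inverse (f x))))) (at x)" for x
    using d[of x] nz[of x]
    by (auto intro!: derivative_eq_intros frechet_derivative_worksI)
  have E: "frechet_derivative (\<lambda>x. inverse (f x)) (at x) =
      (\<lambda>h. (-1) * (frechet_derivative f (at x) h * (inverse (f x) * inverse (f x))))" for x
    by (rule frechet_derivative_eqI[OF D])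
  have "Ck k (\<lambda>x. inverse (f x))"
    using Suc.IH Ck_SucD[OF Suc.prems] by blast
  then show ?case
    unfolding Ck.simps(2) E using D Suc.prems
    by (auto simp only: Ck.simps differentiable_def intro!: Ck_mult Ck_const)
qed

text \<open>The outer function ranges over a family that is closed under taking derivatives, because the
  derivative of \<open>\<beta> \<circ> f\<close> is \<open>(\<beta>' \<circ> f) * f'\<close> and the induction on \<open>k\<close> has to apply to \<open>\<beta>'\<close>.\<close>
lemma Ck_compose:
  assumes B: "\<And>\<beta>. \<beta> \<in> B \<Longrightarrow> \<exists>\<beta>'\<in>B. \<forall>s. (\<beta> has_real_derivative \<beta>' s) (at s)"
  shows "Ck k f \<Longrightarrow> \<beta> \<in> B \<Longrightarrow> Ck k (\<lambda>x. \<beta> (f x))"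
proof (induction k arbitrary: \<beta>)
  case 0
  from B[OF \<open>\<beta> \<in> B\<close>] have "continuous_on UNIV \<beta>"
    by (auto intro!: continuous_at_imp_continuous_on DERIV_isCont)
  then show ?case using 0 by (auto intro: continuous_on_compose2)
next
  case (Suc k)
  obtain \<beta>' where \<beta>': "\<beta>' \<in> B" "\<And>s. (\<beta> has_real_derivative \<beta>' s) (at s)"
    using B[OF \<open>\<beta> \<in> B\<close>] by auto
  have d: "(f has_derivative frechet_derivative f (at x)) (at x)" for x
    using Suc.prems by (auto intro: frechet_derivative_worksI)
  have D: "((\<lambda>x. \<beta> (f x)) has_derivative (\<lambda>h. \<beta>' (f x) * frechet_derivative f (at x) h)) (at x)" for x
    using has_derivative_compose[OF d \<beta>'(2)[unfolded has_field_derivative_def], of x] by simp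
  have E: "frechet_derivative (\<lambda>x. \<beta> (f x)) (at x) = (\<lambda>h. \<beta>' (f x) * frechet_derivative f (at x) h)" for x
    by (rule frechet_derivative_eqI[OF D])
  have "Ck k (\<lambda>x. \<beta>' (f x))"
    using Suc.IH[OF Ck_SucD[OF Suc.prems(1)] \<beta>'(1)] .
  then show ?case
    unfolding Ck.simps(2) E using D Suc.prems
    by (auto simp only: Ck.simps differentiable_def intro!: Ck_mult)
qed

lemma Ck_affine: "Ck k f \<Longrightarrow> Ck k (\<lambda>x. f (s *\<^sub>R x + v))"
proof (induction k arbitrary: f)
  case 0
  then show ?case by (auto intro!: continuous_intros elim!: continuous_on_compose2)
next
  case (Suc k)
  have d: "(f has_derivative frechet_derivative f (at x)) (at x)" for x
    using Suc.prems by (auto intro: frechet_derivative_worksI)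
  have lin: "linear (frechet_derivative f (at x))" for x
    using d has_derivative_linear by blast
  have D: "((\<lambda>x. f (s *\<^sub>R x + v)) has_derivative
      (\<lambda>h. s * frechet_derivative f (at (s *\<^sub>R x + v)) h)) (at x)" for x
  proof -
    have "((\<lambda>x. s *\<^sub>R x + v) has_derivative (\<lambda>h. s *\<^sub>R h)) (at x)"
      by (auto intro!: derivative_eq_intros)
    then show ?thesis
    using has_derivative_compose[OF _ d, of "\<lambda>x. s *\<^sub>R x + v" "\<lambda>h. s *\<^sub>R h" x UNIV]
    by (simp add: linear_scale[OF lin])
  qed
  have E: "frechet_derivative (\<lambda>x. f (s *\<^sub>R x + v)) (at x) =
      (\<lambda>h. s * frechet_derivative f (at (s *\<^sub>R x + v)) h)" for x
    by (rule frechet_derivative_eqI[OF D])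
  show ?case
    unfolding Ck.simps(2) E using D Suc.prems Suc.IH
    by (auto simp only: Ck.simps differentiable_def intro!: Ck_mult Ck_const)
qed

lemma smooth_const: "smooth (\<lambda>x. c)"
  and smooth_inner: "smooth (\<lambda>x. x \<bullet> v)"
  and smooth_add: "smooth f \<Longrightarrow> smooth g \<Longrightarrow> smooth (\<lambda>x. f x + g x)"
  and smooth_mult: "smooth f \<Longrightarrow> smooth g \<Longrightarrow> smooth (\<lambda>x. f x * g x)"
  and smooth_inverse: "smooth f \<Longrightarrow> (\<And>x. f x \<noteq> 0) \<Longrightarrow> smooth (\<lambda>x. inverse (f x))"
  and smooth_affine: "smooth f \<Longrightarrow> smooth (\<lambda>x. f (s *\<^sub>R x + v))"
  by (auto simp: smooth_def intro!: Ck_const Ck_inner Ck_add Ck_mult Ck_inverse Ck_affine)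

lemma smooth_minus: "smooth f \<Longrightarrow> smooth g \<Longrightarrow> smooth (\<lambda>x. f x - g x)"
  using smooth_add[OF _ smooth_mult[OF smooth_const, of g "-1"], of f] by simp

lemma smooth_sum: "(\<And>i. i \<in> I \<Longrightarrow> smooth (f i)) \<Longrightarrow> smooth (\<lambda>x. \<Sum>i\<in>I. f i x)"
  by (induction I rule: infinite_finite_induct) (auto intro: smooth_const smooth_add)

lemma smooth_continuous: "smooth f \<Longrightarrow> continuous_on S f"
  unfolding smooth_def using Ck.simps(1) continuous_on_subset by blast

lemma smooth_has_derivative:
  assumes "smooth f"
  shows "(f has_derivative (\<lambda>h. gradient f x \<bullet> h)) (at x)"
proof -
  have "Ck 1 f" using assms by (simp add: smooth_def)
  then have d: "(f has_derivative frechet_derivative f (at x)) (at x)"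
    by (auto intro: frechet_derivative_worksI)
  have lin: "linear (frechet_derivative f (at x))"
    using d has_derivative_linear by blast
  have "frechet_derivative f (at x) h = gradient f x \<bullet> h" for h
  proof -
    have "frechet_derivative f (at x) h = frechet_derivative f (at x) (\<Sum>b\<in>Basis. (h \<bullet> b) *\<^sub>R b)"
      by (simp add: euclidean_representation)
    also have "\<dots> = (\<Sum>b\<in>Basis. (h \<bullet> b) * frechet_derivative f (at x) b)"
      by (simp add: linear_sum[OF lin] linear_scale[OF lin])
    also have "\<dots> = gradient f x \<bullet> h"
      by (simp add: gradient_def inner_sum_left) (simp add: inner_commute mult.commute)
    finally show ?thesis .
  qed
  then have "frechet_derivative f (at x) = (\<lambda>h. gradient f x \<bullet> h)" by auto
  with d show ?thesis by simp
qed

lemma gradient_inner_Basis: "b \<in> Basis \<Longrightarrow> gradient f x \<bullet> b = frechet_derivative f (at x) b"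
  unfolding gradient_def by simp

lemma gradient_unique:
  fixes g :: "'a::euclidean_space"
  assumes "(f has_derivative (\<lambda>h. g \<bullet> h)) (at x)"
  shows "gradient f x = g"
  unfolding gradient_def frechet_derivative_eqI[OF assms] by (rule euclidean_representation)

lemma smooth_gradient_inner:
  assumes "smooth f" "b \<in> Basis"
  shows "smooth (\<lambda>x. gradient f x \<bullet> b)"
  using assms unfolding smooth_def gradient_inner_Basis[OF assms(2)]
  by (metis Ck.simps(2))

lemma continuous_on_gradient: "smooth f \<Longrightarrow> continuous_on S (gradient f)"
  by (subst continuous_on_componentwise) (auto intro: smooth_continuous smooth_gradient_inner)

lemma gradient_mult:
  assumes "smooth f" "smooth g"
  shows "gradient (\<lambda>x. f x * g x) x = f x *\<^sub>R gradient g x + g x *\<^sub>R gradient f x"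
  by (rule gradient_unique)
     (auto intro!: derivative_eq_intros smooth_has_derivative assms simp: inner_add_left algebra_simps)

lemma gradient_diff:
  assumes "smooth f" "smooth g"
  shows "gradient (\<lambda>x. f x - g x) x = gradient f x - gradient g x"
  by (rule gradient_unique)
     (auto intro!: derivative_eq_intros smooth_has_derivative assms simp: inner_diff_left)

lemma gradient_affine:
  assumes "smooth f"
  shows "gradient (\<lambda>x. f (s *\<^sub>R x + v)) x = s *\<^sub>R gradient f (s *\<^sub>R x + v)"
proof (rule gradient_unique)
  have "((\<lambda>x. s *\<^sub>R x + v) has_derivative (\<lambda>h. s *\<^sub>R h)) (at x)"
    by (auto intro!: derivative_eq_intros)
  then show "((\<lambda>x. f (s *\<^sub>R x + v)) has_derivative (\<lambda>h. (s *\<^sub>R gradient f (s *\<^sub>R x + v)) \<bullet> h)) (at x)"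
    using has_derivative_compose[OF _ smooth_has_derivative[OF assms], of "\<lambda>x. s *\<^sub>R x + v" "\<lambda>h. s *\<^sub>R h" x UNIV]
    by simp
qed

lemma gradient_eq_0:
  assumes "x \<notin> closure {x. f x \<noteq> 0}"
  shows "gradient f x = 0"
proof (rule gradient_unique)
  have "((\<lambda>x. 0) has_derivative (\<lambda>h. 0 \<bullet> h)) (at x)" by simp
  then show "(f has_derivative (\<lambda>h. 0 \<bullet> h)) (at x)"
    by (rule has_derivative_transform_within_open[of _ _ _ _ "- closure {x. f x \<noteq> 0}"])
       (use assms closure_subset[of "{x. f x \<noteq> 0}"] in \<open>auto simp: subset_iff\<close>)
qed

section \<open>Bump functions\<close>

text \<open>The functions \<open>P(1/s) exp(-1/s)\<close>, extended by zero to \<open>s \<le> 0\<close>, for polynomials \<open>P\<close>. They are closed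
  under differentiation; \<open>P = 1\<close> gives the usual smooth function that is flat at the origin.\<close>
definition flat_exp :: "real poly \<Rightarrow> real \<Rightarrow> real" where
  "flat_exp P s = (if 0 < s then poly P (1 / s) * exp (- (1 / s)) else 0)"

lemma poly_times_exp_tendsto_0: "((\<lambda>u. poly P u * exp (- u)) \<longlongrightarrow> (0::real)) at_top"
proof -
  have "((\<lambda>u. \<Sum>i\<le>degree P. coeff P i * (u ^ i / exp u)) \<longlongrightarrow> (\<Sum>i\<le>degree P. coeff P i * (0::real))) at_top"
    by (intro tendsto_sum tendsto_mult tendsto_const tendsto_power_div_exp_0)
  moreover have "poly P u * exp (- u) = (\<Sum>i\<le>degree P. coeff P i * (u ^ i / exp u))" for u
    by (simp add: poly_altdef exp_minus sum_distrib_right divide_inverse mult.assoc)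
  ultimately show ?thesis by simp
qed

text \<open>With \<open>u = 1/s\<close>, the chain rule turns \<open>P(u) exp(-u)\<close> into \<open>u\<^sup>2 (P - P')(u) exp(-u)\<close>. At the origin the
  difference quotient from the right is \<open>u P(u) exp(-u)\<close>, which tends to zero as \<open>u \<rightarrow> \<infinity>\<close>.\<close>
lemma flat_exp_has_derivative:
  "(flat_exp P has_real_derivative flat_exp (monom 1 2 * (P - pderiv P)) s) (at s)"
proof -
  consider "s < 0" | "s = 0" | "0 < s" by linarith
  then show ?thesis
  proof cases
    case 1
    have "((\<lambda>_. 0) has_real_derivative 0) (at s)" by simp
    then have "(flat_exp P has_real_derivative 0) (at s)"
      by (rule has_field_derivative_transform_within_open[of _ _ _ "{..<0}"])
         (use 1 in \<open>auto simp: flat_exp_def\<close>)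
    then show ?thesis using 1 by (simp add: flat_exp_def)
  next
    case 3
    have "((\<lambda>s. poly P (1 / s) * exp (- (1 / s))) has_real_derivative
            poly (monom 1 2 * (P - pderiv P)) (1 / s) * exp (- (1 / s))) (at s)"
      using 3 by (auto intro!: derivative_eq_intros DERIV_chain2[OF poly_DERIV]
          simp: poly_monom field_simps power2_eq_square)
    then have "(flat_exp P has_real_derivative
            poly (monom 1 2 * (P - pderiv P)) (1 / s) * exp (- (1 / s))) (at s)"
      by (rule has_field_derivative_transform_within_open[of _ _ _ "{0<..}"])
         (use 3 in \<open>auto simp: flat_exp_def\<close>)
    then show ?thesis using 3 by (simp add: flat_exp_def)
  next
    case 2
    have "((\<lambda>u. poly (monom 1 1 * P) u * exp (- u)) \<longlongrightarrow> (0::real)) at_top"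
      by (rule poly_times_exp_tendsto_0)
    then have "((\<lambda>h. poly (monom 1 1 * P) (inverse h) * exp (- inverse h)) \<longlongrightarrow> (0::real)) (at_right 0)"
      by (simp add: filterlim_at_top_to_right)
    then have R: "((\<lambda>h. (flat_exp P (0 + h) - flat_exp P 0) / h) \<longlongrightarrow> 0) (at_right 0)"
      by (rule Lim_transform_eventually)
         (auto simp: eventually_at_right_field flat_exp_def poly_monom field_simps intro!: exI[of _ 1])
    have L: "((\<lambda>h. (flat_exp P (0 + h) - flat_exp P 0) / h) \<longlongrightarrow> 0) (at_left 0)"
      by (rule Lim_transform_eventually[of "\<lambda>_. 0"])
         (auto simp: eventually_at_left_field flat_exp_def intro!: exI[of _ "-1"])
    have "(\<lambda>h. (flat_exp P (0 + h) - flat_exp P 0) / h) \<midarrow>0\<rightarrow> 0"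
      using L R by (simp add: filterlim_split_at)
    then have "(flat_exp P has_real_derivative 0) (at 0)"
      by (simp add: DERIV_def)
    then show ?thesis using 2 by (simp add: flat_exp_def)
  qed
qed

lemma smooth_flat_exp: "smooth f \<Longrightarrow> smooth (\<lambda>x. flat_exp P (f x))"
  unfolding smooth_def
  using Ck_compose[of "range flat_exp"] flat_exp_has_derivative by blast

text \<open>Compose the smooth step \<open>H(s) / (H(s) + H(1 - s))\<close>, which is \<open>0\<close> for \<open>s \<le> 0\<close> and \<open>1\<close> for \<open>s \<ge> 1\<close>, with
  the quadratic function \<open>2 - \<bar>x - x0\<bar>\<^sup>2 / r\<^sup>2\<close>.\<close>
lemma exists_bump:
  fixes x0 :: "'a::euclidean_space"
  assumes "0 < r"
  obtains \<zeta> where "smooth \<zeta>" "\<And>x. 0 \<le> \<zeta> x" "\<And>x. \<zeta> x \<le> 1"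
    "\<And>x. x \<in> cball x0 r \<Longrightarrow> \<zeta> x = 1" "\<And>x. x \<notin> ball x0 (2 * r) \<Longrightarrow> \<zeta> x = 0"
proof -
  define F :: "'a \<Rightarrow> real" where "F x = 2 - (\<Sum>b\<in>Basis. (inverse (r\<^sup>2) * ((x \<bullet> b - x0 \<bullet> b) * (x \<bullet> b - x0 \<bullet> b))))" for x
  have F: "F x = 2 - (dist x0 x / r)\<^sup>2" for x
  proof -
    have "(dist x0 x)\<^sup>2 = (\<Sum>b\<in>Basis. (x \<bullet> b - x0 \<bullet> b) * (x \<bullet> b - x0 \<bullet> b))"
      unfolding dist_norm power2_norm_eq_inner
      by (subst euclidean_inner) (auto simp: inner_diff_left algebra_simps)
    then show ?thesis
      unfolding F_def sum_distrib_left[symmetric]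
      by (metis divide_inverse mult.commute power_divide)
  qed
  define H where "H s = flat_exp 1 s" for s
  have Hpos: "0 < H s" if "0 < s" for s using that by (simp add: H_def flat_exp_def)
  have H0: "H s = 0" if "s \<le> 0" for s using that by (simp add: H_def flat_exp_def)
  have Hnn: "0 \<le> H s" for s using Hpos[of s] H0[of s] by linarith
  have den: "0 < H s + H (1 - s)" for s
    using Hpos[of s] Hpos[of "1 - s"] Hnn[of s] Hnn[of "1 - s"]
    by (cases "0 < s") (auto intro: add_pos_nonneg add_nonneg_pos)
  define \<zeta> where "\<zeta> x = H (F x) * inverse (H (F x) + H (1 - F x))" for x
  have sF: "smooth F"
    unfolding F_def by (intro smooth_minus smooth_const smooth_sum smooth_mult smooth_inner)
  show thesis
  proof
    show "smooth \<zeta>"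
      unfolding \<zeta>_def H_def
      by (intro smooth_mult smooth_inverse smooth_add smooth_flat_exp smooth_minus smooth_const sF)
         (use den in \<open>simp add: H_def less_imp_neq[symmetric]\<close>)
    show "0 \<le> \<zeta> x" for x
      unfolding \<zeta>_def using Hnn den[of "F x"] by simp
    show "\<zeta> x \<le> 1" for x
      unfolding \<zeta>_def using Hnn[of "1 - F x"] den[of "F x"] by (simp add: field_simps)
    show "\<zeta> x = 1" if "x \<in> cball x0 r" for x
    proof -
      have "(dist x0 x / r)\<^sup>2 \<le> 1\<^sup>2"
        using that assms by (intro power_mono) (auto simp: field_simps)
      then have "H (1 - F x) = 0" by (intro H0) (simp add: F)
      then show ?thesis unfolding \<zeta>_def using den[of "F x"] by simp
    qed
    show "\<zeta> x = 0" if "x \<notin> ball x0 (2 * r)" for x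
    proof -
      have "2\<^sup>2 \<le> (dist x0 x / r)\<^sup>2"
        using that assms by (intro power_mono) (auto simp: field_simps)
      then have "H (F x) = 0" by (intro H0) (simp add: F)
      then show ?thesis unfolding \<zeta>_def by simp
    qed
  qed
qed

lemma exists_mollifier:
  fixes e :: "'a::euclidean_space"
  assumes "0 < k"
  obtains \<eta> where "smooth \<eta>" "\<And>x. 0 \<le> \<eta> x" "\<And>x. x \<notin> ball e k \<Longrightarrow> \<eta> x = 0"
    "integrable lborel \<eta>" "integral\<^sup>L lborel \<eta> = 1"
proof -
  obtain \<zeta> where \<zeta>: "smooth \<zeta>" "\<And>x. 0 \<le> \<zeta> x" "\<And>x. \<zeta> x \<le> 1"
    "\<And>x. x \<in> cball e (k/2) \<Longrightarrow> \<zeta> x = 1" "\<And>x. x \<notin> ball e (2 * (k/2)) \<Longrightarrow> \<zeta> x = 0"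
    using exists_bump[of "k/2" e] assms by auto
  have int: "integrable lborel \<zeta>"
  proof -
    have "integrable lborel (\<lambda>x. indicator (cball e k) x *\<^sub>R \<zeta> x)"
      by (intro borel_integrable_compact smooth_continuous \<zeta>) auto
    moreover have "(\<lambda>x. indicator (cball e k) x *\<^sub>R \<zeta> x) = \<zeta>"
      using \<zeta>(5) by (force simp: indicator_def)
    ultimately show ?thesis by simp
  qed
  have "0 < measure lborel (cball e (k/2))"
    using content_cball_pos[of "k/2" e] assms by simp
  also have "\<dots> = (\<integral>x. indicator (cball e (k/2)) x \<partial>lborel)" by simp
  also have "\<dots> \<le> integral\<^sup>L lborel \<zeta>"
    using int \<zeta> by (intro integral_mono integrable_real_indicator)
      (auto simp: emeasure_bounded_finite[simplified] split: split_indicator)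
  finally have pos: "0 < integral\<^sup>L lborel \<zeta>" .
  show thesis
  proof (rule that[of "\<lambda>x. inverse (integral\<^sup>L lborel \<zeta>) * \<zeta> x"])
  qed (use pos \<zeta> int in \<open>auto intro!: smooth_mult smooth_const\<close>)
qed

section \<open>Translations and mollification\<close>

lemma nn_integral_translate:
  fixes f :: "'a::euclidean_space \<Rightarrow> ennreal"
  assumes [measurable]: "f \<in> borel_measurable borel"
  shows "(\<integral>\<^sup>+x. f (x + z) \<partial>lborel) = (\<integral>\<^sup>+x. f x \<partial>lborel)"
proof -
  have "(\<integral>\<^sup>+x. f x \<partial>lborel) = (\<integral>\<^sup>+x. f x \<partial>distr lborel borel ((+) z))"
    by (simp add: lborel_distr_plus)
  also have "\<dots> = (\<integral>\<^sup>+x. f (x + z) \<partial>lborel)"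
    by (subst nn_integral_distr) (auto simp: add.commute)
  finally show ?thesis by simp
qed

lemma inner_compact_lborel:
  fixes A :: "'a::euclidean_space set"
  assumes A: "A \<in> sets borel" "emeasure lborel A < \<infinity>" and "0 < e"
  obtains K where "compact K" "K \<subseteq> A" "emeasure lborel (A - K) < ennreal e"
proof -
  obtain T where T: "closed T" "T \<subseteq> A" "emeasure lebesgue (A - T) < ennreal (e/2)"
    using sets_lebesgue_inner_closed[of A "e/2"] A \<open>0 < e\<close> by (metis half_gt_zero sets_completionI_sets sets_lborel)
  have meas: "A - T \<in> sets borel" using T A by auto
  have "(\<lambda>n. emeasure lborel (A - cball 0 (real n))) \<longlonglongrightarrow> emeasure lborel (\<Inter>n. A - cball 0 (real n))"
  proof (rule Lim_emeasure_decseq)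
    show "decseq (\<lambda>n. A - cball 0 (real n))"
      by (intro decseq_SucI) auto
    fix n
    have "emeasure lborel (A - cball 0 (real n)) \<le> emeasure lborel A"
      using A by (intro emeasure_mono) auto
    then show "emeasure lborel (A - cball 0 (real n)) \<noteq> \<infinity>"
      using A by (auto simp: top_unique)
  qed (use A in auto)
  also have "(\<Inter>n. A - cball 0 (real n)) = {}"
  proof -
    have "\<exists>n. x \<in> cball 0 (real n)" for x :: 'a
      using real_arch_simple[of "norm x"] by simp
    then show ?thesis by blast
  qed
  finally have "(\<lambda>n. emeasure lborel (A - cball 0 (real n))) \<longlonglongrightarrow> 0" by simp
  then have "\<forall>\<^sub>F n in sequentially. emeasure lborel (A - cball 0 (real n)) < ennreal (e/2)"
    using \<open>0 < e\<close> by (intro order_tendstoD) auto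
  then obtain n where n: "emeasure lborel (A - cball 0 (real n)) < ennreal (e/2)"
    by (auto simp: eventually_sequentially)
  show thesis
  proof
    show "compact (T \<inter> cball 0 (real n))" using T by (simp add: closed_Int_compact)
    show "T \<inter> cball 0 (real n) \<subseteq> A" using T by auto
    have "emeasure lborel (A - T \<inter> cball 0 (real n)) \<le> emeasure lborel ((A - T) \<union> (A - cball 0 (real n)))"
      using A T by (intro emeasure_mono) auto
    also have "\<dots> \<le> emeasure lborel (A - T) + emeasure lborel (A - cball 0 (real n))"
      using A T by (intro emeasure_subadditive) auto
    also have "\<dots> < ennreal (e/2) + ennreal (e/2)"
      using T(3) meas n by (intro add_strict_mono) auto
    also have "\<dots> = ennreal e" using \<open>0 < e\<close> by (simp flip: ennreal_plus)
    finally show "emeasure lborel (A - T \<inter> cball 0 (real n)) < ennreal e" .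
  qed
qed

text \<open>The property passes to sums and dominated limits, which leaves indicator functions. If
  \<open>K \<subseteq> A \<subseteq> U\<close> with \<open>K\<close> compact and \<open>U\<close> open, a translation by less than the distance from \<open>K\<close> to the
  complement of \<open>U\<close> changes the indicator of \<open>A\<close> only on \<open>U - K\<close> and on a translate of it.\<close>
lemma L1_continuity_of_translation:
  fixes f :: "'a::euclidean_space \<Rightarrow> real"
  assumes "integrable lborel f" "0 < e"
  shows "\<exists>d>0. \<forall>z. norm z < d \<longrightarrow> (\<integral>\<^sup>+x. ennreal \<bar>f (x + z) - f x\<bar> \<partial>lborel) \<le> ennreal e"
  using assms
proof (induction arbitrary: e rule: integrable_induct)
  case (base A c)
  then have A[measurable]: "A \<in> sets borel" and fin: "emeasure lborel A < \<infinity>" by auto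
  define r where "r = e / (4 * (\<bar>c\<bar> + 1))"
  have r: "0 < r" "4 * r * \<bar>c\<bar> \<le> e"
    using base by (auto simp: r_def field_simps)
  obtain K where K: "compact K" "K \<subseteq> A" "emeasure lborel (A - K) < ennreal r"
    using inner_compact_lborel[OF A fin r(1)] .
  obtain U where U: "open U" "A \<subseteq> U" "emeasure lborel (U - A) < ennreal r"
    using outer_regular_lborel[OF A r(1)] by auto
  have [measurable]: "K \<in> sets borel" "U \<in> sets borel"
    using K U by (auto intro: borel_compact)
  obtain d where d: "d > 0" "(\<Union>x\<in>K. ball x d) \<subseteq> U"
    using compact_subset_open_imp_ball_epsilon_subset[OF K(1) U(1)] K U by auto
  have UK: "emeasure lborel (U - K) \<le> ennreal (2 * r)"
  proof -
    have "emeasure lborel (U - K) \<le> emeasure lborel ((U - A) \<union> (A - K))"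
      by (intro emeasure_mono) auto
    also have "\<dots> \<le> emeasure lborel (U - A) + emeasure lborel (A - K)"
      by (intro emeasure_subadditive) auto
    also have "\<dots> \<le> ennreal r + ennreal r"
      using K U by (intro add_mono) auto
    finally show ?thesis using r by (simp flip: ennreal_plus)
  qed
  show ?case
  proof (intro exI conjI allI impI)
    show "0 < d" by fact
    fix z :: 'a assume z: "norm z < d"
    have near: "x \<in> U" if "y \<in> K" "dist y x < d" for x y using that d(2) by (auto simp: subset_iff)
    have pt: "ennreal \<bar>indicator A (x + z) *\<^sub>R c - indicator A x *\<^sub>R c\<bar> \<le>
        ennreal \<bar>c\<bar> * (indicator (U - K) (x + z) + indicator (U - K) x)" for x
      using near[of x "x + z"] near[of "x + z" x] K U z
      by (auto simp: indicator_def dist_norm norm_minus_commute mult_2_right)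
    have "(\<integral>\<^sup>+x. ennreal \<bar>indicator A (x + z) *\<^sub>R c - indicator A x *\<^sub>R c\<bar> \<partial>lborel)
        \<le> (\<integral>\<^sup>+x. ennreal \<bar>c\<bar> * (indicator (U - K) (x + z) + indicator (U - K) x) \<partial>lborel)"
      by (intro nn_integral_mono pt)
    also have "\<dots> = ennreal \<bar>c\<bar> * ((\<integral>\<^sup>+x. indicator (U - K) (x + z) \<partial>lborel) + (\<integral>\<^sup>+x. indicator (U - K) x \<partial>lborel))"
      by (simp add: nn_integral_cmult nn_integral_add)
    also have "\<dots> = ennreal \<bar>c\<bar> * (emeasure lborel (U - K) + emeasure lborel (U - K))"
      by (simp add: nn_integral_translate)
    also have "\<dots> \<le> ennreal \<bar>c\<bar> * (ennreal (2*r) + ennreal (2*r))"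
      by (intro mult_left_mono add_mono UK) auto
    also have "\<dots> = ennreal (4 * r * \<bar>c\<bar>)"
      using r by (simp add: ennreal_plus[symmetric] ennreal_mult[symmetric] mult_ac del: ennreal_plus)
    also have "\<dots> \<le> ennreal e" using r by (intro ennreal_leI)
    finally show "(\<integral>\<^sup>+x. ennreal \<bar>indicator A (x + z) *\<^sub>R c - indicator A x *\<^sub>R c\<bar> \<partial>lborel) \<le> ennreal e" .
  qed
next
  case (add f g)
  have [measurable]: "f \<in> borel_measurable borel" "g \<in> borel_measurable borel"
    using add(1,2) borel_measurable_integrable by auto
  obtain d1 where d1: "d1 > 0" "\<And>z. norm z < d1 \<Longrightarrow> (\<integral>\<^sup>+x. ennreal \<bar>f (x + z) - f x\<bar> \<partial>lborel) \<le> ennreal (e/2)"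
    using add(3)[of "e/2"] add.prems by auto
  obtain d2 where d2: "d2 > 0" "\<And>z. norm z < d2 \<Longrightarrow> (\<integral>\<^sup>+x. ennreal \<bar>g (x + z) - g x\<bar> \<partial>lborel) \<le> ennreal (e/2)"
    using add(4)[of "e/2"] add.prems by auto
  show ?case
  proof (intro exI[of _ "min d1 d2"] conjI allI impI)
    fix z :: 'a assume z: "norm z < min d1 d2"
    have "(\<integral>\<^sup>+x. ennreal \<bar>f (x + z) + g (x + z) - (f x + g x)\<bar> \<partial>lborel)
      \<le> (\<integral>\<^sup>+x. ennreal \<bar>f (x + z) - f x\<bar> + ennreal \<bar>g (x + z) - g x\<bar> \<partial>lborel)"
      by (intro nn_integral_mono) (auto simp flip: ennreal_plus intro!: ennreal_leI)
    also have "\<dots> = (\<integral>\<^sup>+x. ennreal \<bar>f (x + z) - f x\<bar> \<partial>lborel) + (\<integral>\<^sup>+x. ennreal \<bar>g (x + z) - g x\<bar> \<partial>lborel)"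
      by (intro nn_integral_add) auto
    also have "\<dots> \<le> ennreal (e/2) + ennreal (e/2)"
      using d1 d2 z by (intro add_mono) auto
    also have "\<dots> = ennreal e" using add.prems by (simp flip: ennreal_plus)
    finally show "(\<integral>\<^sup>+x. ennreal \<bar>f (x + z) + g (x + z) - (f x + g x)\<bar> \<partial>lborel) \<le> ennreal e" .
  qed (use d1 d2 in auto)
next
  case (lim f s)
  have [measurable]: "f \<in> borel_measurable borel" "\<And>i. s i \<in> borel_measurable borel"
    using lim borel_measurable_integrable by auto
  have "(\<lambda>i. \<integral>x. \<bar>s i x - f x\<bar> \<partial>lborel) \<longlonglongrightarrow> (\<integral>x. 0 \<partial>(lborel::'a measure))"
  proof (rule integral_dominated_convergence[where w = "\<lambda>x. 3 * \<bar>f x\<bar>"])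
    show "AE x in lborel. (\<lambda>i. \<bar>s i x - f x\<bar>) \<longlonglongrightarrow> 0"
      by (intro AE_I2 tendsto_rabs_zero LIM_zero lim)
    show "AE x in lborel. norm \<bar>s i x - f x\<bar> \<le> 3 * \<bar>f x\<bar>" for i
    proof (intro AE_I2)
      fix x
      have "norm (s i x) \<le> 2 * norm (f x)" by (rule lim) simp
      then show "norm \<bar>s i x - f x\<bar> \<le> 3 * \<bar>f x\<bar>" by simp
    qed
  qed (use lim in auto)
  then have "\<forall>\<^sub>F i in sequentially. (\<integral>x. \<bar>s i x - f x\<bar> \<partial>lborel) < e/3"
    using lim.prems by (intro order_tendstoD) auto
  then obtain i where i: "(\<integral>x. \<bar>s i x - f x\<bar> \<partial>lborel) < e/3"
    by (auto simp: eventually_sequentially)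
  have si: "(\<integral>\<^sup>+x. ennreal \<bar>s i x - f x\<bar> \<partial>lborel) \<le> ennreal (e/3)"
    using i lim by (subst nn_integral_eq_integral) (auto intro!: ennreal_leI)
  obtain d where d: "d > 0" "\<And>z. norm z < d \<Longrightarrow> (\<integral>\<^sup>+x. ennreal \<bar>s i (x + z) - s i x\<bar> \<partial>lborel) \<le> ennreal (e/3)"
    using lim.IH[of "e/3" i] lim.prems by auto
  show ?case
  proof (intro exI[of _ d] conjI allI impI)
    fix z :: 'a assume z: "norm z < d"
    have "(\<integral>\<^sup>+x. ennreal \<bar>f (x + z) - f x\<bar> \<partial>lborel)
      \<le> (\<integral>\<^sup>+x. ennreal \<bar>s i (x + z) - f (x + z)\<bar> + (ennreal \<bar>s i (x + z) - s i x\<bar> + ennreal \<bar>s i x - f x\<bar>) \<partial>lborel)"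
      by (intro nn_integral_mono) (auto simp flip: ennreal_plus intro!: ennreal_leI)
    also have "\<dots> = (\<integral>\<^sup>+x. ennreal \<bar>s i (x + z) - f (x + z)\<bar> \<partial>lborel)
        + ((\<integral>\<^sup>+x. ennreal \<bar>s i (x + z) - s i x\<bar> \<partial>lborel) + (\<integral>\<^sup>+x. ennreal \<bar>s i x - f x\<bar> \<partial>lborel))"
      by (simp add: nn_integral_add)
    also have "\<dots> \<le> ennreal (e/3) + (ennreal (e/3) + ennreal (e/3))"
      using d z si by (intro add_mono) (auto simp: nn_integral_translate[of "\<lambda>x. ennreal \<bar>s i x - f x\<bar>"])
    also have "\<dots> = ennreal e" using lim.prems by (simp flip: ennreal_plus)
    finally show "(\<integral>\<^sup>+x. ennreal \<bar>f (x + z) - f x\<bar> \<partial>lborel) \<le> ennreal e" .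
  qed (use d in auto)
qed

lemma translation_pairing_bounded:
  fixes q G :: "'a::euclidean_space \<Rightarrow> real"
  assumes [measurable]: "q \<in> borel_measurable borel" and M: "\<And>x. \<bar>q x\<bar> \<le> M"
    and G: "integrable lborel G" and "0 < e"
  shows "\<exists>d>0. \<forall>z. norm z < d \<longrightarrow> (\<integral>\<^sup>+x. ennreal (\<bar>q x\<bar> * \<bar>G (x + z) - G x\<bar>) \<partial>lborel) \<le> ennreal e"
proof -
  have [measurable]: "G \<in> borel_measurable borel"
    using G borel_measurable_integrable by auto
  have M0: "0 \<le> M" using M[of 0] by linarith
  obtain d where d: "d > 0" "\<And>z. norm z < d \<Longrightarrow> (\<integral>\<^sup>+x. ennreal \<bar>G (x + z) - G x\<bar> \<partial>lborel) \<le> ennreal (e / (M + 1))"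
    using L1_continuity_of_translation[OF G, of "e / (M + 1)"] \<open>0 < e\<close> M0 by auto
  show ?thesis
  proof (intro exI[of _ d] conjI allI impI)
    fix z :: 'a assume z: "norm z < d"
    have "(\<integral>\<^sup>+x. ennreal (\<bar>q x\<bar> * \<bar>G (x + z) - G x\<bar>) \<partial>lborel)
        \<le> (\<integral>\<^sup>+x. ennreal M * ennreal \<bar>G (x + z) - G x\<bar> \<partial>lborel)"
      using M M0 by (intro nn_integral_mono) (auto simp flip: ennreal_mult intro!: ennreal_leI mult_right_mono)
    also have "\<dots> = ennreal M * (\<integral>\<^sup>+x. ennreal \<bar>G (x + z) - G x\<bar> \<partial>lborel)"
      by (simp add: nn_integral_cmult)
    also have "\<dots> \<le> ennreal M * ennreal (e / (M + 1))"
      using d z by (intro mult_left_mono) auto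
    also have "\<dots> \<le> ennreal e"
      using M0 \<open>0 < e\<close> by (auto simp flip: ennreal_mult intro!: ennreal_leI simp: field_simps)
    finally show "(\<integral>\<^sup>+x. ennreal (\<bar>q x\<bar> * \<bar>G (x + z) - G x\<bar>) \<partial>lborel) \<le> ennreal e" .
  qed (use d in auto)
qed

text \<open>Truncating \<open>q\<close> reduces this to a bounded factor and continuity in \<open>L1\<close>; the remainder is small in \<open>L2\<close>
  uniformly in the translation, by Young's inequality.\<close>
lemma translation_pairing_square_integrable:
  fixes q G :: "'a::euclidean_space \<Rightarrow> real"
  assumes [measurable]: "q \<in> borel_measurable borel" and q2: "integrable lborel (\<lambda>x. (q x)\<^sup>2)"
    and G: "integrable lborel G" and G2: "integrable lborel (\<lambda>x. (G x)\<^sup>2)" and "0 < e"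
  shows "\<exists>d>0. \<forall>z. norm z < d \<longrightarrow> (\<integral>\<^sup>+x. ennreal (\<bar>q x\<bar> * \<bar>G (x + z) - G x\<bar>) \<partial>lborel) \<le> ennreal e"
proof -
  have [measurable]: "G \<in> borel_measurable borel"
    using G borel_measurable_integrable by auto
  define I where "I = (\<integral>x. (G x)\<^sup>2 \<partial>lborel)"
  have I0: "0 \<le> I" unfolding I_def by simp
  define \<delta> where "\<delta> = e / (3 * (I + 1))"
  have \<delta>: "0 < \<delta>" "\<delta> * I \<le> e / 3"
    using \<open>0 < e\<close> I0 by (auto simp: \<delta>_def field_simps)
  define p where "p M x = (if \<bar>q x\<bar> \<le> M then q x else 0)" for M x
  have [measurable]: "p M \<in> borel_measurable borel" for M unfolding p_def by measurable
  have "(\<lambda>n. \<integral>x. (q x - p (real n) x)\<^sup>2 \<partial>lborel) \<longlonglongrightarrow> (\<integral>x. 0 \<partial>(lborel::'a measure))"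
  proof (rule integral_dominated_convergence[where w = "\<lambda>x. (q x)\<^sup>2"])
    show "AE x in lborel. (\<lambda>n. (q x - p (real n) x)\<^sup>2) \<longlonglongrightarrow> 0"
    proof (intro AE_I2 tendsto_eventually)
      fix x
      show "\<forall>\<^sub>F n in sequentially. (q x - p (real n) x)\<^sup>2 = 0"
        using eventually_ge_at_top[of "nat \<lceil>\<bar>q x\<bar>\<rceil>"]
      proof eventually_elim
        case (elim n)
        then have "\<bar>q x\<bar> \<le> real n" by linarith
        then show ?case by (simp add: p_def)
      qed
    qed
  qed (use q2 in \<open>auto simp: p_def\<close>)
  then have "\<forall>\<^sub>F n in sequentially. (\<integral>x. (q x - p (real n) x)\<^sup>2 \<partial>lborel) < \<delta> * (e / 3)"
    using \<open>0 < e\<close> \<delta> by (intro order_tendstoD) auto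
  then obtain n where n: "(\<integral>x. (q x - p (real n) x)\<^sup>2 \<partial>lborel) < \<delta> * (e / 3)"
    by (auto simp: eventually_sequentially)
  define M where "M = real n"
  define r where "r x = (q x - p M x)\<^sup>2" for x
  have [measurable]: "r \<in> borel_measurable borel" unfolding r_def by measurable
  have ir: "integrable lborel r"
    by (rule Bochner_Integration.integrable_bound[OF q2]) (auto simp: r_def p_def)
  have rI: "(\<integral>\<^sup>+x. ennreal (r x / \<delta>) \<partial>lborel) \<le> ennreal (e / 3)"
  proof -
    have "(\<integral>\<^sup>+x. ennreal (r x / \<delta>) \<partial>lborel) = ennreal (\<integral>x. r x / \<delta> \<partial>lborel)"
      using ir \<delta> by (intro nn_integral_eq_integral) (auto simp: r_def[abs_def])
    also have "\<dots> \<le> ennreal (e / 3)"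
      using n \<delta> by (intro ennreal_leI) (simp add: r_def M_def field_simps)
    finally show ?thesis .
  qed
  have GI: "(\<integral>\<^sup>+x. ennreal (\<delta> / 2 * (G x)\<^sup>2) \<partial>lborel) \<le> ennreal (e / 6)"
  proof -
    have "(\<integral>\<^sup>+x. ennreal (\<delta> / 2 * (G x)\<^sup>2) \<partial>lborel) = ennreal (\<integral>x. \<delta> / 2 * (G x)\<^sup>2 \<partial>lborel)"
      using G2 \<delta> by (intro nn_integral_eq_integral) auto
    also have "\<dots> \<le> ennreal (e / 6)"
      using \<delta> by (intro ennreal_leI) (simp add: I_def[symmetric] mult.commute)
    finally show ?thesis .
  qed
  have "\<bar>p M x\<bar> \<le> M" for x by (auto simp: p_def M_def)
  then obtain d where d: "d > 0" "\<And>z. norm z < d \<Longrightarrow> (\<integral>\<^sup>+x. ennreal (\<bar>p M x\<bar> * \<bar>G (x + z) - G x\<bar>) \<partial>lborel) \<le> ennreal (e/3)"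
    using translation_pairing_bounded[of "p M" M G "e/3"] G \<open>0 < e\<close> by auto
  show ?thesis
  proof (intro exI[of _ d] conjI allI impI)
    fix z :: 'a assume z: "norm z < d"
    \<comment> \<open>the weight \<open>\<delta>\<close> makes the part with \<open>G\<close> small; the truncation level was chosen after it\<close>
    have young: "a * b \<le> a\<^sup>2 / (2 * \<delta>) + \<delta> / 2 * b\<^sup>2" for a b :: real
    proof -
      have "0 \<le> (a - \<delta> * b)\<^sup>2 / (2 * \<delta>)" using \<delta> by simp
      also have "\<dots> = a\<^sup>2 / (2 * \<delta>) + \<delta> / 2 * b\<^sup>2 - a * b"
        using \<delta> by (simp add: power2_eq_square field_simps)
      finally show ?thesis by simp
    qed
    have pt: "\<bar>q x\<bar> * \<bar>G (x + z) - G x\<bar> \<le>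
      \<bar>p M x\<bar> * \<bar>G (x + z) - G x\<bar> + (r x / \<delta> + (\<delta> / 2 * (G (x + z))\<^sup>2 + \<delta> / 2 * (G x)\<^sup>2))" for x
    proof -
      have "\<bar>q x\<bar> * \<bar>G (x + z) - G x\<bar> \<le> (\<bar>p M x\<bar> + \<bar>q x - p M x\<bar>) * \<bar>G (x + z) - G x\<bar>"
        by (intro mult_right_mono) auto
      also have "\<dots> \<le> \<bar>p M x\<bar> * \<bar>G (x + z) - G x\<bar> + \<bar>q x - p M x\<bar> * (\<bar>G (x + z)\<bar> + \<bar>G x\<bar>)"
        unfolding distrib_right by (intro add_left_mono mult_left_mono) auto
      also have "\<bar>q x - p M x\<bar> * (\<bar>G (x + z)\<bar> + \<bar>G x\<bar>) \<le>
          (r x / (2*\<delta>) + \<delta> / 2 * (G (x + z))\<^sup>2) + (r x / (2*\<delta>) + \<delta> / 2 * (G x)\<^sup>2)"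
        unfolding distrib_left using young[of "\<bar>q x - p M x\<bar>" "\<bar>G (x + z)\<bar>"] young[of "\<bar>q x - p M x\<bar>" "\<bar>G x\<bar>"]
        by (auto simp: r_def)
      also have "\<dots> = r x / \<delta> + (\<delta> / 2 * (G (x + z))\<^sup>2 + \<delta> / 2 * (G x)\<^sup>2)"
        using \<delta> by (simp add: field_simps)
      finally show ?thesis by simp
    qed
    have r0: "0 \<le> r x / \<delta>" for x using \<delta> by (simp add: r_def)
    have "(\<integral>\<^sup>+x. ennreal (\<bar>q x\<bar> * \<bar>G (x + z) - G x\<bar>) \<partial>lborel)
      \<le> (\<integral>\<^sup>+x. ennreal (\<bar>p M x\<bar> * \<bar>G (x + z) - G x\<bar>) + (ennreal (r x / \<delta>) +
          (ennreal (\<delta> / 2 * (G (x + z))\<^sup>2) + ennreal (\<delta> / 2 * (G x)\<^sup>2))) \<partial>lborel)"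
      using pt r0 \<delta> by (intro nn_integral_mono) (auto simp flip: ennreal_plus intro!: ennreal_leI)
    also have "\<dots> = (\<integral>\<^sup>+x. ennreal (\<bar>p M x\<bar> * \<bar>G (x + z) - G x\<bar>) \<partial>lborel) + ((\<integral>\<^sup>+x. ennreal (r x / \<delta>) \<partial>lborel) +
          ((\<integral>\<^sup>+x. ennreal (\<delta> / 2 * (G (x + z))\<^sup>2) \<partial>lborel) + (\<integral>\<^sup>+x. ennreal (\<delta> / 2 * (G x)\<^sup>2) \<partial>lborel)))"
      by (simp add: nn_integral_add)
    also have "\<dots> \<le> ennreal (e/3) + (ennreal (e/3) + (ennreal (e/6) + ennreal (e/6)))"
      using d(2)[OF z] rI GI nn_integral_translate[of "\<lambda>x. ennreal (\<delta> / 2 * (G x)\<^sup>2)" z]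
      by (intro add_mono) auto
    also have "\<dots> = ennreal e" using \<open>0 < e\<close> by (simp flip: ennreal_plus)
    finally show "(\<integral>\<^sup>+x. ennreal (\<bar>q x\<bar> * \<bar>G (x + z) - G x\<bar>) \<partial>lborel) \<le> ennreal e" .
  qed (use d in auto)
qed

lemma mollified_integrable:
  fixes q G \<eta> :: "'a::euclidean_space \<Rightarrow> real"
  assumes q: "integrable lborel q" and G: "integrable lborel G"
    and [measurable]: "\<eta> \<in> borel_measurable borel" and C: "\<And>z. \<bar>\<eta> z\<bar> \<le> C"
  shows "integrable (lborel \<Otimes>\<^sub>M lborel) (\<lambda>(x, y). \<eta> (y - x) * (q x * G y))"
proof -
  have [measurable]: "q \<in> borel_measurable borel" "G \<in> borel_measurable borel"
    using q G borel_measurable_integrable by auto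
  have 1: "integrable (lborel \<Otimes>\<^sub>M lborel) (\<lambda>(x, y). q x * G y)"
  proof (rule lborel_pair.Fubini_integrable)
    have "(\<integral>y. norm (case (x, y) of (x, y) \<Rightarrow> q x * G y) \<partial>lborel) = \<bar>q x\<bar> * (\<integral>y. \<bar>G y\<bar> \<partial>lborel)" for x
      by (simp add: abs_mult)
    then show "integrable lborel (\<lambda>x. \<integral>y. norm (case (x, y) of (x, y) \<Rightarrow> q x * G y) \<partial>lborel)"
      using q by simp
  qed (use G in \<open>auto intro!: AE_I2\<close>)
  have C0: "0 \<le> C" using C[of 0] by linarith
  show ?thesis
  proof (rule Bochner_Integration.integrable_bound)
    show "integrable (lborel \<Otimes>\<^sub>M lborel) (\<lambda>z. C * (case z of (x, y) \<Rightarrow> q x * G y))"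
      using 1 by simp
    show "AE z in lborel \<Otimes>\<^sub>M lborel. norm (case z of (x, y) \<Rightarrow> \<eta> (y - x) * (q x * G y))
        \<le> norm (C * (case z of (x, y) \<Rightarrow> q x * G y))"
      using C C0 by (intro AE_I2) (auto simp: abs_mult split: prod.split intro!: mult_right_mono)
  qed measurable
qed

text \<open>Since the kernel has integral one, the error is the double integral of
  \<open>\<eta> (y - x) q(x) (G(y) - G(x))\<close>. Substituting \<open>y = x + z\<close> and integrating in \<open>x\<close> first bounds it by
  an average over \<open>z\<close>, in the support of the kernel, of the translation errors.\<close>
lemma mollified_pairing_error:
  fixes q G \<eta> :: "'a::euclidean_space \<Rightarrow> real"
  assumes q: "integrable lborel q" and G: "integrable lborel G" and qG: "integrable lborel (\<lambda>x. q x * G x)"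
    and \<eta>: "integrable lborel \<eta>" "\<And>z. 0 \<le> \<eta> z" "integral\<^sup>L lborel \<eta> = 1"
    and C: "\<And>z. \<bar>\<eta> z\<bar> \<le> C" and supp: "\<And>z. d \<le> norm z \<Longrightarrow> \<eta> z = 0"
    and T: "\<And>z. norm z < d \<Longrightarrow> (\<integral>\<^sup>+x. ennreal (\<bar>q x\<bar> * \<bar>G (x + z) - G x\<bar>) \<partial>lborel) \<le> ennreal e"
    and "0 \<le> e"
  shows "\<bar>(\<integral>x. (\<integral>y. \<eta> (y - x) * (q x * G y) \<partial>lborel) \<partial>lborel) - (\<integral>x. q x * G x \<partial>lborel)\<bar> \<le> e"
proof -
  have [measurable]: "q \<in> borel_measurable borel" "G \<in> borel_measurable borel" "\<eta> \<in> borel_measurable borel"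
    using q G \<eta> borel_measurable_integrable by auto
  have shift: "(\<integral>\<^sup>+y. ennreal (\<eta> (y - x)) \<partial>lborel) = 1" for x
  proof -
    have "(\<integral>\<^sup>+y. ennreal (\<eta> (y - x)) \<partial>lborel) = (\<integral>\<^sup>+y. ennreal (\<eta> y) \<partial>lborel)"
      using nn_integral_translate[of "\<lambda>y. ennreal (\<eta> y)" "- x"] by simp
    also have "\<dots> = 1" using \<eta> by (subst nn_integral_eq_integral) auto
    finally show ?thesis .
  qed
  have shift_int: "integrable lborel (\<lambda>y. \<eta> (y - x))" for x
    using shift[of x] \<eta> by (intro integrableI_nn_integral_finite[where x = 1]) auto
  have shift_I: "(\<integral>y. \<eta> (y - x) \<partial>lborel) = 1" for x
    using shift[of x] \<eta> by (subst integral_eq_nn_integral) auto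
  have i1: "integrable (lborel \<Otimes>\<^sub>M lborel) (\<lambda>(x, y). \<eta> (y - x) * (q x * G y))"
    by (rule mollified_integrable[OF q G _ C]) measurable
  have i2: "integrable (lborel \<Otimes>\<^sub>M lborel) (\<lambda>(x, y). \<eta> (y - x) * (q x * G x))"
  proof (rule lborel_pair.Fubini_integrable)
    have "(\<integral>y. norm (case (x, y) of (x, y) \<Rightarrow> \<eta> (y - x) * (q x * G x)) \<partial>lborel) = \<bar>q x * G x\<bar>" for x
      using \<eta>(2) shift_I by (simp add: abs_mult)
    then show "integrable lborel (\<lambda>x. \<integral>y. norm (case (x, y) of (x, y) \<Rightarrow> \<eta> (y - x) * (q x * G x)) \<partial>lborel)"
      using qG by simp
  qed (use shift_int in \<open>auto intro!: AE_I2\<close>)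
  let ?F = "\<lambda>(x, y). \<eta> (y - x) * (q x * G y) - \<eta> (y - x) * (q x * G x)"
  have i3: "integrable (lborel \<Otimes>\<^sub>M lborel) ?F"
    using Bochner_Integration.integrable_diff[OF i1 i2] by (simp add: case_prod_unfold)
  have "(\<integral>x. (\<integral>y. \<eta> (y - x) * (q x * G y) \<partial>lborel) \<partial>lborel) - (\<integral>x. q x * G x \<partial>lborel)
    = (\<integral>x. (\<integral>y. \<eta> (y - x) * (q x * G y) \<partial>lborel) \<partial>lborel) - (\<integral>x. (\<integral>y. \<eta> (y - x) * (q x * G x) \<partial>lborel) \<partial>lborel)"
    using shift_I by simp
  also have "\<dots> = (\<integral>z. (case z of (x, y) \<Rightarrow> \<eta> (y - x) * (q x * G y)) \<partial>(lborel \<Otimes>\<^sub>M lborel))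
      - (\<integral>z. (case z of (x, y) \<Rightarrow> \<eta> (y - x) * (q x * G x)) \<partial>(lborel \<Otimes>\<^sub>M lborel))"
    using lborel_pair.integral_fst[OF i1] lborel_pair.integral_fst[OF i2] by simp
  also have "\<dots> = (\<integral>z. ?F z \<partial>(lborel \<Otimes>\<^sub>M lborel))"
    using Bochner_Integration.integral_diff[OF i1 i2] by (simp add: case_prod_unfold)
  finally have eq: "(\<integral>x. (\<integral>y. \<eta> (y - x) * (q x * G y) \<partial>lborel) \<partial>lborel) - (\<integral>x. q x * G x \<partial>lborel)
      = (\<integral>z. ?F z \<partial>(lborel \<Otimes>\<^sub>M lborel))" .
  have "ennreal (norm (\<integral>z. ?F z \<partial>(lborel \<Otimes>\<^sub>M lborel))) \<le> (\<integral>\<^sup>+z. norm (?F z) \<partial>(lborel \<Otimes>\<^sub>M lborel))"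
    by (rule integral_norm_bound_ennreal[OF i3])
  also have "\<dots> = (\<integral>\<^sup>+x. (\<integral>\<^sup>+y. ennreal (\<eta> (y - x) * (\<bar>q x\<bar> * \<bar>G y - G x\<bar>)) \<partial>lborel) \<partial>lborel)"
  proof -
    have "norm (?F (x, y)) = \<eta> (y - x) * (\<bar>q x\<bar> * \<bar>G y - G x\<bar>)" for x y
      using \<eta>(2)[of "y - x"]
      by (simp add: right_diff_distrib[symmetric] abs_mult)
    then show ?thesis
      by (subst lborel.nn_integral_fst[symmetric]) auto
  qed
  also have "\<dots> = (\<integral>\<^sup>+x. (\<integral>\<^sup>+z. ennreal (\<eta> z * (\<bar>q x\<bar> * \<bar>G (x + z) - G x\<bar>)) \<partial>lborel) \<partial>lborel)"
  proof (rule nn_integral_cong)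
    fix x :: 'a
    show "(\<integral>\<^sup>+y. ennreal (\<eta> (y - x) * (\<bar>q x\<bar> * \<bar>G y - G x\<bar>)) \<partial>lborel)
      = (\<integral>\<^sup>+z. ennreal (\<eta> z * (\<bar>q x\<bar> * \<bar>G (x + z) - G x\<bar>)) \<partial>lborel)"
      using nn_integral_translate[of "\<lambda>y. ennreal (\<eta> (y - x) * (\<bar>q x\<bar> * \<bar>G y - G x\<bar>))" x]
      by (simp add: add.commute)
  qed
  also have "\<dots> = (\<integral>\<^sup>+z. (\<integral>\<^sup>+x. ennreal (\<eta> z * (\<bar>q x\<bar> * \<bar>G (x + z) - G x\<bar>)) \<partial>lborel) \<partial>lborel)"
    by (rule lborel_pair.Fubini') measurable
  also have "\<dots> = (\<integral>\<^sup>+z. ennreal (\<eta> z) * (\<integral>\<^sup>+x. ennreal (\<bar>q x\<bar> * \<bar>G (x + z) - G x\<bar>) \<partial>lborel) \<partial>lborel)"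
    using \<eta>(2) by (intro nn_integral_cong) (simp add: ennreal_mult nn_integral_cmult)
  also have "\<dots> \<le> (\<integral>\<^sup>+z. ennreal (\<eta> z) * ennreal e \<partial>lborel)"
  proof (rule nn_integral_mono)
    fix z
    show "ennreal (\<eta> z) * (\<integral>\<^sup>+x. ennreal (\<bar>q x\<bar> * \<bar>G (x + z) - G x\<bar>) \<partial>lborel) \<le> ennreal (\<eta> z) * ennreal e"
      using T[of z] supp[of z] by (cases "norm z < d") (auto intro: mult_left_mono)
  qed
  also have "\<dots> = ennreal e"
    using shift[of 0] by (simp add: nn_integral_multc)
  finally show ?thesis
    unfolding eq using \<open>0 \<le> e\<close> by (simp add: ennreal_le_iff)
qed

section \<open>Local integrability\<close>

lemma borel_imp_lebesgue_on:
  "f \<in> borel_measurable borel \<Longrightarrow> f \<in> borel_measurable (lebesgue_on S)"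
  by (intro measurable_restrict_space1 measurable_completion) simp

text \<open>The product measure of two completed measures does not make \<open>(x, y) \<mapsto> f (y - x)\<close> measurable for
  Lebesgue measurable \<open>f\<close>. Arguments with Fubini's theorem therefore use Borel representatives.\<close>
lemma borel_representative:
  fixes f :: "'a::euclidean_space \<Rightarrow> real"
  assumes f: "f \<in> borel_measurable (lebesgue_on S)" and S: "S \<in> sets borel"
  obtains f' where "f' \<in> borel_measurable borel" "\<And>x. x \<notin> S \<Longrightarrow> f' x = 0"
    "AE x in lebesgue_on S. f x = f' x"
proof -
  have Sl: "S \<in> sets lebesgue" using S by auto
  have "(\<lambda>x. if x \<in> S then f x else 0) \<in> borel_measurable lebesgue"
    by (rule borel_measurable_if_I[OF f Sl])
  then obtain g where g: "g \<in> borel_measurable lborel" "AE x in lborel. (if x \<in> S then f x else 0) = g x"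
    using completion_ex_borel_measurable_real by blast
  show thesis
  proof
    show "(\<lambda>x. if x \<in> S then g x else 0) \<in> borel_measurable borel"
      using g S by auto
    have "AE x in lebesgue. (if x \<in> S then f x else 0) = g x"
      using g(2) by (rule AE_completion)
    then show "AE x in lebesgue_on S. f x = (if x \<in> S then g x else 0)"
      using Sl by (subst AE_restrict_space_iff) (auto elim!: AE_mp)
  qed auto
qed

lemma integrable_lebesgue_on_borel:
  fixes h :: "'a::euclidean_space \<Rightarrow> real"
  assumes "S \<in> sets borel" "h \<in> borel_measurable borel" "\<And>x. x \<notin> S \<Longrightarrow> h x = 0"
  shows "integrable (lebesgue_on S) h \<longleftrightarrow> integrable lborel h"
    and "integral\<^sup>L (lebesgue_on S) h = integral\<^sup>L lborel h"
proof -
  have eq: "(\<lambda>x. indicator S x * h x) = h"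
    using assms(3) by (force simp: indicator_def)
  show "integrable (lebesgue_on S) h \<longleftrightarrow> integrable lborel h"
    using assms by (subst integrable_restrict_space) (auto simp: eq integrable_completion)
  show "integral\<^sup>L (lebesgue_on S) h = integral\<^sup>L lborel h"
    using assms by (subst integral_restrict_space) (auto simp: eq integral_completion)
qed

lemma integrable_lebesgue_on_subset:
  fixes h :: "'a::euclidean_space \<Rightarrow> real"
  assumes "K \<subseteq> S" "K \<in> sets lebesgue" "S \<in> sets lebesgue" "\<And>x. x \<in> S - K \<Longrightarrow> h x = 0"
  shows "integrable (lebesgue_on S) h \<longleftrightarrow> integrable (lebesgue_on K) h"
    and "integral\<^sup>L (lebesgue_on S) h = integral\<^sup>L (lebesgue_on K) h"
proof -
  have eq: "(\<lambda>x. if x \<in> S then h x else 0) = (\<lambda>x. if x \<in> K then h x else 0)"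
    using assms(1,4) by force
  show "integrable (lebesgue_on S) h \<longleftrightarrow> integrable (lebesgue_on K) h"
    using Lebesgue_Measure.integrable_restrict_UNIV[of S h] Lebesgue_Measure.integrable_restrict_UNIV[of K h] assms(2,3) eq by simp
  show "integral\<^sup>L (lebesgue_on S) h = integral\<^sup>L (lebesgue_on K) h"
    using Lebesgue_Measure.integral_restrict_UNIV[of S h] Lebesgue_Measure.integral_restrict_UNIV[of K h] assms(2,3) eq by simp
qed

lemma integrable_mult_bounded:
  fixes h \<phi> :: "'a \<Rightarrow> real"
  assumes "integrable M h" "\<phi> \<in> borel_measurable M" "\<And>x. x \<in> space M \<Longrightarrow> \<bar>\<phi> x\<bar> \<le> C"
  shows "integrable M (\<lambda>x. h x * \<phi> x)"
proof (rule Bochner_Integration.integrable_bound)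
  show "integrable M (\<lambda>x. C * h x)" using assms by simp
  show "AE x in M. norm (h x * \<phi> x) \<le> norm (C * h x)"
  proof (rule AE_I2)
    fix x assume x: "x \<in> space M"
    have "\<bar>h x\<bar> * \<bar>\<phi> x\<bar> \<le> \<bar>h x\<bar> * \<bar>C\<bar>"
      using assms(3)[OF x] by (intro mult_left_mono) auto
    then show "norm (h x * \<phi> x) \<le> norm (C * h x)" by (simp add: abs_mult mult.commute)
  qed
qed (use assms in auto)

lemma locally_integrable_times_continuous:
  fixes h \<phi> :: "'a::euclidean_space \<Rightarrow> real"
  assumes h: "locally_integrable \<Omega> h" and \<phi>: "continuous_on UNIV \<phi>" "\<And>x. x \<notin> K \<Longrightarrow> \<phi> x = 0"
    and K: "compact K" "K \<subseteq> \<Omega>" and \<Omega>: "open \<Omega>"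
  shows "integrable (lebesgue_on \<Omega>) (\<lambda>x. h x * \<phi> x)"
proof -
  have "bounded (\<phi> ` K)"
    by (intro compact_imp_bounded compact_continuous_image continuous_on_subset[OF \<phi>(1)] K) auto
  then obtain C where C: "\<And>x. x \<in> K \<Longrightarrow> \<bar>\<phi> x\<bar> \<le> C"
    by (auto simp: bounded_iff)
  have "integrable (lebesgue_on K) (\<lambda>x. h x * \<phi> x)"
  proof (rule integrable_mult_bounded)
    show "integrable (lebesgue_on K) h"
      using h K by (auto simp: locally_integrable_def)
    show "\<phi> \<in> borel_measurable (lebesgue_on K)"
      using \<phi> by (intro borel_imp_lebesgue_on borel_measurable_continuous_onI)
  qed (use C in auto)
  then show ?thesis
    using K \<Omega> \<phi> by (subst integrable_lebesgue_on_subset(1)[of K]) (auto simp: borel_compact)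
qed

lemma test_functions_support:
  assumes "\<phi> \<in> test_functions \<Omega>"
  obtains K where "compact K" "K \<subseteq> \<Omega>" "\<forall>x. x \<notin> K \<longrightarrow> \<phi> x = 0 \<and> gradient \<phi> x = 0"
proof
  let ?K = "closure {x. \<phi> x \<noteq> 0}"
  show "compact ?K" "?K \<subseteq> \<Omega>" using assms by (auto simp: test_functions_def)
  show "\<forall>x. x \<notin> ?K \<longrightarrow> \<phi> x = 0 \<and> gradient \<phi> x = 0"
    using closure_subset[of "{x. \<phi> x \<noteq> 0}"] gradient_eq_0[of _ \<phi>] by auto
qed

lemma test_functionsI:
  assumes "smooth \<phi>" "compact K" "K \<subseteq> \<Omega>" "\<And>x. x \<notin> K \<Longrightarrow> \<phi> x = 0"
  shows "\<phi> \<in> test_functions \<Omega>"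
proof -
  have "closure {x. \<phi> x \<noteq> 0} \<subseteq> K"
    using assms by (intro closure_minimal) (auto simp: compact_imp_closed)
  then show ?thesis
    using assms unfolding test_functions_def
    by (auto simp: compact_eq_bounded_closed intro: bounded_subset)
qed

lemma test_functions_smooth: "\<phi> \<in> test_functions \<Omega> \<Longrightarrow> smooth \<phi>"
  by (simp add: test_functions_def)

lemma test_functions_mono: "\<phi> \<in> test_functions \<Omega> \<Longrightarrow> \<Omega> \<subseteq> \<Omega>' \<Longrightarrow> \<phi> \<in> test_functions \<Omega>'"
  by (auto simp: test_functions_def)

lemma test_functions_mult:
  assumes "\<phi> \<in> test_functions \<Omega>" "smooth f"
  shows "(\<lambda>x. f x * \<phi> x) \<in> test_functions \<Omega>"
proof -
  obtain K where "compact K" "K \<subseteq> \<Omega>" "\<forall>x. x \<notin> K \<longrightarrow> \<phi> x = 0 \<and> gradient \<phi> x = 0"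
    using test_functions_support[OF assms(1)] .
  then show ?thesis
    using smooth_mult[OF assms(2) test_functions_smooth[OF assms(1)]]
    by (intro test_functionsI[of _ K]) auto
qed

lemma integrable_times_test:
  assumes h: "locally_integrable \<Omega> h" and \<phi>: "\<phi> \<in> test_functions \<Omega>" and \<Omega>: "open \<Omega>"
  shows "integrable (lebesgue_on \<Omega>) (\<lambda>x. h x * \<phi> x)"
    and "b \<in> Basis \<Longrightarrow> integrable (lebesgue_on \<Omega>) (\<lambda>x. h x * (gradient \<phi> x \<bullet> b))"
proof -
  obtain K where K: "compact K" "K \<subseteq> \<Omega>" "\<forall>x. x \<notin> K \<longrightarrow> \<phi> x = 0 \<and> gradient \<phi> x = 0"
    using test_functions_support[OF \<phi>] .
  have s: "smooth \<phi>" using \<phi> by (rule test_functions_smooth)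
  show "integrable (lebesgue_on \<Omega>) (\<lambda>x. h x * \<phi> x)"
    using K(3) by (intro locally_integrable_times_continuous[OF h smooth_continuous[OF s] _ K(1,2) \<Omega>]) auto
  show "integrable (lebesgue_on \<Omega>) (\<lambda>x. h x * (gradient \<phi> x \<bullet> b))" if "b \<in> Basis"
    using K(3) by (intro locally_integrable_times_continuous[OF h
          smooth_continuous[OF smooth_gradient_inner[OF s that]] _ K(1,2) \<Omega>]) auto
qed

lemma locally_integrable_inner:
  "locally_integrable \<Omega> G \<Longrightarrow> locally_integrable \<Omega> (\<lambda>x. G x \<bullet> b)"
  by (auto simp: locally_integrable_def)

lemma locally_integrable_diff:
  "locally_integrable \<Omega> G \<Longrightarrow> locally_integrable \<Omega> H \<Longrightarrow> locally_integrable \<Omega> (\<lambda>x. G x - H x)"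
  by (auto simp: locally_integrable_def)

lemma locally_integrable_subset:
  "locally_integrable \<Omega> G \<Longrightarrow> S \<subseteq> \<Omega> \<Longrightarrow> locally_integrable S G"
  by (auto simp: locally_integrable_def)

section \<open>Uniqueness of weak derivatives\<close>

lemma mollifier_in_test_functions:
  assumes "smooth \<eta>" "\<And>z. z \<notin> ball e k \<Longrightarrow> \<eta> z = 0"
  shows "cball (x + e) k \<subseteq> \<Omega> \<Longrightarrow> (\<lambda>y. \<eta> (y - x)) \<in> test_functions \<Omega>"
    and "cball (x - e) k \<subseteq> \<Omega> \<Longrightarrow> (\<lambda>y. \<eta> (x - y)) \<in> test_functions \<Omega>"
proof -
  have "\<eta> (y - x) = 0" if "y \<notin> cball (x + e) k" for y
    using that by (intro assms) (auto simp: dist_norm algebra_simps)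
  then show "cball (x + e) k \<subseteq> \<Omega> \<Longrightarrow> (\<lambda>y. \<eta> (y - x)) \<in> test_functions \<Omega>"
    using smooth_affine[OF assms(1), of 1 "-x"]
    by (intro test_functionsI[of _ "cball (x + e) k"]) auto
  have "\<eta> (x - y) = 0" if "y \<notin> cball (x - e) k" for y
  proof (rule assms)
    have "e - (x - y) = - (x - e - y)" by simp
    then have "norm (e - (x - y)) = norm (x - e - y)"
      by (metis norm_minus_cancel)
    with that show "x - y \<notin> ball e k" by (auto simp: dist_norm)
  qed
  then show "cball (x - e) k \<subseteq> \<Omega> \<Longrightarrow> (\<lambda>y. \<eta> (x - y)) \<in> test_functions \<Omega>"
    using smooth_affine[OF assms(1), of "-1" x]
    by (intro test_functionsI[of _ "cball (x - e) k"]) auto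
qed

lemma mollifier_bounded:
  fixes \<eta> :: "'a::euclidean_space \<Rightarrow> real"
  assumes "smooth \<eta>" "\<And>z. z \<notin> ball e k \<Longrightarrow> \<eta> z = 0"
  obtains C where "\<And>z. \<bar>\<eta> z\<bar> \<le> C"
proof -
  have "bounded (\<eta> ` cball e k)"
    by (intro compact_imp_bounded compact_continuous_image smooth_continuous assms) auto
  then obtain C where "\<forall>y\<in>\<eta> ` cball e k. norm y \<le> C"
    unfolding bounded_iff by blast
  then have C: "\<bar>\<eta> x\<bar> \<le> C" if "x \<in> cball e k" for x
    using that by auto
  have "\<bar>\<eta> z\<bar> \<le> max C 0" for z
  proof (cases "z \<in> ball e k")
    case True
    then have "\<bar>\<eta> z\<bar> \<le> C" by (intro C) auto
    then show ?thesis by simp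
  qed (use assms(2) in simp)
  with that show thesis .
qed

text \<open>On a compact subset \<open>K\<close>, pair the mollification of \<open>D\<close> with \<open>sgn D\<close> restricted to \<open>K\<close>. Each translate
  \<open>\<eta> (\<cdot> - x)\<close> of a small kernel with \<open>x \<in> K\<close> is a test function, so the mollified pairing vanishes,
  while it converges to the integral of \<open>\<bar>D\<bar>\<close> over \<open>K\<close>.\<close>
lemma fundamental_lemma:
  fixes D :: "'a::euclidean_space \<Rightarrow> real"
  assumes \<Omega>: "open \<Omega>" and D: "locally_integrable \<Omega> D"
    and test: "\<And>\<phi>. \<phi> \<in> test_functions \<Omega> \<Longrightarrow> (\<integral>x. D x * \<phi> x \<partial>lebesgue_on \<Omega>) = 0"
  shows "AE x in lebesgue_on \<Omega>. D x = 0"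
proof -
  have main: "AE x in lebesgue. x \<in> K \<longrightarrow> D x = 0" if K: "compact K" "K \<subseteq> \<Omega>" for K
  proof -
    obtain r where r: "r > 0" "(\<Union>x\<in>K. ball x r) \<subseteq> \<Omega>"
      using compact_subset_open_imp_ball_epsilon_subset[OF K(1) \<Omega> K(2)] .
    define K' where "K' = {x + y |x y. x \<in> K \<and> y \<in> cball 0 (r/2)}"
    have K': "compact K'" unfolding K'_def using K by (intro compact_sums) auto
    have KK': "K \<subseteq> K'"
    proof
      fix x assume "x \<in> K"
      then have "x + 0 \<in> K'"
        unfolding K'_def using r by (intro CollectI exI conjI refl) auto
      then show "x \<in> K'" by simp
    qed
    have cb: "cball x (r/2) \<subseteq> K'" if "x \<in> K" for x
    proof
      fix y assume "y \<in> cball x (r/2)"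
      then have "y - x \<in> cball 0 (r/2)" by (simp add: dist_norm norm_minus_commute)
      then have "x + (y - x) \<in> K'"
        unfolding K'_def using that by blast
      then show "y \<in> K'" by simp
    qed
    have K'\<Omega>: "K' \<subseteq> \<Omega>"
    proof
      fix z assume "z \<in> K'"
      then obtain x y where "x \<in> K" "norm y \<le> r/2" "z = x + y" by (auto simp: K'_def)
      then have "z \<in> ball x r" using r by (auto simp: dist_norm)
      with \<open>x \<in> K\<close> r show "z \<in> \<Omega>" by blast
    qed
    have [measurable]: "K \<in> sets borel" "K' \<in> sets borel" using K K' borel_compact by auto
    have iD: "integrable (lebesgue_on K') D"
      using D K' K'\<Omega> by (auto simp: locally_integrable_def)
    obtain D' where D': "D' \<in> borel_measurable borel" "\<And>x. x \<notin> K' \<Longrightarrow> D' x = 0"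
        "AE x in lebesgue_on K'. D x = D' x"
      using borel_representative[OF borel_measurable_integrable[OF iD] \<open>K' \<in> sets borel\<close>] by blast
    note [measurable] = D'(1)
    have iD': "integrable lborel D'"
    proof -
      have "integrable (lebesgue_on K') D'"
        by (rule integrable_cong_AE_imp[OF iD borel_imp_lebesgue_on[OF D'(1)] D'(3)])
      then show ?thesis
        using integrable_lebesgue_on_borel(1)[OF \<open>K' \<in> sets borel\<close> D'(1,2)] by simp
    qed
    \<comment> \<open>pairing with this sign function gives the integral of \<open>\<bar>D\<bar>\<close> over \<open>K\<close>\<close>
    define s where "s x = (if x \<in> K then sgn (D' x) else 0)" for x
    have s_meas [measurable]: "s \<in> borel_measurable borel" unfolding s_def by measurable
    have s1: "\<bar>s x\<bar> \<le> 1" for x by (auto simp: s_def sgn_if)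
    have int_s: "integrable lborel s"
    proof (rule Bochner_Integration.integrable_bound)
      show "integrable lborel (indicator K :: 'a \<Rightarrow> real)"
        using emeasure_compact_finite[OF K(1)] by (intro integrable_real_indicator) auto
      show "AE x in lborel. norm (s x) \<le> norm (indicator K x :: real)"
        by (auto simp: s_def sgn_if)
    qed auto
    have isD: "integrable lborel (\<lambda>x. s x * D' x)"
      using integrable_mult_bounded[OF iD', of s 1] s1 by (simp add: mult.commute)
    have small: "\<bar>\<integral>x. s x * D' x \<partial>lborel\<bar> \<le> e" if e: "0 < e" for e
    proof -
      obtain d where d: "d > 0" "\<And>z. norm z < d \<Longrightarrow> (\<integral>\<^sup>+x. ennreal (\<bar>s x\<bar> * \<bar>D' (x + z) - D' x\<bar>) \<partial>lborel) \<le> ennreal e"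
        using translation_pairing_bounded[OF s_meas s1 iD' e] by blast
      define k where "k = min d (r/2)"
      have k: "0 < k" "k \<le> d" "k \<le> r/2" using d r by (auto simp: k_def)
      obtain \<eta> where \<eta>: "smooth \<eta>" "\<And>x. 0 \<le> \<eta> x" "\<And>x. x \<notin> ball (0::'a) k \<Longrightarrow> \<eta> x = 0"
          "integrable lborel \<eta>" "integral\<^sup>L lborel \<eta> = 1"
        using exists_mollifier[OF k(1)] by metis
      obtain C where C: "\<And>z. \<bar>\<eta> z\<bar> \<le> C" using mollifier_bounded[OF \<eta>(1,3)] by blast
      have [measurable]: "\<eta> \<in> borel_measurable borel"
        using \<eta>(1) by (intro borel_measurable_continuous_onI smooth_continuous)
      have inner: "(\<integral>y. \<eta> (y - x) * (s x * D' y) \<partial>lborel) = 0" for x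
      proof (cases "x \<in> K")
        case True
        have sub: "cball (x + 0) k \<subseteq> K'" using cb[OF True] k by auto
        then have "(\<lambda>y. \<eta> (y - x)) \<in> test_functions \<Omega>"
          using K'\<Omega> \<eta>(1,3) by (intro mollifier_in_test_functions(1)[where e = 0 and k = k]) auto
        from test[OF this] have 0: "(\<integral>y. D y * \<eta> (y - x) \<partial>lebesgue_on \<Omega>) = 0" .
        have off: "\<eta> (y - x) = 0" if "y \<notin> K'" for y
          using that sub by (intro \<eta>(3)) (auto simp: dist_norm norm_minus_commute subset_iff)
        have "(\<integral>y. D y * \<eta> (y - x) \<partial>lebesgue_on \<Omega>) = (\<integral>y. D y * \<eta> (y - x) \<partial>lebesgue_on K')"
          using \<Omega> K'\<Omega> off by (intro integrable_lebesgue_on_subset(2)) auto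
        also have "\<dots> = (\<integral>y. D' y * \<eta> (y - x) \<partial>lebesgue_on K')"
        proof (rule integral_cong_AE)
          show "(\<lambda>y. D' y * \<eta> (y - x)) \<in> borel_measurable (lebesgue_on K')"
            by (intro borel_imp_lebesgue_on) measurable
          show "(\<lambda>y. D y * \<eta> (y - x)) \<in> borel_measurable (lebesgue_on K')"
            using iD by (intro borel_measurable_times borel_measurable_integrable[OF iD] borel_imp_lebesgue_on) measurable
        qed (use D'(3) in auto)
        also have "\<dots> = (\<integral>y. D' y * \<eta> (y - x) \<partial>lborel)"
          using D'(2) by (intro integrable_lebesgue_on_borel(2)) auto
        finally have "(\<integral>y. D' y * \<eta> (y - x) \<partial>lborel) = 0" using 0 by simp
        then have "(\<integral>y. s x * (D' y * \<eta> (y - x)) \<partial>lborel) = 0" by simp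
        then show ?thesis by (simp add: mult_ac)
      qed (simp add: s_def)
      have "\<bar>(\<integral>x. (\<integral>y. \<eta> (y - x) * (s x * D' y) \<partial>lborel) \<partial>lborel) - (\<integral>x. s x * D' x \<partial>lborel)\<bar> \<le> e"
        using e d(2) k by (intro mollified_pairing_error[OF int_s iD' isD \<eta>(4,2,5) C, of d] \<eta>(3)) auto
      then show ?thesis by (simp add: inner)
    qed
    have "\<bar>\<integral>x. s x * D' x \<partial>lborel\<bar> \<le> 0"
      by (rule field_le_epsilon) (simp add: small)
    then have z: "(\<integral>x. s x * D' x \<partial>lborel) = 0" by simp
    have "AE x in lborel. s x * D' x = 0"
    proof (subst integral_nonneg_eq_0_iff_AE[symmetric])
      show "AE x in lborel. 0 \<le> s x * D' x"
        by (intro AE_I2) (auto simp: s_def sgn_if)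
    qed (use isD z in auto)
    then have 1: "AE x in lebesgue. s x * D' x = 0" by (rule AE_completion)
    have 2: "AE x in lebesgue. x \<in> K' \<longrightarrow> D x = D' x"
      using D'(3) by (subst (asm) AE_restrict_space_iff) auto
    show ?thesis
      using 1 2
    proof eventually_elim
      case (elim x)
      then show ?case using KK' by (auto simp: s_def sgn_if split: if_splits)
    qed
  qed
  have "\<exists>C :: nat \<Rightarrow> 'a set. (\<forall>n. compact (C n)) \<and> (\<forall>n. C n \<subseteq> \<Omega>) \<and> \<Union>(range C) = \<Omega>"
    by (rule open_Union_compact_subsets[OF \<Omega>]) blast
  then obtain C :: "nat \<Rightarrow> 'a set" where C: "\<And>n. compact (C n)" "\<And>n. C n \<subseteq> \<Omega>" "\<Union>(range C) = \<Omega>"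
    by blast
  have "AE x in lebesgue. \<forall>n::nat. x \<in> C n \<longrightarrow> D x = 0"
    unfolding AE_all_countable using main[OF C(1,2)] by blast
  then have "AE x in lebesgue. x \<in> \<Omega> \<longrightarrow> D x = 0"
    by eventually_elim (use C(3) in blast)
  then show ?thesis
    using \<Omega> by (subst AE_restrict_space_iff) auto
qed

lemma AE_Basis_eqI:
  fixes G H :: "'b \<Rightarrow> 'a::euclidean_space"
  assumes "\<And>b. b \<in> Basis \<Longrightarrow> AE x in M. G x \<bullet> b - H x \<bullet> b = 0"
  shows "AE x in M. G x = H x"
proof -
  have "AE x in M. \<forall>b\<in>Basis. G x \<bullet> b - H x \<bullet> b = 0"
    using assms by (intro AE_finite_allI) auto
  then show ?thesis
    by eventually_elim (rule euclidean_eqI, simp)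
qed

lemma has_weak_gradient_unique:
  assumes \<Omega>: "open \<Omega>" and G: "has_weak_gradient \<Omega> u G" and H: "has_weak_gradient \<Omega> u H"
  shows "AE x in lebesgue_on \<Omega>. G x = H x"
proof (rule AE_Basis_eqI)
  fix b :: 'a assume b: "b \<in> Basis"
  have "locally_integrable \<Omega> G" "locally_integrable \<Omega> H"
    using G H unfolding has_weak_gradient_def by blast+
  note l = this[THEN locally_integrable_inner[where b = b]]
  show "AE x in lebesgue_on \<Omega>. G x \<bullet> b - H x \<bullet> b = 0"
  proof (rule fundamental_lemma[OF \<Omega> locally_integrable_diff[OF l]])
    fix \<phi> assume \<phi>: "\<phi> \<in> test_functions \<Omega>"
    have "(\<integral>x. (G x \<bullet> b) * \<phi> x \<partial>lebesgue_on \<Omega>) = (\<integral>x. (H x \<bullet> b) * \<phi> x \<partial>lebesgue_on \<Omega>)"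
      using G H \<phi> b unfolding has_weak_gradient_def by (metis (no_types, lifting) neg_equal_iff_equal)
    then show "(\<integral>x. (G x \<bullet> b - H x \<bullet> b) * \<phi> x \<partial>lebesgue_on \<Omega>) = 0"
      using integrable_times_test(1)[OF l(1) \<phi> \<Omega>] integrable_times_test(1)[OF l(2) \<phi> \<Omega>]
      by (simp add: left_diff_distrib)
  qed
qed

lemma has_weak_divergence_unique:
  assumes \<Omega>: "open \<Omega>" and G: "has_weak_divergence \<Omega> p D" and H: "has_weak_divergence \<Omega> p E"
  shows "AE x in lebesgue_on \<Omega>. D x = E x"
proof -
  have l: "locally_integrable \<Omega> D" "locally_integrable \<Omega> E"
    using G H by (auto simp: has_weak_divergence_def)
  have "AE x in lebesgue_on \<Omega>. D x - E x = 0"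
  proof (rule fundamental_lemma[OF \<Omega> locally_integrable_diff[OF l]])
    fix \<phi> assume \<phi>: "\<phi> \<in> test_functions \<Omega>"
    have "(\<integral>x. D x * \<phi> x \<partial>lebesgue_on \<Omega>) = (\<integral>x. E x * \<phi> x \<partial>lebesgue_on \<Omega>)"
      using G H \<phi> unfolding has_weak_divergence_def by (metis neg_equal_iff_equal)
    then show "(\<integral>x. (D x - E x) * \<phi> x \<partial>lebesgue_on \<Omega>) = 0"
      using integrable_times_test(1)[OF l(1) \<phi> \<Omega>] integrable_times_test(1)[OF l(2) \<phi> \<Omega>]
      by (simp add: left_diff_distrib)
  qed
  then show ?thesis by simp
qed

section \<open>Square integrable functions\<close>

lemma L2_measurable: "f \<in> L2 M \<Longrightarrow> f \<in> borel_measurable M"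
  by (simp add: L2_def)

lemma L2_integrable_inner:
  assumes f: "f \<in> L2 M" and g: "g \<in> L2 M"
  shows "integrable M (\<lambda>x. f x \<bullet> g x)"
proof (rule Bochner_Integration.integrable_bound)
  show "integrable M (\<lambda>x. (norm (f x))\<^sup>2 + (norm (g x))\<^sup>2)"
    using f g by (auto simp: L2_def)
  show "AE x in M. norm (f x \<bullet> g x) \<le> norm ((norm (f x))\<^sup>2 + (norm (g x))\<^sup>2)"
  proof (rule AE_I2)
    fix x
    have "\<bar>f x \<bullet> g x\<bar> \<le> norm (f x) * norm (g x)" by (rule Cauchy_Schwarz_ineq2)
    also have "\<dots> \<le> (norm (f x))\<^sup>2 + (norm (g x))\<^sup>2"
      using sum_squares_bound[of "norm (f x)" "norm (g x)"]
        mult_nonneg_nonneg[OF norm_ge_zero[of "f x"] norm_ge_zero[of "g x"]] by linarith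
    finally show "norm (f x \<bullet> g x) \<le> norm ((norm (f x))\<^sup>2 + (norm (g x))\<^sup>2)" by simp
  qed
qed (use f g in \<open>auto simp: L2_def\<close>)

lemma L2_integrable_mult:
  fixes f g :: "'a \<Rightarrow> real"
  shows "f \<in> L2 M \<Longrightarrow> g \<in> L2 M \<Longrightarrow> integrable M (\<lambda>x. f x * g x)"
  using L2_integrable_inner[of f M g] by simp

lemma L2_diff:
  assumes f: "f \<in> L2 M" and g: "g \<in> L2 M"
  shows "(\<lambda>x. f x - g x) \<in> L2 M"
proof -
  have "integrable M (\<lambda>x. f x \<bullet> f x - 2 * (f x \<bullet> g x) + g x \<bullet> g x)"
    using f g by (intro Bochner_Integration.integrable_add Bochner_Integration.integrable_diff
        integrable_mult_right L2_integrable_inner)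
  then have "integrable M (\<lambda>x. (norm (f x - g x))\<^sup>2)"
    by (simp add: power2_norm_eq_inner inner_diff_left inner_diff_right inner_commute algebra_simps)
  with f g show ?thesis by (auto simp: L2_def)
qed

lemma L2_component:
  assumes f: "f \<in> L2 M"
  shows "(\<lambda>x. f x \<bullet> b) \<in> L2 M"
proof -
  have "integrable M (\<lambda>x. (f x \<bullet> b)\<^sup>2)"
  proof (rule Bochner_Integration.integrable_bound)
    show "integrable M (\<lambda>x. (norm b)\<^sup>2 * (norm (f x))\<^sup>2)" using f by (auto simp: L2_def)
    show "AE x in M. norm ((f x \<bullet> b)\<^sup>2) \<le> norm ((norm b)\<^sup>2 * (norm (f x))\<^sup>2)"
    proof (rule AE_I2)
      fix x
      have "\<bar>f x \<bullet> b\<bar>\<^sup>2 \<le> (norm (f x) * norm b)\<^sup>2"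
        by (intro power_mono Cauchy_Schwarz_ineq2) auto
      then show "norm ((f x \<bullet> b)\<^sup>2) \<le> norm ((norm b)\<^sup>2 * (norm (f x))\<^sup>2)"
        by (simp add: power_mult_distrib mult.commute)
    qed
  qed (use f in \<open>auto simp: L2_def\<close>)
  then show ?thesis using f by (auto simp: L2_def)
qed

lemma L2_mult_bounded:
  fixes f :: "'a \<Rightarrow> 'b::euclidean_space"
  assumes f: "f \<in> L2 M" and h: "h \<in> borel_measurable M" "AE x in M. \<bar>h x\<bar> \<le> C"
  shows "(\<lambda>x. h x *\<^sub>R f x) \<in> L2 M"
proof -
  have "integrable M (\<lambda>x. (norm (h x *\<^sub>R f x))\<^sup>2)"
  proof (rule Bochner_Integration.integrable_bound)
    show "integrable M (\<lambda>x. C\<^sup>2 * (norm (f x))\<^sup>2)" using f by (auto simp: L2_def)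
    show "AE x in M. norm ((norm (h x *\<^sub>R f x))\<^sup>2) \<le> norm (C\<^sup>2 * (norm (f x))\<^sup>2)"
      using h(2)
    proof eventually_elim
      case (elim x)
      then have "\<bar>h x\<bar>\<^sup>2 \<le> C\<^sup>2" by (intro power_mono) auto
      then show ?case by (auto simp: power_mult_distrib intro!: mult_right_mono)
    qed
  qed (use f h in \<open>auto simp: L2_def\<close>)
  then show ?thesis using f h by (auto simp: L2_def)
qed

lemma L2_cong_AE:
  fixes f g :: "'a \<Rightarrow> 'b::euclidean_space"
  assumes f: "f \<in> L2 M" and g: "g \<in> borel_measurable M" "AE x in M. f x = g x"
  shows "g \<in> L2 M"
proof -
  have "integrable M (\<lambda>x. (norm (g x))\<^sup>2)"
    by (rule integrable_cong_AE_imp[of M "\<lambda>x. (norm (f x))\<^sup>2"]) (use f g in \<open>auto simp: L2_def\<close>)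
  with g show ?thesis by (simp add: L2_def)
qed

lemma L2_integrable:
  assumes f: "f \<in> L2 M" and fin: "finite_measure M"
  shows "integrable M f"
proof (rule Bochner_Integration.integrable_bound)
  show "integrable M (\<lambda>x. 1 + (norm (f x))\<^sup>2)"
    using f fin by (auto simp: L2_def finite_measure.integrable_const)
  show "AE x in M. norm (f x) \<le> norm (1 + (norm (f x))\<^sup>2)"
  proof (rule AE_I2)
    fix x
    have "2 * norm (f x) \<le> 1 + (norm (f x))\<^sup>2"
      using sum_squares_bound[of 1 "norm (f x)"] by simp
    then have "norm (f x) \<le> 1 + (norm (f x))\<^sup>2"
      using norm_ge_zero[of "f x"] by linarith
    then show "norm (f x) \<le> norm (1 + (norm (f x))\<^sup>2)" by simp
  qed
qed (use f in \<open>auto simp: L2_def\<close>)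

lemma finite_measure_lebesgue_on_bounded:
  "bounded S \<Longrightarrow> S \<in> sets lebesgue \<Longrightarrow> finite_measure (lebesgue_on S)"
  using bounded_set_imp_lmeasurable[of S] finite_measure_lebesgue_on by blast

lemma L2_restrict:
  assumes f: "f \<in> L2 (lebesgue_on S)" and T: "T \<subseteq> S" "T \<in> sets lebesgue" "S \<in> sets lebesgue"
  shows "f \<in> L2 (lebesgue_on T)"
proof -
  have "lebesgue_on T = restrict_space (lebesgue_on S) T"
    using T by (simp add: restrict_restrict_space Int_absorb1)
  moreover have "f \<in> borel_measurable (restrict_space (lebesgue_on S) T)"
    using L2_measurable[OF f] by (rule measurable_restrict_space1)
  moreover have "integrable (lebesgue_on T) (\<lambda>x. (norm (f x))\<^sup>2)"
  proof -
    have "integrable lebesgue (\<lambda>x. indicator T x *\<^sub>R (indicator S x *\<^sub>R (norm (f x))\<^sup>2))"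
      using f T by (intro integrable_mult_indicator[where f = "\<lambda>x. indicator S x *\<^sub>R (norm (f x))\<^sup>2"])
        (auto simp: L2_def integrable_restrict_space)
    also have "(\<lambda>x. indicator T x *\<^sub>R (indicator S x *\<^sub>R (norm (f x))\<^sup>2)) = (\<lambda>x. indicator T x *\<^sub>R (norm (f x))\<^sup>2)"
      using T(1) by (intro ext) (simp split: split_indicator, blast)
    finally show ?thesis using T by (simp add: integrable_restrict_space)
  qed
  ultimately show ?thesis by (simp add: L2_def)
qed

lemma L2_locally_integrable:
  assumes f: "f \<in> L2 (lebesgue_on S)" and S: "S \<in> sets lebesgue"
  shows "locally_integrable S f"
  unfolding locally_integrable_def
proof (intro allI impI)
  fix K assume K: "compact K \<and> K \<subseteq> S"
  then have "K \<in> sets lebesgue" "bounded K" by (auto simp: borel_compact compact_imp_bounded)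
  with K show "integrable (lebesgue_on K) f"
    by (intro L2_integrable L2_restrict[OF f _ _ S] finite_measure_lebesgue_on_bounded) auto
qed

lemma measurable_lebesgue_on_cong_AE:
  fixes f g :: "'a::euclidean_space \<Rightarrow> 'b::euclidean_space"
  assumes f: "f \<in> borel_measurable (lebesgue_on S)" and S: "S \<in> sets lebesgue"
    and ae: "AE x in lebesgue_on S. f x = g x"
  shows "g \<in> borel_measurable (lebesgue_on S)"
proof (rule borel_measurable_if_D)
  have "AE x in lebesgue. (if x \<in> S then f x else 0) = (if x \<in> S then g x else 0)"
    using ae S by (subst (asm) AE_restrict_space_iff) auto
  with borel_measurable_if_I[OF f S] show "(\<lambda>x. if x \<in> S then g x else 0) \<in> borel_measurable lebesgue"
    by (rule borel_measurable_AE)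
qed

text \<open>For \<open>u\<close> in \<open>H1\<close> the choice operator picks a square integrable function, because it can differ
  from a square integrable weak gradient only on a null set.\<close>
lemma weak_gradient_props:
  assumes \<Omega>: "open \<Omega>" and u: "u \<in> H1 \<Omega>"
  shows "has_weak_gradient \<Omega> u (weak_gradient \<Omega> u)"
    and "weak_gradient \<Omega> u \<in> L2 (lebesgue_on \<Omega>)"
proof -
  obtain G where G: "G \<in> L2 (lebesgue_on \<Omega>)" "has_weak_gradient \<Omega> u G"
    using u by (auto simp: H1_def)
  show w: "has_weak_gradient \<Omega> u (weak_gradient \<Omega> u)"
    unfolding weak_gradient_def using G(2) by (rule someI[of "has_weak_gradient \<Omega> u"])
  have "AE x in lebesgue_on \<Omega>. G x = weak_gradient \<Omega> u x"
    by (rule has_weak_gradient_unique[OF \<Omega> G(2) w])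
  then show "weak_gradient \<Omega> u \<in> L2 (lebesgue_on \<Omega>)"
    using \<Omega> by (intro L2_cong_AE[OF G(1)] measurable_lebesgue_on_cong_AE[OF L2_measurable[OF G(1)]]) auto
qed

lemma weak_divergence_props:
  assumes \<Omega>: "open \<Omega>" and q: "q \<in> Hdiv \<Omega>"
  shows "has_weak_divergence \<Omega> q (weak_divergence \<Omega> q)"
    and "weak_divergence \<Omega> q \<in> L2 (lebesgue_on \<Omega>)"
proof -
  obtain D where D: "D \<in> L2 (lebesgue_on \<Omega>)" "has_weak_divergence \<Omega> q D"
    using q by (auto simp: Hdiv_def)
  show w: "has_weak_divergence \<Omega> q (weak_divergence \<Omega> q)"
    unfolding weak_divergence_def using D(2) by (rule someI[of "has_weak_divergence \<Omega> q"])
  have "AE x in lebesgue_on \<Omega>. D x = weak_divergence \<Omega> q x"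
    by (rule has_weak_divergence_unique[OF \<Omega> D(2) w])
  then show "weak_divergence \<Omega> q \<in> L2 (lebesgue_on \<Omega>)"
    using \<Omega> by (intro L2_cong_AE[OF D(1)] measurable_lebesgue_on_cong_AE[OF L2_measurable[OF D(1)]]) auto
qed

section \<open>Hausdorff measure\<close>

lemma hausdorff_size_empty [simp]: "hausdorff_size s {} = 0"
  by (simp add: hausdorff_size_def)

lemma hausdorff_content_le:
  "A \<subseteq> (\<Union>i. C i) \<Longrightarrow> (\<And>i. bounded (C i) \<and> diameter (C i) \<le> \<delta>) \<Longrightarrow>
    hausdorff_content s \<delta> A \<le> (\<Sum>i. hausdorff_size s (C i))"
  unfolding hausdorff_content_def by (rule INF_lower) auto

lemma hausdorff_content_cover:
  assumes "hausdorff_content s \<delta> A < c"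
  obtains C where "A \<subseteq> (\<Union>i. C i)" "\<And>i. bounded (C i)" "\<And>i. diameter (C i) \<le> \<delta>"
    "(\<Sum>i. hausdorff_size s (C i)) < c"
  using assms unfolding hausdorff_content_def INF_less_iff by auto

lemma hausdorff_content_mono: "A \<subseteq> B \<Longrightarrow> hausdorff_content s \<delta> A \<le> hausdorff_content s \<delta> B"
  unfolding hausdorff_content_def by (rule INF_superset_mono) auto

lemma hausdorff_content_antimono:
  "\<delta> \<le> \<delta>' \<Longrightarrow> hausdorff_content s \<delta>' A \<le> hausdorff_content s \<delta> A"
  unfolding hausdorff_content_def by (rule INF_superset_mono) (auto intro: order_trans)

lemma hausdorff_content_empty: "0 \<le> \<delta> \<Longrightarrow> hausdorff_content s \<delta> {} = 0"
  using hausdorff_content_le[of "{}" "\<lambda>_. {}" \<delta> s] by simp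

lemma hausdorff_content_le_outer: "0 < \<delta> \<Longrightarrow> hausdorff_content s \<delta> A \<le> hausdorff_outer s A"
  unfolding hausdorff_outer_def by (rule SUP_upper) auto

lemma hausdorff_content_UN:
  assumes "0 \<le> \<delta>"
  shows "hausdorff_content s \<delta> (\<Union>i. A i) \<le> (\<Sum>i. hausdorff_content s \<delta> (A i))"
proof (rule ennreal_le_epsilon)
  fix e :: real assume fin: "(\<Sum>i. hausdorff_content s \<delta> (A i)) < top" and "0 < e"
  define d where "d n = e * (1/2) ^ Suc n" for n
  have d: "0 < d n" for n using \<open>0 < e\<close> by (simp add: d_def)
  have sd: "(\<Sum>n. ennreal (d n)) = ennreal e"
  proof -
    have "d sums (e * 1)" unfolding d_def by (intro sums_mult power_half_series)
    then show ?thesis using d \<open>0 < e\<close> by (intro suminf_ennreal_eq) (auto intro: less_imp_le)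
  qed
  have "\<exists>C. A n \<subseteq> (\<Union>i. C i) \<and> (\<forall>i. bounded (C i) \<and> diameter (C i) \<le> \<delta>) \<and>
      (\<Sum>i. hausdorff_size s (C i)) < hausdorff_content s \<delta> (A n) + ennreal (d n)" for n
  proof -
    have "hausdorff_content s \<delta> (A n) < top"
      using fin by (rule ennreal_suminf_lessD)
    then have "hausdorff_content s \<delta> (A n) < hausdorff_content s \<delta> (A n) + ennreal (d n)"
      using d[of n] by (simp add: ennreal_add_left_cancel_less less_top[symmetric])
    then show ?thesis
      by (rule hausdorff_content_cover) blast
  qed
  then obtain C where C: "\<And>n. A n \<subseteq> (\<Union>i. C n i)" "\<And>n i. bounded (C n i)" "\<And>n i. diameter (C n i) \<le> \<delta>"
    "\<And>n. (\<Sum>i. hausdorff_size s (C n i)) < hausdorff_content s \<delta> (A n) + ennreal (d n)"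
    by metis
  define B where "B k = (case prod_decode k of (n, i) \<Rightarrow> C n i)" for k
  have cov: "(\<Union>n. A n) \<subseteq> (\<Union>k. B k)"
  proof
    fix x assume "x \<in> (\<Union>n. A n)"
    then obtain n i where "x \<in> C n i" using C(1) by blast
    then have "x \<in> B (prod_encode (n, i))" by (simp add: B_def)
    then show "x \<in> (\<Union>k. B k)" by blast
  qed
  have "hausdorff_content s \<delta> (\<Union>n. A n) \<le> (\<Sum>k. hausdorff_size s (B k))"
    by (rule hausdorff_content_le[OF cov]) (auto simp: B_def C split: prod.split)
  also have "\<dots> = (\<Sum>k. (case prod_decode k of (n, i) \<Rightarrow> hausdorff_size s (C n i)))"
    by (simp add: B_def prod.case_distrib[of "hausdorff_size s"])
  also have "\<dots> = (\<Sum>n. \<Sum>i. hausdorff_size s (C n i))"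
    by (rule suminf_ennreal_2dimen) simp
  also have "\<dots> \<le> (\<Sum>n. hausdorff_content s \<delta> (A n) + ennreal (d n))"
    using C(4) by (intro suminf_le) (auto intro: less_imp_le)
  also have "\<dots> = (\<Sum>n. hausdorff_content s \<delta> (A n)) + ennreal e"
    by (simp add: suminf_add[symmetric] sd)
  finally show "hausdorff_content s \<delta> (\<Union>i. A i) \<le> (\<Sum>i. hausdorff_content s \<delta> (A i)) + ennreal e" .
qed

lemma hausdorff_outer_empty [simp]: "hausdorff_outer s {} = 0"
  unfolding hausdorff_outer_def by (auto simp: hausdorff_content_empty)

lemma hausdorff_outer_mono: "A \<subseteq> B \<Longrightarrow> hausdorff_outer s A \<le> hausdorff_outer s B"
  unfolding hausdorff_outer_def by (rule SUP_mono) (auto intro: hausdorff_content_mono)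

lemma hausdorff_outer_UN: "hausdorff_outer s (\<Union>i. A i) \<le> (\<Sum>i. hausdorff_outer s (A i))"
  unfolding hausdorff_outer_def[of s "\<Union>i. A i"]
proof (rule SUP_least)
  fix \<delta> :: real assume "\<delta> \<in> {0<..}"
  then have \<delta>: "0 < \<delta>" by simp
  have "hausdorff_content s \<delta> (\<Union>i. A i) \<le> (\<Sum>i. hausdorff_content s \<delta> (A i))"
    using \<delta> by (intro hausdorff_content_UN) simp
  also have "\<dots> \<le> (\<Sum>i. hausdorff_outer s (A i))"
    using \<delta> by (intro suminf_le hausdorff_content_le_outer) auto
  finally show "hausdorff_content s \<delta> (\<Union>i. A i) \<le> (\<Sum>i. hausdorff_outer s (A i))" .
qed

lemma hausdorff_outer_Un: "hausdorff_outer s (A \<union> B) \<le> hausdorff_outer s A + hausdorff_outer s B"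
proof -
  let ?S = "\<lambda>i::nat. if i = 0 then A else if i = 1 then B else {}"
  have "hausdorff_outer s (\<Union>i. ?S i) \<le> (\<Sum>i. hausdorff_outer s (?S i))"
    by (rule hausdorff_outer_UN)
  also have "\<dots> = (\<Sum>i\<in>{0, 1}. hausdorff_outer s (?S i))"
    by (rule suminf_finite) auto
  also have "(\<Union>i. ?S i) = A \<union> B" by (auto split: if_splits)
  finally show ?thesis by simp
qed

text \<open>Once \<open>\<delta>\<close> is below the distance of the two sets, no member of a cover by sets of diameter at most \<open>\<delta>\<close>
  meets both, so the cover splits into covers of \<open>A\<close> and of \<open>B\<close>.\<close>
lemma hausdorff_outer_separated:
  assumes "0 < d" and sep: "\<And>x y. x \<in> A \<Longrightarrow> y \<in> B \<Longrightarrow> d \<le> dist x y"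
  shows "hausdorff_outer s A + hausdorff_outer s B \<le> hausdorff_outer s (A \<union> B)"
proof -
  have small: "hausdorff_content s \<delta> A + hausdorff_content s \<delta> B \<le> hausdorff_content s \<delta> (A \<union> B)"
    if \<delta>: "0 < \<delta>" "\<delta> < d" for \<delta>
    unfolding hausdorff_content_def[of s \<delta> "A \<union> B"]
  proof (rule INF_greatest, clarify)
    fix C :: "nat \<Rightarrow> 'a set"
    assume cov: "A \<union> B \<subseteq> (\<Union>i. C i)" and C: "\<forall>i. bounded (C i) \<and> diameter (C i) \<le> \<delta>"
    let ?A = "\<lambda>i. if C i \<inter> A = {} then {} else C i" and ?B = "\<lambda>i. if C i \<inter> B = {} then {} else C i"
    have one: "C i \<inter> A = {} \<or> C i \<inter> B = {}" for i
    proof (rule ccontr)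
      assume "\<not> ?thesis"
      then obtain x y where "x \<in> C i" "x \<in> A" "y \<in> C i" "y \<in> B" by blast
      then have "d \<le> dist x y" "dist x y \<le> \<delta>"
        using sep C diameter_bounded_bound[of "C i" x y] by (auto intro: order_trans)
      then show False using \<delta> by simp
    qed
    have "hausdorff_content s \<delta> A + hausdorff_content s \<delta> B
        \<le> (\<Sum>i. hausdorff_size s (?A i)) + (\<Sum>i. hausdorff_size s (?B i))"
    proof (intro add_mono hausdorff_content_le)
      show "A \<subseteq> (\<Union>i. ?A i)" "B \<subseteq> (\<Union>i. ?B i)"
        using cov by (fastforce split: if_splits)+
    qed (use C \<delta> in auto)
    also have "\<dots> = (\<Sum>i. hausdorff_size s (?A i) + hausdorff_size s (?B i))"
      by (rule suminf_add) auto
    also have "\<dots> \<le> (\<Sum>i. hausdorff_size s (C i))"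
      using one by (intro suminf_le) auto
    finally show "hausdorff_content s \<delta> A + hausdorff_content s \<delta> B \<le> (\<Sum>i. hausdorff_size s (C i))" .
  qed
  have both: "hausdorff_content s \<delta> A + hausdorff_content s \<delta>' B \<le> hausdorff_outer s (A \<union> B)"
    if "0 < \<delta>" "0 < \<delta>'" for \<delta> \<delta>'
  proof -
    define m where "m = min (min \<delta> \<delta>') (d/2)"
    have m: "0 < m" "m < d" "m \<le> \<delta>" "m \<le> \<delta>'" using that \<open>0 < d\<close> by (auto simp: m_def)
    have "hausdorff_content s \<delta> A + hausdorff_content s \<delta>' B \<le> hausdorff_content s m A + hausdorff_content s m B"
      using m by (intro add_mono hausdorff_content_antimono) auto
    also have "\<dots> \<le> hausdorff_content s m (A \<union> B)" using m by (intro small)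
    also have "\<dots> \<le> hausdorff_outer s (A \<union> B)" using m by (intro hausdorff_content_le_outer)
    finally show ?thesis .
  qed
  have "hausdorff_outer s A + hausdorff_content s \<delta>' B \<le> hausdorff_outer s (A \<union> B)" if "0 < \<delta>'" for \<delta>'
    unfolding hausdorff_outer_def[of s A]
    by (subst ennreal_SUP_add_left[symmetric]) (use both that in \<open>auto intro!: SUP_least\<close>)
  then have "(SUP \<delta>'\<in>{0<..}. hausdorff_content s \<delta>' B + hausdorff_outer s A) \<le> hausdorff_outer s (A \<union> B)"
    by (intro SUP_least) (auto simp: add.commute)
  then show ?thesis
    unfolding hausdorff_outer_def[of s B]
    by (subst (asm) ennreal_SUP_add_left) (auto simp: add.commute)
qed

lemma hausdorff_outer_measure_space: "outer_measure_space (Pow UNIV) (hausdorff_outer s)"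
  unfolding outer_measure_space_def
  by (auto simp: positive_def increasing_def countably_subadditive_def
      intro: hausdorff_outer_mono hausdorff_outer_UN)

text \<open>Caratheodory's criterion for outer measures that are additive on separated sets, for \<open>X\<close> of finite measure. Exhaust \<open>X - F\<close> by
  the sets \<open>A n\<close> of points at distance at least \<open>1 / (n + 1)\<close> from \<open>F\<close>, for which additivity is known.
  The rest splits into rings whose measures form a convergent series, hence is negligible in the limit.\<close>
lemma closed_caratheodory:
  fixes F :: "'a::metric_space set"
  assumes "closed F"
  shows "hausdorff_outer s (X \<inter> F) + hausdorff_outer s (X - F) \<le> hausdorff_outer s X"
proof (cases "F = {} \<or> hausdorff_outer s X = top")
  case True
  then show ?thesis by auto
next
  case False
  then have "F \<noteq> {}" and fin: "hausdorff_outer s X < top" by (auto simp: less_top)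
  let ?H = "hausdorff_outer s"
  define B where "B = X - F"
  define A where "A n = {x \<in> B. 1 / real (Suc n) \<le> infdist x F}" for n
  define R where "R n = {x \<in> B. 1 / real (Suc (Suc n)) \<le> infdist x F \<and> infdist x F < 1 / real (Suc n)}" for n
  have tri: "infdist x F \<le> infdist y F + dist x y" for x y by (rule infdist_triangle)
  have mono: "1 / real (Suc n) \<le> 1 / real (Suc m)" if "m \<le> n" for m n
    using that by (simp add: field_simps)
  have finR: "?H Y < top" if "Y \<subseteq> X" for Y
    using hausdorff_outer_mono[OF that, of s] fin by (rule le_less_trans)
  \<comment> \<open>rings with indices of the same parity are a positive distance apart\<close>
  have ring: "(\<Sum>k<n. ?H (R (2 * k + j))) \<le> ?H (\<Union>k<n. R (2 * k + j))" for n j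
  proof (induction n)
    case (Suc n)
    define u where "u = 1 / real (Suc (2 * n + j)) "
    define d where "d = (if n = 0 then 1 else 1 / real (2 * n + j) - u)"
    have d: "0 < d"
    proof (cases "n = 0")
      case False
      then have "1 / real (Suc (2 * n + j)) < 1 / real (2 * n + j)"
        by (intro divide_strict_left_mono) auto
      then show ?thesis by (simp add: d_def u_def)
    qed (simp add: d_def)
    have sep: "d \<le> dist x y" if x: "x \<in> (\<Union>k<n. R (2 * k + j))" and y: "y \<in> R (2 * n + j)" for x y
    proof -
      obtain k where k: "k < n" "x \<in> R (2 * k + j)" using x by auto
      then have "1 / real (2 * n + j) \<le> 1 / real (Suc (Suc (2 * k + j)))"
        using k by (intro divide_left_mono) auto
      also have "\<dots> \<le> infdist x F" using k by (simp add: R_def)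
      finally have 1: "1 / real (2 * n + j) \<le> infdist x F" .
      have "infdist y F < u" using y by (simp add: R_def u_def)
      then show ?thesis using 1 k tri[of x y] by (auto simp: d_def)
    qed
    have "(\<Sum>k<Suc n. ?H (R (2 * k + j))) \<le> ?H (\<Union>k<n. R (2 * k + j)) + ?H (R (2 * n + j))"
      using Suc by (simp add: add_right_mono)
    also have "\<dots> \<le> ?H ((\<Union>k<n. R (2 * k + j)) \<union> R (2 * n + j))"
      by (rule hausdorff_outer_separated[OF d sep])
    also have "(\<Union>k<n. R (2 * k + j)) \<union> R (2 * n + j) = (\<Union>k<Suc n. R (2 * k + j))"
      by (auto simp: lessThan_Suc)
    finally show ?case .
  qed simp
  define r where "r n = enn2real (?H (R n))" for n
  have RX: "R n \<subseteq> X" for n by (auto simp: R_def B_def)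
  have r: "?H (R n) = ennreal (r n)" "0 \<le> r n" for n
    using finR[OF RX, of n] by (auto simp: r_def)
  have bound: "(\<Sum>k<n. r (2 * k + j)) \<le> enn2real (?H X)" for n j
  proof -
    have "ennreal (\<Sum>k<n. r (2 * k + j)) = (\<Sum>k<n. ?H (R (2 * k + j)))"
      by (simp add: r sum_ennreal)
    also have "\<dots> \<le> ?H (\<Union>k<n. R (2 * k + j))" by (rule ring)
    also have "\<dots> \<le> ?H X" using RX by (intro hausdorff_outer_mono) auto
    finally have "ennreal (\<Sum>k<n. r (2 * k + j)) \<le> ?H X" .
    then have "enn2real (ennreal (\<Sum>k<n. r (2 * k + j))) \<le> enn2real (?H X)"
      using fin by (intro enn2real_mono) auto
    then show ?thesis by (simp add: r sum_nonneg)
  qed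
  have total: "(\<Sum>k<n. r k) \<le> enn2real (?H X) + enn2real (?H X)" for n
  proof -
    have "(\<Sum>k<n. r k) \<le> (\<Sum>k<2 * n. r k)"
      using r by (intro sum_mono2) auto
    also have "\<dots> = (\<Sum>k<n. r (2 * k + 0)) + (\<Sum>k<n. r (2 * k + 1))"
      by (induction n) auto
    also have "\<dots> \<le> enn2real (?H X) + enn2real (?H X)"
      by (intro add_mono bound)
    finally show ?thesis .
  qed
  have sumr: "summable r"
  proof (rule bounded_imp_summable)
    show "(\<Sum>k\<le>n. r k) \<le> enn2real (?H X) + enn2real (?H X)" for n
      using total[of "Suc n"] by (simp only: lessThan_Suc_atMost)
  qed (rule r)
  have tail: "(\<lambda>n. \<Sum>k. r (k + n)) \<longlonglongrightarrow> 0"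
    using suminf_exist_split2[OF sumr] by simp
  have cover: "B \<subseteq> A n \<union> (\<Union>k. R (k + n))" for n
  proof
    fix x assume x: "x \<in> B"
    then have "x \<notin> F" by (simp add: B_def)
    then have pos: "0 < infdist x F"
      using \<open>closed F\<close> \<open>F \<noteq> {}\<close> by (simp add: infdist_pos_not_in_closed)
    show "x \<in> A n \<union> (\<Union>k. R (k + n))"
    proof (cases "x \<in> A n")
      case False
      define P where "P m \<longleftrightarrow> 1 / real (Suc (m + n)) \<le> infdist x F" for m
      obtain m where "inverse (real (Suc m)) < infdist x F"
        using reals_Archimedean[OF pos] by blast
      then have "P m" using mono[of m "m + n"] by (simp add: P_def inverse_eq_divide)
      moreover have "\<not> P 0" using False x by (simp add: A_def P_def)
      ultimately obtain k where "\<not> P k" "P (Suc k)"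
        using nat_induct[of "\<lambda>i. \<not> P i" m] by blast
      then have "x \<in> R (k + n)" using x by (auto simp: R_def P_def not_le)
      then show ?thesis by blast
    qed simp
  qed
  \<comment> \<open>by construction \<open>A n\<close> is separated from \<open>X \<inter> F\<close>, and the remaining rings form a tail of the series\<close>
  have step: "?H (X \<inter> F) + ?H B \<le> ?H X + ennreal (\<Sum>k. r (k + n))" for n
  proof -
    have sep: "1 / real (Suc n) \<le> dist x y" if "x \<in> X \<inter> F" "y \<in> A n" for x y
      using tri[of y x] that by (auto simp: A_def dist_commute)
    have "?H B \<le> ?H (A n \<union> (\<Union>k. R (k + n)))"
      by (rule hausdorff_outer_mono[OF cover])
    also have "\<dots> \<le> ?H (A n) + ?H (\<Union>k. R (k + n))"
      by (rule hausdorff_outer_Un)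
    also have "?H (\<Union>k. R (k + n)) \<le> (\<Sum>k. ?H (R (k + n)))"
      by (rule hausdorff_outer_UN)
    also have "(\<Sum>k. ?H (R (k + n))) = ennreal (\<Sum>k. r (k + n))"
      using r sumr by (simp add: suminf_ennreal2 summable_ignore_initial_segment)
    finally have "?H (X \<inter> F) + ?H B \<le> (?H (X \<inter> F) + ?H (A n)) + ennreal (\<Sum>k. r (k + n))"
      by (simp add: add.assoc add_left_mono)
    also have "?H (X \<inter> F) + ?H (A n) \<le> ?H (X \<inter> F \<union> A n)"
      by (rule hausdorff_outer_separated[OF _ sep]) auto
    also have "\<dots> \<le> ?H X" by (rule hausdorff_outer_mono) (auto simp: A_def B_def)
    finally show ?thesis by (simp add: add_right_mono)
  qed
  have "(\<lambda>n. ?H X + ennreal (\<Sum>k. r (k + n))) \<longlonglongrightarrow> ?H X + ennreal 0"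
    by (intro tendsto_add tendsto_const tendsto_ennrealI tail)
  then have "?H (X \<inter> F) + ?H B \<le> ?H X + ennreal 0"
    by (rule LIMSEQ_le_const) (use step in auto)
  then show ?thesis by (simp add: B_def)
qed

lemma closed_in_lambda_system:
  fixes F :: "'a::metric_space set"
  assumes "closed F"
  shows "F \<in> lambda_system UNIV (Pow UNIV) (hausdorff_outer s)"
  unfolding lambda_system_def
proof (clarsimp)
  fix X :: "'a set"
  have "hausdorff_outer s (F \<inter> X) + hausdorff_outer s ((UNIV - F) \<inter> X)
      = hausdorff_outer s (X \<inter> F) + hausdorff_outer s (X - F)"
    by (simp add: Int_commute Diff_eq)
  also have "\<dots> = hausdorff_outer s X"
  proof (rule antisym)
    show "hausdorff_outer s X \<le> hausdorff_outer s (X \<inter> F) + hausdorff_outer s (X - F)"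
      using hausdorff_outer_Un[of s "X \<inter> F" "X - F"] by (simp add: Int_Diff_Un)
  qed (rule closed_caratheodory[OF assms])
  finally show "hausdorff_outer s (F \<inter> X) + hausdorff_outer s ((UNIV - F) \<inter> X) = hausdorff_outer s X" .
qed

lemma hausdorff_measure_space:
  "measure_space UNIV (lambda_system UNIV (Pow UNIV) (hausdorff_outer s)) (hausdorff_outer s)"
  by (rule sigma_algebra.caratheodory_lemma[OF sigma_algebra_Pow hausdorff_outer_measure_space])

lemma space_hausdorff_measure [simp]: "space (hausdorff_measure s) = UNIV"
  by (simp add: hausdorff_measure_def)

lemma sets_hausdorff_measure:
  "sets (hausdorff_measure s) = lambda_system UNIV (Pow UNIV) (hausdorff_outer s)"
proof -
  have "sigma_algebra UNIV (lambda_system UNIV (Pow UNIV) (hausdorff_outer s))"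
    using hausdorff_measure_space[of s] unfolding measure_space_def by blast
  then show ?thesis
    unfolding hausdorff_measure_def by (rule sigma_algebra.sets_measure_of_eq)
qed

lemma borel_sets_hausdorff_measure:
  fixes A :: "'a::metric_space set"
  assumes "A \<in> sets borel"
  shows "A \<in> sets (hausdorff_measure s)"
proof -
  have "sets borel = sigma_sets UNIV {F :: 'a set. closed F}"
    by (simp add: borel_eq_closed)
  moreover have "sigma_sets UNIV {F. closed F} \<subseteq> sets (hausdorff_measure s :: 'a measure)"
    using sets.sigma_sets_subset[of "{F :: 'a set. closed F}" "hausdorff_measure s"]
      closed_in_lambda_system by (auto simp: sets_hausdorff_measure)
  ultimately show ?thesis using assms by auto
qed

text \<open>Outside the Caratheodory measurable sets the measure is zero by convention, so measurability of Borel
  sets is what ties it to the outer measure.\<close>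
lemma emeasure_hausdorff_measure:
  fixes A :: "'a::metric_space set"
  assumes "A \<in> sets borel"
  shows "emeasure (hausdorff_measure s) A = hausdorff_outer s A"
  unfolding hausdorff_measure_def
proof (rule emeasure_measure_of_sigma)
  show "A \<in> lambda_system UNIV (Pow UNIV) (hausdorff_outer s)"
    using borel_sets_hausdorff_measure[OF assms, of s] by (simp add: sets_hausdorff_measure)
qed (use hausdorff_measure_space[of s] in \<open>auto simp: measure_space_def\<close>)

section \<open>Hausdorff measure of dimension one less and Lebesgue measure\<close>

text \<open>The factor \<open>3 * 4\<^sup>d\<^sup>-\<^sup>1\<close> comes from the volume \<open>(2 r + s) (2 r)\<^sup>d\<^sup>-\<^sup>1 \<le> 3 s (2 r)\<^sup>d\<^sup>-\<^sup>1\<close> of a box around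
  the tube over a set of diameter \<open>r \<le> s\<close>, divided by the Hausdorff size of a set of that
  diameter.\<close>
definition tube_constant :: "'a::euclidean_space itself \<Rightarrow> real" where
  "tube_constant _ = 3 * 4 ^ (DIM('a) - 1) / unit_ball_vol (real (DIM('a) - 1))"

lemma tube_constant_pos: "0 < tube_constant TYPE('a::euclidean_space)"
  by (simp add: tube_constant_def)

text \<open>The set lies in the box of half-width \<open>r\<close> around any of its points, and its tube in the same box
  prolonged by \<open>s\<close> in the direction \<open>b\<close>.\<close>
lemma translates_box_cover:
  fixes C :: "'a::euclidean_space set"
  assumes C: "bounded C" "diameter C \<le> s" and "0 < s" and b: "b \<in> Basis"
  shows "\<exists>U\<in>sets borel. (\<forall>y\<in>C. \<forall>t\<in>{0..s}. y + t *\<^sub>R b \<in> U) \<and>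
    emeasure lborel U \<le> ennreal (tube_constant TYPE('a) * s) * hausdorff_size (DIM('a) - 1) C"
proof (cases "C = {}")
  case True
  then show ?thesis by (intro bexI[of _ "{}"]) auto
next
  case False
  then obtain p where p: "p \<in> C" by blast
  define r where "r = diameter C"
  have r: "0 \<le> r" "r \<le> s" using C diameter_ge_0 by (auto simp: r_def)
  define U where "U = cbox (p - r *\<^sub>R One) (p + r *\<^sub>R One + s *\<^sub>R b)"
  have in_U: "y + t *\<^sub>R b \<in> U" if "y \<in> C" "t \<in> {0..s}" for y t
    unfolding U_def mem_box
  proof
    fix i :: 'a assume i: "i \<in> Basis"
    have "\<bar>(y - p) \<bullet> i\<bar> \<le> norm (y - p)" using i by (rule Basis_le_norm)
    also have "\<dots> \<le> r"
      using diameter_bounded_bound[OF C(1) that(1) p] by (simp add: r_def dist_norm)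
    finally have "\<bar>y \<bullet> i - p \<bullet> i\<bar> \<le> r" by (simp add: inner_diff_left)
    moreover have "0 \<le> t * (b \<bullet> i)" "t * (b \<bullet> i) \<le> s * (b \<bullet> i)"
      using that i b by (auto simp: inner_Basis)
    ultimately show "(p - r *\<^sub>R One) \<bullet> i \<le> (y + t *\<^sub>R b) \<bullet> i \<and> (y + t *\<^sub>R b) \<bullet> i \<le> (p + r *\<^sub>R One + s *\<^sub>R b) \<bullet> i"
      using i by (auto simp: inner_add_left inner_diff_left)
  qed
  have "emeasure lborel U = ennreal (\<Prod>i\<in>Basis. (p + r *\<^sub>R One + s *\<^sub>R b - (p - r *\<^sub>R One)) \<bullet> i)"
    unfolding U_def using r \<open>0 < s\<close> b
    by (intro emeasure_lborel_cbox) (auto simp: inner_add_left inner_diff_left inner_Basis)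
  also have "(\<Prod>i\<in>Basis. (p + r *\<^sub>R One + s *\<^sub>R b - (p - r *\<^sub>R One)) \<bullet> i)
      = (\<Prod>i\<in>Basis. if i = b then 2 * r + s else 2 * r)"
    using b by (intro prod.cong) (auto simp: inner_add_left inner_diff_left inner_Basis)
  also have "\<dots> = (2 * r + s) * (2 * r) ^ (DIM('a) - 1)"
    using b by (simp add: prod.remove[of _ b] card_Diff_singleton)
  also have "\<dots> \<le> (3 * s) * (2 * r) ^ (DIM('a) - 1)"
    using r by (intro mult_right_mono) auto
  also have "(3 * s) * (2 * r) ^ (DIM('a) - 1) =
      (tube_constant TYPE('a) * s) * (unit_ball_vol (real (DIM('a) - 1)) * (r / 2) ^ (DIM('a) - 1))"
  proof -
    have "2 * r = 4 * (r / 2)" by simp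
    then have "(2 * r) ^ (DIM('a) - 1) = 4 ^ (DIM('a) - 1) * (r / 2) ^ (DIM('a) - 1)"
      by (metis power_mult_distrib)
    moreover have "(3 * s) * (F * X) = (3 * F / V * s) * (V * X)" if "V \<noteq> 0" for F V X :: real
      using that by (simp add: field_simps)
    moreover have "unit_ball_vol (real (DIM('a) - 1)) \<noteq> 0"
      using unit_ball_vol_pos[of "real (DIM('a) - 1)"] by linarith
    ultimately show ?thesis unfolding tube_constant_def by metis
  qed
  finally have "emeasure lborel U \<le>
      ennreal ((tube_constant TYPE('a) * s) * (unit_ball_vol (real (DIM('a) - 1)) * (r / 2) ^ (DIM('a) - 1)))"
    by (simp add: ennreal_leI)
  also have "\<dots> = ennreal (tube_constant TYPE('a) * s) * hausdorff_size (DIM('a) - 1) C"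
    using False \<open>0 < s\<close> tube_constant_pos[where 'a='a] r
    by (simp add: hausdorff_size_def r_def ennreal_mult)
  finally show ?thesis
    using in_U by (intro bexI[of _ U]) (auto simp: U_def)
qed

text \<open>Covers by sets of diameter at most \<open>s\<close> compete in the Hausdorff content at scale \<open>s\<close>, which is bounded
  by Hausdorff measure; each member contributes the volume of one box.\<close>
lemma tube_cover:
  fixes A :: "'a::euclidean_space set"
  assumes fin: "hausdorff_outer (DIM('a) - 1) A < top" and "0 < s" and b: "b \<in> Basis" and "0 < e"
  shows "\<exists>U\<in>sets borel. (\<forall>y\<in>A. \<forall>t\<in>{0..s}. y + t *\<^sub>R b \<in> U) \<and>
    emeasure lborel U \<le> ennreal (tube_constant TYPE('a) * s) * hausdorff_outer (DIM('a) - 1) A + ennreal e"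
proof -
  let ?H = "hausdorff_outer (DIM('a) - 1)" and ?K = "tube_constant TYPE('a) * s"
  have K: "0 < ?K" using tube_constant_pos[where 'a='a] \<open>0 < s\<close> by simp
  have "hausdorff_content (DIM('a) - 1) s A \<le> ?H A"
    using \<open>0 < s\<close> by (rule hausdorff_content_le_outer)
  also have "?H A < ?H A + ennreal (e / ?K)"
    using fin K \<open>0 < e\<close> by (simp add: ennreal_add_left_cancel_less less_top[symmetric])
  finally obtain C where C: "A \<subseteq> (\<Union>i. C i)" "\<And>i. bounded (C i)" "\<And>i. diameter (C i) \<le> s"
      "(\<Sum>i. hausdorff_size (DIM('a) - 1) (C i)) < ?H A + ennreal (e / ?K)"
    by (rule hausdorff_content_cover) blast
  have "\<forall>i. \<exists>U\<in>sets borel. (\<forall>y\<in>C i. \<forall>t\<in>{0..s}. y + t *\<^sub>R b \<in> U) \<and>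
      emeasure lborel U \<le> ennreal ?K * hausdorff_size (DIM('a) - 1) (C i)"
    using translates_box_cover[OF C(2,3) \<open>0 < s\<close> b] by blast
  then obtain U where U: "\<And>i. U i \<in> sets borel" "\<And>i y t. y \<in> C i \<Longrightarrow> t \<in> {0..s} \<Longrightarrow> y + t *\<^sub>R b \<in> U i"
      "\<And>i. emeasure lborel (U i) \<le> ennreal ?K * hausdorff_size (DIM('a) - 1) (C i)"
    by metis
  have "emeasure lborel (\<Union>i. U i) \<le> (\<Sum>i. emeasure lborel (U i))"
    using U by (intro emeasure_subadditive_countably) auto
  also have "\<dots> \<le> (\<Sum>i. ennreal ?K * hausdorff_size (DIM('a) - 1) (C i))"
    using U by (intro suminf_le) auto
  also have "\<dots> = ennreal ?K * (\<Sum>i. hausdorff_size (DIM('a) - 1) (C i))"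
    by simp
  also have "\<dots> \<le> ennreal ?K * (?H A + ennreal (e / ?K))"
    using C(4) by (intro mult_left_mono) auto
  also have "\<dots> = ennreal ?K * ?H A + ennreal e"
  proof -
    have "ennreal ?K * ennreal (e / ?K) = ennreal (?K * (e / ?K))"
      using K \<open>0 < e\<close> by (intro ennreal_mult[symmetric]) auto
    also have "?K * (e / ?K) = e" using K by (metis less_irrefl nonzero_mult_div_cancel_left times_divide_eq_right)
    finally show ?thesis by (simp add: distrib_left)
  qed
  finally show ?thesis
    using U C(1) by (intro bexI[of _ "\<Union>i. U i"]) (auto; blast)+
qed

section \<open>Integrals of derivatives\<close>

lemma integral_translate:
  fixes f :: "'a::euclidean_space \<Rightarrow> real"
  assumes [measurable]: "f \<in> borel_measurable borel"
  shows "integrable lborel (\<lambda>x. f (x + z)) \<longleftrightarrow> integrable lborel f"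
    and "(\<integral>x. f (x + z) \<partial>lborel) = (\<integral>x. f x \<partial>lborel)"
proof -
  have "integrable (distr lborel borel ((+) z)) f \<longleftrightarrow> integrable lborel (\<lambda>x. f (z + x))"
    by (rule integrable_distr_eq) auto
  then show "integrable lborel (\<lambda>x. f (x + z)) \<longleftrightarrow> integrable lborel f"
    by (simp add: lborel_distr_plus add.commute)
  have "(\<integral>x. f x \<partial>distr lborel borel ((+) z)) = (\<integral>x. f (z + x) \<partial>lborel)"
    by (rule integral_distr) auto
  then show "(\<integral>x. f (x + z) \<partial>lborel) = (\<integral>x. f x \<partial>lborel)"
    by (simp add: lborel_distr_plus add.commute)
qed

lemma continuous_compact_support_integrable:
  fixes f :: "'a::euclidean_space \<Rightarrow> real"
  assumes "continuous_on UNIV f" "compact K" "\<And>x. x \<notin> K \<Longrightarrow> f x = 0"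
  shows "integrable lborel f"
proof -
  have "integrable lborel (\<lambda>x. indicator K x *\<^sub>R f x)"
    using assms by (intro borel_integrable_compact continuous_on_subset[OF assms(1)]) auto
  also have "(\<lambda>x. indicator K x *\<^sub>R f x) = f"
    using assms(3) by (force simp: indicator_def)
  finally show ?thesis .
qed

lemma test_function_bounded:
  assumes "\<phi> \<in> test_functions \<Omega>"
  shows "\<exists>C>0. \<forall>x. \<bar>\<phi> x\<bar> \<le> C \<and> norm (gradient \<phi> x) \<le> C"
proof -
  obtain K where K: "compact K" "K \<subseteq> \<Omega>" "\<forall>x. x \<notin> K \<longrightarrow> \<phi> x = 0 \<and> gradient \<phi> x = 0"
    using test_functions_support[OF assms] .
  have s: "smooth \<phi>" using assms by (rule test_functions_smooth)
  have "bounded (\<phi> ` K)" "bounded (gradient \<phi> ` K)"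
    by (intro compact_imp_bounded compact_continuous_image smooth_continuous[OF s] continuous_on_gradient[OF s] K)+
  then obtain C1 C2 where C: "\<forall>y\<in>\<phi> ` K. norm y \<le> C1" "\<forall>y\<in>gradient \<phi> ` K. norm y \<le> C2"
    unfolding bounded_iff by blast
  define C where "C = \<bar>C1\<bar> + \<bar>C2\<bar> + 1"
  have "\<bar>\<phi> x\<bar> \<le> C" "norm (gradient \<phi> x) \<le> C" for x
    using C K(3) by (cases "x \<in> K"; force simp: C_def)+
  moreover have "0 < C" by (simp add: C_def)
  ultimately show ?thesis by blast
qed

lemma test_function_lipschitz:
  assumes s: "smooth \<phi>" and C: "\<And>x. norm (gradient \<phi> x) \<le> C"
  shows "\<bar>\<phi> x - \<phi> y\<bar> \<le> C * norm (x - y)"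
proof -
  have "norm (\<phi> x - \<phi> y) \<le> C * norm (x - y)"
  proof (rule differentiable_bound[of UNIV \<phi> "\<lambda>x h. gradient \<phi> x \<bullet> h"])
    show "(\<phi> has_derivative (\<lambda>h. gradient \<phi> x \<bullet> h)) (at x within UNIV)" for x
      using smooth_has_derivative[OF s] by simp
    show "onorm (\<lambda>h. gradient \<phi> x \<bullet> h) \<le> C" for x
    proof (rule onorm_le)
      fix h
      have "\<bar>gradient \<phi> x \<bullet> h\<bar> \<le> norm (gradient \<phi> x) * norm h" by (rule Cauchy_Schwarz_ineq2)
      also have "\<dots> \<le> C * norm h" using C by (intro mult_right_mono) auto
      finally show "norm (gradient \<phi> x \<bullet> h) \<le> C * norm h" by simp
    qed
  qed auto
  then show ?thesis by simp
qed

lemma difference_quotient_tendsto: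
  assumes s: "smooth \<phi>"
  shows "(\<lambda>n. (\<phi> (x + inverse (real (Suc n)) *\<^sub>R b) - \<phi> x) / inverse (real (Suc n))) \<longlonglongrightarrow> gradient \<phi> x \<bullet> b"
proof -
  have "((\<lambda>t. x + t *\<^sub>R b) has_derivative (\<lambda>t. t *\<^sub>R b)) (at 0)"
    by (auto intro!: derivative_eq_intros)
  from has_derivative_compose[OF this, of \<phi> "\<lambda>h. gradient \<phi> x \<bullet> h"]
  have "((\<lambda>t. \<phi> (x + t *\<^sub>R b)) has_derivative (\<lambda>t. t * (gradient \<phi> x \<bullet> b))) (at 0)"
    using smooth_has_derivative[OF s, of x] by simp
  then have "((\<lambda>t. \<phi> (x + t *\<^sub>R b)) has_real_derivative (gradient \<phi> x \<bullet> b)) (at 0)"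
    by (simp add: has_field_derivative_def mult.commute[of _ "gradient \<phi> x \<bullet> b"])
  then have "((\<lambda>h. (\<phi> (x + h *\<^sub>R b) - \<phi> x) / h) \<longlongrightarrow> gradient \<phi> x \<bullet> b) (at 0)"
    by (simp add: DERIV_def)
  moreover have "filterlim (\<lambda>n. inverse (real (Suc n))) (at 0) sequentially"
    by (rule filterlim_atI[OF LIMSEQ_inverse_real_of_nat]) auto
  ultimately show ?thesis by (rule filterlim_compose)
qed

text \<open>The quotients are dominated, by the Lipschitz bound, by a constant on a ball slightly larger than one
  that contains the support.\<close>
lemma difference_quotient_integral:
  assumes \<phi>: "\<phi> \<in> test_functions UNIV" and b: "b \<in> Basis" and [measurable]: "A \<in> sets borel"
  shows "(\<lambda>n. \<integral>x. indicator A x * ((\<phi> (x + inverse (real (Suc n)) *\<^sub>R b) - \<phi> x) / inverse (real (Suc n))) \<partial>lborel)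
      \<longlonglongrightarrow> (\<integral>x. indicator A x * (gradient \<phi> x \<bullet> b) \<partial>lborel)"
proof -
  have s: "smooth \<phi>" using \<phi> by (rule test_functions_smooth)
  obtain C where "0 < C \<and> (\<forall>x. \<bar>\<phi> x\<bar> \<le> C \<and> norm (gradient \<phi> x) \<le> C)"
    using test_function_bounded[OF \<phi>] ..
  then have C: "0 < C" "\<And>x. \<bar>\<phi> x\<bar> \<le> C" "\<And>x. norm (gradient \<phi> x) \<le> C" by auto
  obtain K where K: "compact K" "K \<subseteq> UNIV" "\<forall>x. x \<notin> K \<longrightarrow> \<phi> x = 0 \<and> gradient \<phi> x = 0"
    using test_functions_support[OF \<phi>] .
  obtain R where "\<forall>x\<in>K. norm x \<le> R"
    using compact_imp_bounded[OF K(1)] unfolding bounded_iff ..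
  then have R: "K \<subseteq> cball 0 R" by auto
  have [measurable]: "\<phi> \<in> borel_measurable borel" "(\<lambda>x. gradient \<phi> x \<bullet> b) \<in> borel_measurable borel"
    by (intro borel_measurable_continuous_onI smooth_continuous s smooth_gradient_inner b)+
  show ?thesis
  proof (rule integral_dominated_convergence[where w = "\<lambda>x. C * indicator (cball 0 (R + 1)) x"])
    show "integrable lborel (\<lambda>x::'a. C * indicator (cball 0 (R + 1)) x)"
      using emeasure_compact_finite[of "cball (0::'a) (R + 1)"]
      by (intro integrable_mult_right integrable_real_indicator) auto
    show "AE x in lborel. (\<lambda>n. indicator A x * ((\<phi> (x + inverse (real (Suc n)) *\<^sub>R b) - \<phi> x) / inverse (real (Suc n))))
        \<longlonglongrightarrow> indicator A x * (gradient \<phi> x \<bullet> b)"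
      by (intro AE_I2 tendsto_mult_left difference_quotient_tendsto s)
    fix n
    define t where "t = inverse (real (Suc n))"
    have t: "0 < t" "t \<le> 1" by (auto simp: t_def field_simps)
    have "\<bar>indicator A x * ((\<phi> (x + t *\<^sub>R b) - \<phi> x) / t)\<bar> \<le> C * indicator (cball 0 (R + 1)) x" for x
    proof (cases "x \<in> cball 0 (R + 1)")
      case True
      have "\<bar>\<phi> (x + t *\<^sub>R b) - \<phi> x\<bar> \<le> C * norm (x + t *\<^sub>R b - x)"
        by (rule test_function_lipschitz[OF s C(3)])
      then have "\<bar>(\<phi> (x + t *\<^sub>R b) - \<phi> x) / t\<bar> \<le> C"
        using t b by (simp add: abs_divide field_simps)
      with True C(1) show ?thesis by (simp add: indicator_def)
    next
      case False
      have "norm x \<le> norm (x + t *\<^sub>R b) + norm (t *\<^sub>R b)"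
        using norm_triangle_ineq4[of "x + t *\<^sub>R b" "t *\<^sub>R b"] by simp
      then have "x \<notin> K" "x + t *\<^sub>R b \<notin> K"
        using False R t b by (auto simp: subset_iff)
      then show ?thesis using K(3) False by (simp add: indicator_def)
    qed
    then show "AE x in lborel. norm (indicator A x * ((\<phi> (x + inverse (real (Suc n)) *\<^sub>R b) - \<phi> x) / inverse (real (Suc n))))
        \<le> C * indicator (cball 0 (R + 1)) x"
      unfolding t_def by simp
  qed measurable
qed

lemma test_function_integrable:
  assumes \<phi>: "\<phi> \<in> test_functions \<Omega>"
  shows "integrable lborel \<phi>" and "b \<in> Basis \<Longrightarrow> integrable lborel (\<lambda>x. gradient \<phi> x \<bullet> b)"
proof -
  have s: "smooth \<phi>" using \<phi> by (rule test_functions_smooth)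
  obtain K where K: "compact K" "K \<subseteq> \<Omega>" "\<forall>x. x \<notin> K \<longrightarrow> \<phi> x = 0 \<and> gradient \<phi> x = 0"
    using test_functions_support[OF \<phi>] .
  show "integrable lborel \<phi>"
    using K(3) by (intro continuous_compact_support_integrable[OF smooth_continuous[OF s] K(1)]) auto
  show "integrable lborel (\<lambda>x. gradient \<phi> x \<bullet> b)" if "b \<in> Basis"
    using K(3) by (intro continuous_compact_support_integrable[OF smooth_continuous[OF smooth_gradient_inner[OF s that]] K(1)]) auto
qed

text \<open>The integral of every difference quotient vanishes by translation invariance.\<close>
lemma integral_gradient_test_function:
  assumes \<phi>: "\<phi> \<in> test_functions UNIV" and b: "b \<in> Basis"
  shows "(\<integral>x. gradient \<phi> x \<bullet> b \<partial>lborel) = 0"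
proof -
  have i: "integrable lborel \<phi>" by (rule test_function_integrable[OF \<phi>])
  then have m: "\<phi> \<in> borel_measurable borel" by auto
  have z: "(\<integral>x. indicator UNIV x * ((\<phi> (x + t *\<^sub>R b) - \<phi> x) / t) \<partial>lborel) = 0" for t
    using integral_translate[OF m] i by simp
  have "(\<lambda>n::nat. 0) \<longlonglongrightarrow> (\<integral>x. gradient \<phi> x \<bullet> b \<partial>lborel)"
    using difference_quotient_integral[OF \<phi> b, of UNIV] unfolding z by simp
  then show ?thesis by (simp add: LIMSEQ_const_iff)
qed

lemma continuous_locally_integrable:
  fixes f :: "'a::euclidean_space \<Rightarrow> 'b::euclidean_space"
  assumes "continuous_on UNIV f"
  shows "locally_integrable \<Omega> f"
  unfolding locally_integrable_def
proof (intro allI impI)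
  fix K assume K: "compact K \<and> K \<subseteq> \<Omega>"
  have [measurable]: "f \<in> borel_measurable borel" "K \<in> sets borel"
    using assms K borel_compact by (auto intro: borel_measurable_continuous_onI)
  have "integrable lborel (\<lambda>x. indicator K x *\<^sub>R f x)"
    using K by (intro borel_integrable_compact continuous_on_subset[OF assms]) auto
  then have "integrable lebesgue (\<lambda>x. indicator K x *\<^sub>R f x)"
    by (subst integrable_completion) auto
  then show "integrable (lebesgue_on K) f"
    by (subst integrable_restrict_space) auto
qed

text \<open>Integration by parts is the vanishing of the integral of \<open>\<partial>\<^sub>b (f \<phi>)\<close>, since \<open>f \<phi>\<close> is a test function.\<close>
lemma has_weak_gradient_smooth:
  assumes \<Omega>: "open \<Omega>" and f: "smooth f"
  shows "has_weak_gradient \<Omega> f (gradient f)"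
  unfolding has_weak_gradient_def
proof (intro conjI ballI)
  show lf: "locally_integrable \<Omega> f"
    by (intro continuous_locally_integrable smooth_continuous f)
  show lg: "locally_integrable \<Omega> (gradient f)"
    by (intro continuous_locally_integrable continuous_on_gradient f)
  fix \<phi> b assume \<phi>: "\<phi> \<in> test_functions \<Omega>" and b: "(b::'a) \<in> Basis"
  have p: "(\<lambda>x. f x * \<phi> x) \<in> test_functions \<Omega>" by (rule test_functions_mult[OF \<phi> f])
  obtain K where K: "compact K" "K \<subseteq> \<Omega>" "\<forall>x. x \<notin> K \<longrightarrow> f x * \<phi> x = 0 \<and> gradient (\<lambda>x. f x * \<phi> x) x = 0"
    using test_functions_support[OF p] .
  have "(\<integral>x. gradient (\<lambda>x. f x * \<phi> x) x \<bullet> b \<partial>lebesgue_on \<Omega>) = (\<integral>x. gradient (\<lambda>x. f x * \<phi> x) x \<bullet> b \<partial>lborel)"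
  proof (rule integrable_lebesgue_on_borel(2))
    show "(\<lambda>x. gradient (\<lambda>x. f x * \<phi> x) x \<bullet> b) \<in> borel_measurable borel"
      using test_function_integrable(2)[OF p b] by auto
  qed (use \<Omega> K in auto)
  also have "\<dots> = 0"
    by (rule integral_gradient_test_function[OF test_functions_mono[OF p] b]) simp
  finally have "(\<integral>x. f x * (gradient \<phi> x \<bullet> b) + (gradient f x \<bullet> b) * \<phi> x \<partial>lebesgue_on \<Omega>) = 0"
    by (simp add: gradient_mult[OF f test_functions_smooth[OF \<phi>]] inner_add_left mult.commute[of "\<phi> _"])
  then show "(\<integral>x. f x * (gradient \<phi> x \<bullet> b) \<partial>lebesgue_on \<Omega>) = - (\<integral>x. (gradient f x \<bullet> b) * \<phi> x \<partial>lebesgue_on \<Omega>)"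
    using integrable_times_test(2)[OF lf \<phi> \<Omega> b] integrable_times_test(1)[OF locally_integrable_inner[OF lg] \<phi> \<Omega>, of b]
    by simp
qed

section \<open>The boundary integral controls integrals of derivatives\<close>

lemma borel_measurable_hausdorff:
  assumes "f \<in> borel_measurable borel"
  shows "f \<in> borel_measurable (hausdorff_measure s)"
proof (rule measurableI)
  fix A :: "'b set" assume "A \<in> sets borel"
  then have "f -` A \<inter> space borel \<in> sets borel" by (rule measurable_sets[OF assms])
  then show "f -` A \<inter> space (hausdorff_measure s) \<in> sets (hausdorff_measure s)"
    by (simp add: borel_sets_hausdorff_measure)
qed simp

lemma frontier_borel: "frontier S \<in> sets borel"
  by (simp add: frontier_closed)

lemma space_boundary_measure [simp]: "space (boundary_measure \<Omega>) = frontier \<Omega>"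
  by (simp add: boundary_measure_def space_restrict_space)

lemma borel_measurable_boundary:
  "f \<in> borel_measurable borel \<Longrightarrow> f \<in> borel_measurable (boundary_measure \<Omega>)"
  unfolding boundary_measure_def by (intro measurable_restrict_space1 borel_measurable_hausdorff)

lemma boundary_measure_borel:
  fixes \<Omega> :: "'a::euclidean_space set"
  assumes "A \<in> sets borel" "A \<subseteq> frontier \<Omega>"
  shows "A \<in> sets (boundary_measure \<Omega>)"
    and "emeasure (boundary_measure \<Omega>) A = hausdorff_outer (DIM('a) - 1) A"
proof -
  have "A = frontier \<Omega> \<inter> A" using assms(2) by auto
  then show "A \<in> sets (boundary_measure \<Omega>)"
    unfolding boundary_measure_def sets_restrict_space
    using borel_sets_hausdorff_measure[OF assms(1)] by blast
  show "emeasure (boundary_measure \<Omega>) A = hausdorff_outer (DIM('a) - 1) A"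
    unfolding boundary_measure_def
    using assms borel_sets_hausdorff_measure[OF frontier_borel]
    by (subst emeasure_restrict_space) (auto simp: emeasure_hausdorff_measure)
qed

lemma finite_boundary_measure:
  fixes \<Omega> :: "'a::euclidean_space set"
  assumes "hausdorff_outer (DIM('a) - 1) (frontier \<Omega>) < top"
  shows "finite_measure (boundary_measure \<Omega>)"
  using assms boundary_measure_borel(2)[OF frontier_borel, of \<Omega>] by (intro finite_measureI) (auto simp: less_top)

lemma segment_crosses_frontier:
  fixes \<Omega> :: "'a::euclidean_space set"
  assumes "(x \<in> \<Omega>) \<noteq> (x - s *\<^sub>R b \<in> \<Omega>)" "0 \<le> s"
  shows "\<exists>t\<in>{0..s}. x - t *\<^sub>R b \<in> frontier \<Omega>"
proof -
  have "closed_segment x (x - s *\<^sub>R b) \<inter> frontier \<Omega> \<noteq> {}"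
    using assms by (intro connected_Int_frontier) auto
  then obtain z where z: "z \<in> closed_segment x (x - s *\<^sub>R b)" "z \<in> frontier \<Omega>" by blast
  then obtain u where u: "0 \<le> u" "u \<le> 1" "z = (1 - u) *\<^sub>R x + u *\<^sub>R (x - s *\<^sub>R b)"
    unfolding closed_segment_def by blast
  have "z = x - (u * s) *\<^sub>R b" using u by (simp add: algebra_simps)
  moreover have "u * s \<in> {0..s}" using u assms(2) by (auto simp: mult_left_le_one_le)
  ultimately show ?thesis using z by blast
qed

text \<open>Moving the translation from \<open>\<phi>\<close> to \<open>\<Omega>\<close> leaves the integral of \<open>\<phi>\<close> over the symmetric difference of
  \<open>\<Omega>\<close> and its translate. Each point there is joined to a point \<open>y\<close> of the boundary by a segment of
  length at most \<open>s\<close>, so \<open>\<bar>\<phi>\<bar>\<close> exceeds \<open>\<bar>\<phi>(y)\<bar>\<close> by at most \<open>M s\<close>. Splitting the boundary into the level sets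
  of \<open>\<bar>\<phi>\<bar>\<close> with step \<open>e\<close> and covering their tubes gives a Riemann sum for the boundary integral.\<close>
lemma boundary_layer_estimate:
  fixes \<Omega> :: "'a::euclidean_space set"
  assumes \<Omega>: "open \<Omega>" and fin: "hausdorff_outer (DIM('a) - 1) (frontier \<Omega>) < top"
    and \<phi>: "\<phi> \<in> test_functions UNIV" and b: "b \<in> Basis"
    and M: "0 < M" "\<And>x. \<bar>\<phi> x\<bar> \<le> M" "\<And>x. norm (gradient \<phi> x) \<le> M"
    and s: "0 < s" and e: "0 < e"
  shows "\<bar>\<integral>x. indicator \<Omega> x * (\<phi> (x + s *\<^sub>R b) - \<phi> x) \<partial>lborel\<bar> \<le>
    tube_constant TYPE('a) * s * ((\<integral>y. \<bar>\<phi> y\<bar> \<partial>boundary_measure \<Omega>) + (e + M * s) * measure (boundary_measure \<Omega>) (frontier \<Omega>))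
      + e * s"
proof -
  let ?B = "boundary_measure \<Omega>" and ?F = "frontier \<Omega>"
  define T where "T = tube_constant TYPE('a) * s"
  have T: "0 < T" using tube_constant_pos[where 'a='a] s by (simp add: T_def)
  interpret B: finite_measure ?B by (rule finite_boundary_measure[OF fin])
  have sm: "smooth \<phi>" using \<phi> by (rule test_functions_smooth)
  have cont: "continuous_on UNIV \<phi>" by (rule smooth_continuous[OF sm])
  have [measurable]: "\<phi> \<in> borel_measurable borel" "\<Omega> \<in> sets borel" "?F \<in> sets borel"
    using \<Omega> cont by (auto intro: borel_measurable_continuous_onI frontier_borel)
  have i\<phi>: "integrable lborel \<phi>" by (rule test_function_integrable[OF \<phi>])
  \<comment> \<open>level sets of the boundary values\<close>
  define lev where "lev y = nat \<lfloor>\<bar>\<phi> y\<bar> / e\<rfloor>" for y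
  have lev: "real (lev y) * e \<le> \<bar>\<phi> y\<bar>" "\<bar>\<phi> y\<bar> \<le> (real (lev y) + 1) * e" for y
  proof -
    have r: "real (lev y) = of_int \<lfloor>\<bar>\<phi> y\<bar> / e\<rfloor>" using e by (simp add: lev_def)
    have "real (lev y) \<le> \<bar>\<phi> y\<bar> / e" "\<bar>\<phi> y\<bar> / e \<le> real (lev y) + 1"
      unfolding r by linarith+
    then show "real (lev y) * e \<le> \<bar>\<phi> y\<bar>" "\<bar>\<phi> y\<bar> \<le> (real (lev y) + 1) * e"
      using e by (simp_all only: pos_le_divide_eq pos_divide_le_eq)
  qed
  have [measurable]: "lev \<in> measurable borel (count_space UNIV)" unfolding lev_def by measurable
  define N where "N = nat \<lfloor>M / e\<rfloor> + 1"
  have levN: "lev y < N" for y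
  proof -
    have "\<bar>\<phi> y\<bar> / e \<le> M / e" using M(2) e by (intro divide_right_mono) auto
    then have "lev y \<le> nat \<lfloor>M / e\<rfloor>" unfolding lev_def by (intro nat_mono floor_mono)
    then show ?thesis by (simp add: N_def)
  qed
  define A where "A k = {y \<in> ?F. lev y = k}" for k
  have A: "A k \<in> sets borel" "A k \<subseteq> ?F" for k
  proof -
    have "A k = ?F \<inter> (lev -` {k} \<inter> space borel)" by (auto simp: A_def)
    moreover have "lev -` {k} \<inter> space borel \<in> sets borel"
      by (rule measurable_sets[of lev _ "count_space UNIV"]) auto
    ultimately show "A k \<in> sets borel" by (simp add: sets.Int)
  qed (auto simp: A_def)
  define c where "c k = (real k + 1) * e + M * s" for k
  have c: "0 \<le> c k" for k using e M s by (simp add: c_def)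
  \<comment> \<open>the error allowed in each tube, small enough for the weighted sum of all errors to stay below \<open>e s\<close>\<close>
  define d where "d = e * s / ((\<Sum>k<N. c k) + 1)"
  have S: "0 \<le> (\<Sum>k<N. c k)" using c by (intro sum_nonneg)
  have d: "0 < d" unfolding d_def using e s S by (intro divide_pos_pos) auto
  have "(\<Sum>k<N. c k) / ((\<Sum>k<N. c k) + 1) * (e * s) \<le> 1 * (e * s)"
    using S e s by (intro mult_right_mono) auto
  then have Sd: "(\<Sum>k<N. c k) * d \<le> e * s" by (simp add: d_def mult_ac)
  have HA: "hausdorff_outer (DIM('a) - 1) (A k) = ennreal (measure ?B (A k))" for k
    using boundary_measure_borel(2)[OF A] B.emeasure_eq_measure by metis
  have "\<exists>U\<in>sets borel. (\<forall>y\<in>A k. \<forall>t\<in>{0..s}. y + t *\<^sub>R b \<in> U) \<and>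
      emeasure lborel U \<le> ennreal (T * measure ?B (A k) + d)" for k
  proof -
    have eq: "ennreal T * ennreal (measure ?B (A k)) + ennreal d = ennreal (T * measure ?B (A k) + d)"
      using T d by (subst ennreal_plus) (auto simp: ennreal_mult)
    have "hausdorff_outer (DIM('a) - 1) (A k) < top" unfolding HA by simp
    from tube_cover[OF this s b d] show ?thesis
      unfolding HA T_def[symmetric] eq .
  qed
  then obtain U where U: "\<And>k. U k \<in> sets borel" "\<And>k y t. y \<in> A k \<Longrightarrow> t \<in> {0..s} \<Longrightarrow> y + t *\<^sub>R b \<in> U k"
      "\<And>k. emeasure lborel (U k) \<le> ennreal (T * measure ?B (A k) + d)"
    by metis
  have Ufin: "emeasure lborel (U k) < \<infinity>" for k
    using U(3)[of k] by (rule le_less_trans) simp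
  have mU: "measure lborel (U k) \<le> T * measure ?B (A k) + d" for k
    using U(3)[of k] T d by (simp add: measure_def enn2real_leI)
  note [measurable] = U(1)
  have iU: "integrable lborel (\<lambda>x. c k * indicator (U k) x)" for k
    using Ufin U(1) by (intro integrable_mult_right integrable_real_indicator) auto
  have pt: "\<bar>(indicator \<Omega> (x - s *\<^sub>R b) - indicator \<Omega> x) * \<phi> x\<bar> \<le> (\<Sum>k<N. c k * indicator (U k) x)" for x
  proof (cases "(x \<in> \<Omega>) = (x - s *\<^sub>R b \<in> \<Omega>)")
    case True
    then show ?thesis using c by (auto simp: indicator_def intro!: sum_nonneg)
  next
    case False
    then have "\<exists>t\<in>{0..s}. x - t *\<^sub>R b \<in> ?F"
      using s by (intro segment_crosses_frontier) auto
    then obtain t where t: "t \<in> {0..s}" "x - t *\<^sub>R b \<in> ?F" by blast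
    define y where "y = x - t *\<^sub>R b"
    have yA: "y \<in> A (lev y)" using t by (simp add: A_def y_def)
    have "x = y + t *\<^sub>R b" by (simp add: y_def)
    then have xU: "x \<in> U (lev y)" using U(2)[OF yA t(1)] by simp
    have "\<bar>\<phi> x - \<phi> y\<bar> \<le> M * norm (x - y)" by (rule test_function_lipschitz[OF sm M(3)])
    also have "\<dots> \<le> M * s" using t M b by (intro mult_left_mono) (auto simp: y_def)
    finally have "\<bar>\<phi> x\<bar> \<le> c (lev y)" using lev(2)[of y] by (simp add: c_def)
    also have "\<dots> = c (lev y) * indicator (U (lev y)) x" using xU by simp
    also have "\<dots> \<le> (\<Sum>k<N. c k * indicator (U k) x)"
      using levN[of y] c by (intro member_le_sum) auto
    finally show ?thesis using False by (auto simp: indicator_def)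
  qed
  have iB: "integrable ?B (\<lambda>y. \<bar>\<phi> y\<bar>)"
    using M(2) by (intro B.integrable_const_bound[where B = M]) (auto intro: borel_measurable_boundary)
  have i1: "integrable lborel (\<lambda>x. indicator \<Omega> x * \<phi> x)"
    using integrable_mult_indicator[OF _ i\<phi>, of \<Omega>] by simp
  have i2: "integrable lborel (\<lambda>x. indicator \<Omega> (x - s *\<^sub>R b) * \<phi> x)"
    by (rule Bochner_Integration.integrable_bound[OF i\<phi>]) (auto simp: indicator_def)
  have i3: "integrable lborel (\<lambda>x. indicator \<Omega> x * \<phi> (x + s *\<^sub>R b))"
    and e3: "(\<integral>x. indicator \<Omega> x * \<phi> (x + s *\<^sub>R b) \<partial>lborel) = (\<integral>x. indicator \<Omega> (x - s *\<^sub>R b) * \<phi> x \<partial>lborel)"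
    using i2 integral_translate[of "\<lambda>x. indicator \<Omega> (x - s *\<^sub>R b) * \<phi> x" "s *\<^sub>R b"] by auto
  have "(\<integral>x. indicator \<Omega> x * (\<phi> (x + s *\<^sub>R b) - \<phi> x) \<partial>lborel)
      = (\<integral>x. (indicator \<Omega> (x - s *\<^sub>R b) - indicator \<Omega> x) * \<phi> x \<partial>lborel)"
    using i1 i2 i3 e3 by (simp add: right_diff_distrib left_diff_distrib)
  also have "\<bar>\<dots>\<bar> \<le> (\<integral>x. \<bar>(indicator \<Omega> (x - s *\<^sub>R b) - indicator \<Omega> x) * \<phi> x\<bar> \<partial>lborel)"
    by (rule integral_abs_bound)
  also have "\<dots> \<le> (\<integral>x. (\<Sum>k<N. c k * indicator (U k) x) \<partial>lborel)"
    using i1 i2 iU by (intro integral_mono pt integrable_abs Bochner_Integration.integrable_sum)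
      (auto simp: left_diff_distrib)
  also have "\<dots> = (\<Sum>k<N. c k * measure lborel (U k))"
    by (subst Bochner_Integration.integral_sum[OF iU]) simp
  also have "\<dots> \<le> (\<Sum>k<N. c k * (T * measure ?B (A k) + d))"
    using c mU by (intro sum_mono mult_left_mono)
  also have "\<dots> = T * (\<Sum>k<N. c k * measure ?B (A k)) + (\<Sum>k<N. c k) * d"
    by (simp add: distrib_left sum.distrib sum_distrib_left sum_distrib_right mult_ac)
  also have "(\<Sum>k<N. c k * measure ?B (A k)) = (\<integral>y. (\<Sum>k<N. c k * indicator (A k) y) \<partial>?B)"
    using boundary_measure_borel(1)[OF A]
    by (subst Bochner_Integration.integral_sum) (auto simp: less_top[symmetric] Int_absorb2[OF A(2)])
  also have "\<dots> \<le> (\<integral>y. \<bar>\<phi> y\<bar> + (e + M * s) \<partial>?B)"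
  proof (rule integral_mono)
    show "integrable ?B (\<lambda>y. \<Sum>k<N. c k * indicator (A k) y)"
      using boundary_measure_borel(1)[OF A] by (intro Bochner_Integration.integrable_sum) (auto simp: less_top[symmetric])
    show "integrable ?B (\<lambda>y. \<bar>\<phi> y\<bar> + (e + M * s))"
      using iB by (intro Bochner_Integration.integrable_add) auto
    fix y assume "y \<in> space ?B"
    then have "(\<Sum>k<N. c k * indicator (A k) y) = (\<Sum>k<N. if k = lev y then c k else 0)"
      by (intro sum.cong) (auto simp: A_def indicator_def)
    also have "\<dots> = c (lev y)" using levN[of y] by simp
    also have "\<dots> \<le> \<bar>\<phi> y\<bar> + (e + M * s)" using lev(1)[of y] by (simp add: c_def algebra_simps)
    finally show "(\<Sum>k<N. c k * indicator (A k) y) \<le> \<bar>\<phi> y\<bar> + (e + M * s)" .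
  qed
  also have "(\<integral>y. \<bar>\<phi> y\<bar> + (e + M * s) \<partial>?B) = (\<integral>y. \<bar>\<phi> y\<bar> \<partial>?B) + (e + M * s) * measure ?B ?F"
    using iB by simp
  finally have "\<bar>\<integral>x. indicator \<Omega> x * (\<phi> (x + s *\<^sub>R b) - \<phi> x) \<partial>lborel\<bar> \<le>
      T * ((\<integral>y. \<bar>\<phi> y\<bar> \<partial>?B) + (e + M * s) * measure ?B ?F) + (\<Sum>k<N. c k) * d"
    using T by (simp add: mult_left_mono)
  then show ?thesis using Sd unfolding T_def by linarith
qed

text \<open>Divide \<open>boundary_layer_estimate\<close> by \<open>s\<close>, let \<open>s\<close> tend to zero and then the step of the level sets.\<close>
lemma boundary_integral_bound:
  fixes \<Omega> :: "'a::euclidean_space set"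
  assumes \<Omega>: "open \<Omega>" and fin: "hausdorff_outer (DIM('a) - 1) (frontier \<Omega>) < top"
    and \<phi>: "\<phi> \<in> test_functions UNIV" and b: "b \<in> Basis"
  shows "\<bar>\<integral>x. gradient \<phi> x \<bullet> b \<partial>lebesgue_on \<Omega>\<bar> \<le>
    tube_constant TYPE('a) * (\<integral>y. \<bar>\<phi> y\<bar> \<partial>boundary_measure \<Omega>)"
proof -
  let ?T = "tube_constant TYPE('a)" and ?I = "\<integral>y. \<bar>\<phi> y\<bar> \<partial>boundary_measure \<Omega>"
  let ?h = "measure (boundary_measure \<Omega>) (frontier \<Omega>)"
  let ?L = "\<integral>x. indicator \<Omega> x * (gradient \<phi> x \<bullet> b) \<partial>lborel"
  define s where "s n = inverse (real (Suc n))" for n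
  have s: "0 < s n" for n by (simp add: s_def)
  obtain M where "0 < M \<and> (\<forall>x. \<bar>\<phi> x\<bar> \<le> M \<and> norm (gradient \<phi> x) \<le> M)"
    using test_function_bounded[OF \<phi>] ..
  then have M: "0 < M" "\<And>x. \<bar>\<phi> x\<bar> \<le> M" "\<And>x. norm (gradient \<phi> x) \<le> M" by auto
  have "\<bar>?L\<bar> \<le> ?T * (?I + e * ?h) + e" if e: "0 < e" for e
  proof (rule LIMSEQ_le)
    show "(\<lambda>n. \<bar>\<integral>x. indicator \<Omega> x * ((\<phi> (x + s n *\<^sub>R b) - \<phi> x) / s n) \<partial>lborel\<bar>) \<longlonglongrightarrow> \<bar>?L\<bar>"
      unfolding s_def using \<Omega> by (intro tendsto_rabs difference_quotient_integral[OF \<phi> b]) auto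
    have "(\<lambda>n. ?T * (?I + (e + M * s n) * ?h) + e) \<longlonglongrightarrow> ?T * (?I + (e + M * 0) * ?h) + e"
      unfolding s_def by (intro tendsto_intros LIMSEQ_inverse_real_of_nat)
    then show "(\<lambda>n. ?T * (?I + (e + M * s n) * ?h) + e) \<longlonglongrightarrow> ?T * (?I + e * ?h) + e" by simp
    show "\<exists>N. \<forall>n\<ge>N. \<bar>\<integral>x. indicator \<Omega> x * ((\<phi> (x + s n *\<^sub>R b) - \<phi> x) / s n) \<partial>lborel\<bar> \<le> ?T * (?I + (e + M * s n) * ?h) + e"
    proof (intro exI allI impI)
      fix n
      have "\<bar>\<integral>x. indicator \<Omega> x * ((\<phi> (x + s n *\<^sub>R b) - \<phi> x) / s n) \<partial>lborel\<bar>
          = \<bar>\<integral>x. indicator \<Omega> x * (\<phi> (x + s n *\<^sub>R b) - \<phi> x) \<partial>lborel\<bar> / s n"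
        using s[of n] by (simp add: abs_divide)
      also have "\<dots> \<le> (?T * s n * (?I + (e + M * s n) * ?h) + e * s n) / s n"
        using s[of n] by (intro divide_right_mono boundary_layer_estimate[OF \<Omega> fin \<phi> b M s e]) simp
      also have "\<dots> = ?T * (?I + (e + M * s n) * ?h) + e"
        using s[of n] by (simp add: field_simps)
      finally show "\<bar>\<integral>x. indicator \<Omega> x * ((\<phi> (x + s n *\<^sub>R b) - \<phi> x) / s n) \<partial>lborel\<bar> \<le> ?T * (?I + (e + M * s n) * ?h) + e" .
    qed
  qed
  then have *: "\<bar>?L\<bar> \<le> ?T * ?I + e * (?T * ?h + 1)" if "0 < e" for e
    using that by (simp add: algebra_simps)
  have pos: "0 < ?T * ?h + 1"
    using tube_constant_pos[where 'a='a] by (intro add_nonneg_pos mult_nonneg_nonneg) auto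
  have "\<bar>?L\<bar> \<le> ?T * ?I"
  proof (rule field_le_epsilon)
    fix e :: real assume "0 < e"
    then show "\<bar>?L\<bar> \<le> ?T * ?I + e"
      using *[of "e / (?T * ?h + 1)"] pos by simp
  qed
  moreover have "(\<integral>x. gradient \<phi> x \<bullet> b \<partial>lebesgue_on \<Omega>) = ?L"
  proof -
    have "(\<lambda>x. indicator \<Omega> x *\<^sub>R (gradient \<phi> x \<bullet> b)) \<in> borel_measurable borel"
      using \<Omega> test_function_integrable(2)[OF \<phi> b] by (intro borel_measurable_scaleR) auto
    then show ?thesis
      using \<Omega> by (subst integral_restrict_space) (auto simp: integral_completion)
  qed
  ultimately show ?thesis by simp
qed

section \<open>Lipschitz boundaries have finite measure\<close>

lemma hausdorff_content_finite_cover: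
  fixes S :: "'a::euclidean_space set"
  assumes S: "finite S" and cov: "P \<subseteq> (\<Union>p\<in>S. cball p \<delta>)" and "0 < \<delta>"
  shows "hausdorff_content s (2 * \<delta>) P \<le> ennreal (real (card S) * (unit_ball_vol (real s) * \<delta> ^ s))"
proof -
  obtain f where f: "bij_betw f {0..<card S} S"
    using ex_bij_betw_nat_finite[OF S] by blast
  define C where "C i = (if i < card S then cball (f i) \<delta> else {})" for i
  have size: "hausdorff_size s (C i) = ennreal (unit_ball_vol (real s) * \<delta> ^ s)" if "i < card S" for i
    using that \<open>0 < \<delta>\<close> by (simp add: C_def hausdorff_size_def)
  have "hausdorff_content s (2 * \<delta>) P \<le> (\<Sum>i. hausdorff_size s (C i))"
  proof (rule hausdorff_content_le)
    show "P \<subseteq> (\<Union>i. C i)"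
    proof
      fix x assume "x \<in> P"
      then obtain p where "p \<in> S" "x \<in> cball p \<delta>" using cov by blast
      moreover have "p \<in> f ` {0..<card S}" using f \<open>p \<in> S\<close> by (simp add: bij_betw_def)
      then obtain i where "i < card S" "f i = p" by auto
      ultimately have "x \<in> C i" by (simp add: C_def)
      then show "x \<in> (\<Union>i. C i)" by blast
    qed
  qed (use \<open>0 < \<delta>\<close> in \<open>auto simp: C_def\<close>)
  also have "\<dots> = (\<Sum>i<card S. hausdorff_size s (C i))"
    by (rule suminf_finite) (auto simp: C_def)
  also have "\<dots> = (\<Sum>i<card S. ennreal (unit_ball_vol (real s) * \<delta> ^ s))"
    using size by (intro sum.cong) auto
  also have "\<dots> = ennreal (real (card S) * (unit_ball_vol (real s) * \<delta> ^ s))"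
    using \<open>0 < \<delta>\<close> by (simp add: ennreal_mult ennreal_of_nat_eq_real_of_nat)
  finally show ?thesis .
qed

lemma norm_orthogonal_part_le:
  fixes e v :: "'a::real_inner"
  assumes "norm e = 1"
  shows "norm (v - (e \<bullet> v) *\<^sub>R e) \<le> norm v"
proof (rule power2_le_imp_le)
  have "e \<bullet> e = 1" using assms by (simp add: norm_eq_1)
  then have "(norm (v - (e \<bullet> v) *\<^sub>R e))\<^sup>2 = (norm v)\<^sup>2 - (e \<bullet> v)\<^sup>2"
    unfolding power2_norm_eq_inner
    by (simp add: inner_diff_left inner_diff_right inner_commute power2_eq_square)
  then show "(norm (v - (e \<bullet> v) *\<^sub>R e))\<^sup>2 \<le> (norm v)\<^sup>2" by simp
qed simp

text \<open>The slope of the graph is at most \<open>L\<close>, so translates of it by multiples of \<open>\<delta> (L + 2)\<close> in the direction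
  \<open>e\<close> stay \<open>\<delta>\<close> apart. Stacking about \<open>1 / \<delta>\<close> translates of the balls of radius \<open>\<delta> / 2\<close> around the
  points of \<open>S\<close> therefore gives disjoint balls in a fixed ball, and comparing volumes bounds the number of
  points by a constant times \<open>\<delta>\<^sup>1\<^sup>-\<^sup>d\<close>.\<close>
lemma lipschitz_graph_packing:
  fixes P S :: "'a::euclidean_space set"
  assumes e: "norm e = 1" and L: "0 \<le> L"
    and lip: "\<And>x y. x \<in> P \<Longrightarrow> y \<in> P \<Longrightarrow> \<bar>e \<bullet> (x - y)\<bar> \<le> L * norm ((x - y) - (e \<bullet> (x - y)) *\<^sub>R e)"
    and R: "0 \<le> R" "P \<subseteq> cball 0 R" and \<delta>: "0 < \<delta>" "\<delta> \<le> 1"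
    and S: "finite S" "S \<subseteq> P" "\<And>x y. x \<in> S \<Longrightarrow> y \<in> S \<Longrightarrow> x \<noteq> y \<Longrightarrow> \<delta> < dist x y"
  shows "real (card S) * \<delta> ^ (DIM('a) - 1) \<le> (2 * (R + 2 * (L + 2) + 1)) ^ DIM('a)"
proof -
  define R' where "R' = R + 2 * (L + 2) + 1"
  have R': "0 < R'" using L R by (simp add: R'_def)
  define n where "n = nat \<lceil>1 / \<delta>\<rceil>"
  have n: "1 / \<delta> \<le> real n" "real n \<le> 2 / \<delta>"
  proof -
    have "1 \<le> 1 / \<delta>" using \<delta> by simp
    moreover have "real n = of_int \<lceil>1 / \<delta>\<rceil>" using \<delta> by (simp add: n_def)
    moreover have "of_int \<lceil>1 / \<delta>\<rceil> \<le> 1 / \<delta> + 1" "1 / \<delta> \<le> of_int \<lceil>1 / \<delta>\<rceil>" by linarith+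
    ultimately have "1 / \<delta> \<le> real n" "real n \<le> 1 / \<delta> + 1 / \<delta>" by linarith+
    then show "1 / \<delta> \<le> real n" "real n \<le> 2 / \<delta>" by auto
  qed
  define c where "c = (\<lambda>(p, k). p + (real k * \<delta> * (L + 2)) *\<^sub>R e)"
  have sep: "\<delta> \<le> dist (c x) (c y)" if xy: "x \<in> S \<times> {..<n}" "y \<in> S \<times> {..<n}" "x \<noteq> y" for x y
  proof -
    obtain p k q l where x: "x = (p, k)" and y: "y = (q, l)" by (cases x, cases y) auto
    have pq: "p \<in> S" "q \<in> S" using xy by (auto simp: x y)
    define v where "v = c x - c y"
    define m where "m = (real k - real l) * \<delta> * (L + 2)"
    have v: "v = (p - q) + m *\<^sub>R e" by (simp add: v_def c_def x y m_def algebra_simps)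
    show ?thesis
    proof (cases "k = l")
      case True
      then have "p \<noteq> q" using xy by (auto simp: x y)
      then show ?thesis using S(3)[OF pq] True by (simp add: c_def x y)
    next
      case False
      have ee: "e \<bullet> e = 1" using e by (simp add: norm_eq_1)
      show ?thesis
      proof (rule ccontr)
        assume "\<not> ?thesis"
        then have small: "norm v < \<delta>" by (simp add: v_def dist_norm)
        have ev: "e \<bullet> v = e \<bullet> (p - q) + m" using ee by (simp add: v inner_add_right)
        have "v - (e \<bullet> v) *\<^sub>R e = (p - q) - (e \<bullet> (p - q)) *\<^sub>R e"
          unfolding ev by (simp add: v algebra_simps)
        moreover have "norm (v - (e \<bullet> v) *\<^sub>R e) \<le> norm v" by (rule norm_orthogonal_part_le[OF e])
        ultimately have "norm ((p - q) - (e \<bullet> (p - q)) *\<^sub>R e) \<le> \<delta>" using small by simp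
        then have "\<bar>e \<bullet> (p - q)\<bar> \<le> L * \<delta>"
          using lip[of p q] pq S(2) L by (meson mult_left_mono order_trans subsetD)
        moreover have "\<bar>e \<bullet> v\<bar> \<le> norm v" using Cauchy_Schwarz_ineq2[of e v] e by simp
        moreover have "\<delta> * (L + 2) \<le> \<bar>m\<bar>"
        proof -
          have "1 \<le> \<bar>real k - real l\<bar>" using False by linarith
          then have "1 * (\<delta> * (L + 2)) \<le> \<bar>real k - real l\<bar> * (\<delta> * (L + 2))"
            using \<delta> L by (intro mult_right_mono) auto
          then show ?thesis using \<delta> L by (simp add: m_def abs_mult mult.assoc)
        qed
        ultimately show False using small ev \<delta> by (simp add: algebra_simps abs_if split: if_splits)
      qed
    qed
  qed
  have disj: "disjoint_family_on (\<lambda>x. ball (c x) (\<delta> / 2)) (S \<times> {..<n})"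
    unfolding disjoint_family_on_def
  proof (intro ballI impI)
    fix x y assume "x \<in> S \<times> {..<n}" "y \<in> S \<times> {..<n}" "x \<noteq> y"
    from sep[OF this] show "ball (c x) (\<delta> / 2) \<inter> ball (c y) (\<delta> / 2) = {}"
      by (intro disjoint_ballI) simp
  qed
  have inR: "ball (c x) (\<delta> / 2) \<subseteq> ball 0 R'" if "x \<in> S \<times> {..<n}" for x
  proof
    obtain p k where x: "x = (p, k)" by (cases x)
    fix z assume z: "z \<in> ball (c x) (\<delta> / 2)"
    have "real k * \<delta> \<le> 2"
    proof -
      have "real k * \<delta> \<le> (2 / \<delta>) * \<delta>"
        using that n \<delta> by (intro mult_right_mono) (auto simp: x)
      then show ?thesis using \<delta> by simp
    qed
    then have "real k * \<delta> * (L + 2) \<le> 2 * (L + 2)"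
      using L by (intro mult_right_mono) auto
    moreover have "norm (c x) \<le> norm p + norm ((real k * \<delta> * (L + 2)) *\<^sub>R e)"
      unfolding c_def x by (simp only: prod.case) (rule norm_triangle_ineq)
    moreover have "norm ((real k * \<delta> * (L + 2)) *\<^sub>R e) = real k * \<delta> * (L + 2)"
      using e \<delta> L by (simp add: abs_mult)
    moreover have "norm p \<le> R" using that S(2) R by (auto simp: x subset_iff)
    moreover have "norm z \<le> norm (c x) + norm (z - c x)" by (rule norm_triangle_sub)
    moreover have "norm (z - c x) < \<delta> / 2" using z by (simp add: dist_norm norm_minus_commute)
    ultimately show "z \<in> ball 0 R'" using \<delta> by (simp add: R'_def)
  qed
  let ?V = "unit_ball_vol (real DIM('a))"
  have V: "0 < ?V" by simp
  have "ennreal (real (card S * n) * (?V * (\<delta> / 2) ^ DIM('a))) = (\<Sum>x\<in>S \<times> {..<n}. emeasure lborel (ball (c x) (\<delta> / 2)))"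
    using \<delta> by (simp add: emeasure_ball ennreal_mult ennreal_of_nat_eq_real_of_nat card_cartesian_product)
  also have "\<dots> = emeasure lborel (\<Union>x\<in>S \<times> {..<n}. ball (c x) (\<delta> / 2))"
    using S(1) disj by (intro sum_emeasure) auto
  also have "\<dots> \<le> emeasure lborel (ball (0::'a) R')"
    using inR by (intro emeasure_mono) auto
  also have "\<dots> = ennreal (?V * R' ^ DIM('a))" using R' by (simp add: emeasure_ball)
  finally have "real (card S * n) * (?V * (\<delta> / 2) ^ DIM('a)) \<le> ?V * R' ^ DIM('a)"
    using R' V by (simp add: ennreal_le_iff)
  then have "?V * (real (card S) * real n * (\<delta> / 2) ^ DIM('a)) \<le> ?V * R' ^ DIM('a)"
    by (simp add: mult_ac)
  then have vol: "real (card S) * real n * (\<delta> / 2) ^ DIM('a) \<le> R' ^ DIM('a)"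
    using V by (simp only: mult_le_cancel_left_pos)
  have "real (card S) * \<delta> ^ (DIM('a) - 1) = real (card S) * (1 / \<delta>) * \<delta> ^ DIM('a)"
    using \<delta> by (simp add: power_eq_if[of \<delta> "DIM('a)"])
  also have "\<dots> \<le> real (card S) * real n * \<delta> ^ DIM('a)"
    using n \<delta> by (intro mult_right_mono mult_left_mono) auto
  also have "\<dots> = 2 ^ DIM('a) * (real (card S) * real n * (\<delta> / 2) ^ DIM('a))"
    by (simp add: power_divide)
  also have "\<dots> \<le> 2 ^ DIM('a) * R' ^ DIM('a)"
    using vol by (intro mult_left_mono) auto
  also have "\<dots> = (2 * R') ^ DIM('a)" by (simp add: power_mult_distrib)
  finally show ?thesis by (simp add: R'_def)
qed

text \<open>A maximal \<open>\<delta>\<close>-separated subset exists by the packing bound, and balls of radius \<open>\<delta>\<close> around its points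
  cover the graph.\<close>
lemma lipschitz_graph_finite_hausdorff:
  fixes P :: "'a::euclidean_space set"
  assumes e: "norm e = 1" and L: "0 \<le> L"
    and lip: "\<And>x y. x \<in> P \<Longrightarrow> y \<in> P \<Longrightarrow> \<bar>e \<bullet> (x - y)\<bar> \<le> L * norm ((x - y) - (e \<bullet> (x - y)) *\<^sub>R e)"
    and "bounded P"
  shows "hausdorff_outer (DIM('a) - 1) P < top"
proof -
  obtain R where "\<forall>x\<in>P. norm x \<le> R" using \<open>bounded P\<close> unfolding bounded_iff ..
  then have R: "0 \<le> \<bar>R\<bar>" "P \<subseteq> cball 0 \<bar>R\<bar>" by auto
  define Q where "Q = (2 * (\<bar>R\<bar> + 2 * (L + 2) + 1)) ^ DIM('a)"
  let ?v = "unit_ball_vol (real (DIM('a) - 1))"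
  have main: "hausdorff_content (DIM('a) - 1) (2 * \<delta>) P \<le> ennreal (?v * Q)" if \<delta>: "0 < \<delta>" "\<delta> \<le> 1" for \<delta>
  proof -
    let ?sep = "\<lambda>S. finite S \<and> S \<subseteq> P \<and> (\<forall>x\<in>S. \<forall>y\<in>S. x \<noteq> y \<longrightarrow> \<delta> < dist x y)"
    have bound: "real (card S) * \<delta> ^ (DIM('a) - 1) \<le> Q" if "?sep S" for S
      unfolding Q_def using that by (intro lipschitz_graph_packing[OF e L lip R \<delta>]) auto
    have "card S \<le> nat \<lceil>Q / \<delta> ^ (DIM('a) - 1)\<rceil>" if "?sep S" for S
    proof -
      have "real (card S) \<le> Q / \<delta> ^ (DIM('a) - 1)"
        using bound[OF that] \<delta> by (subst pos_le_divide_eq) auto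
      then show ?thesis by linarith
    qed
    then have bdd: "\<forall>S. ?sep S \<longrightarrow> card S < Suc (nat \<lceil>Q / \<delta> ^ (DIM('a) - 1)\<rceil>)"
      by (simp add: less_Suc_eq_le)
    have "?sep {}" by simp
    from ex_has_greatest_nat[of ?sep "{}" card, OF this bdd]
    obtain S where S: "?sep S" and max: "\<And>S'. ?sep S' \<Longrightarrow> card S' \<le> card S" by blast
    have cov: "P \<subseteq> (\<Union>p\<in>S. cball p \<delta>)"
    proof
      fix x assume x: "x \<in> P"
      show "x \<in> (\<Union>p\<in>S. cball p \<delta>)"
      proof (rule ccontr)
        assume "\<not> ?thesis"
        then have far: "\<forall>p\<in>S. \<delta> < dist p x" by auto
        then have "x \<notin> S" using \<delta> by force
        have "?sep (insert x S)" using S x far by (auto simp: dist_commute)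
        from max[OF this] show False using S \<open>x \<notin> S\<close> by simp
      qed
    qed
    have "hausdorff_content (DIM('a) - 1) (2 * \<delta>) P \<le> ennreal (real (card S) * (?v * \<delta> ^ (DIM('a) - 1)))"
      using S cov \<delta> by (intro hausdorff_content_finite_cover) auto
    also have "\<dots> \<le> ennreal (?v * Q)"
      using bound[OF S] by (intro ennreal_leI) (simp add: mult.left_commute[of _ ?v] mult_left_mono)
    finally show ?thesis .
  qed
  have "hausdorff_outer (DIM('a) - 1) P \<le> ennreal (?v * Q)"
    unfolding hausdorff_outer_def
  proof (rule SUP_least)
    fix \<delta> :: real assume "\<delta> \<in> {0<..}"
    then have "hausdorff_content (DIM('a) - 1) \<delta> P \<le> hausdorff_content (DIM('a) - 1) (2 * min 1 (\<delta> / 2)) P"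
      by (intro hausdorff_content_antimono) auto
    also have "\<dots> \<le> ennreal (?v * Q)" using \<open>\<delta> \<in> {0<..}\<close> by (intro main) auto
    finally show "hausdorff_content (DIM('a) - 1) \<delta> P \<le> ennreal (?v * Q)" .
  qed
  also have "\<dots> < top" by simp
  finally show ?thesis .
qed

text \<open>A point below the graph is interior to \<open>\<Omega>\<close> and a point above it is exterior, because the function
  whose sign decides this is continuous.\<close>
lemma subgraph_frontier:
  fixes \<Omega> :: "'a::euclidean_space set"
  assumes \<Omega>: "open \<Omega>" and e: "norm e = 1" and lip: "lipschitz_on L {y. e \<bullet> y = 0} \<gamma>"
    and graph: "\<Omega> \<inter> ball x r = {y \<in> ball x r. e \<bullet> y < \<gamma> (y - (e \<bullet> y) *\<^sub>R e)}"
    and y: "y \<in> frontier \<Omega>" "y \<in> ball x r"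
  shows "e \<bullet> y = \<gamma> (y - (e \<bullet> y) *\<^sub>R e)"
proof -
  let ?h = "\<lambda>y. e \<bullet> y - \<gamma> (y - (e \<bullet> y) *\<^sub>R e)"
  have ee: "e \<bullet> e = 1" using e by (simp add: norm_eq_1)
  have "continuous_on UNIV (\<lambda>y. \<gamma> (y - (e \<bullet> y) *\<^sub>R e))"
    by (rule continuous_on_compose2[OF lipschitz_on_continuous_on[OF lip]])
       (auto intro!: continuous_intros simp: inner_diff_right ee)
  then have cont: "continuous_on UNIV ?h" by (intro continuous_intros)
  have "y \<notin> \<Omega>" using y(1) \<Omega> by (simp add: frontier_def interior_open)
  then have "y \<notin> \<Omega> \<inter> ball x r" by simp
  then have ge: "0 \<le> ?h y" unfolding graph using y(2) by simp
  have "\<not> 0 < ?h y"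
  proof
    assume "0 < ?h y"
    define V where "V = ball x r \<inter> {z. 0 < ?h z}"
    have "open V" unfolding V_def
      by (intro open_Int open_ball open_Collect_less continuous_on_const cont)
    moreover have "y \<in> V" using y(2) \<open>0 < ?h y\<close> by (simp add: V_def)
    moreover have "V \<inter> \<Omega> = {}"
    proof (rule ccontr)
      assume "V \<inter> \<Omega> \<noteq> {}"
      then obtain z where z: "z \<in> V" "z \<in> \<Omega>" by blast
      then have "z \<in> \<Omega> \<inter> ball x r" by (simp add: V_def)
      then show False using z(1) unfolding graph by (simp add: V_def)
    qed
    moreover have "y \<in> closure \<Omega>" using y(1) by (simp add: frontier_def)
    ultimately show False using open_Int_closure_eq_empty[of V \<Omega>] by blast
  qed
  with ge show ?thesis by simp
qed

lemma lipschitz_boundary_finite_measure: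
  fixes \<Omega> :: "'a::euclidean_space set"
  assumes \<Omega>: "open \<Omega>" "bounded \<Omega>" and lb: "lipschitz_boundary \<Omega>"
  shows "hausdorff_outer (DIM('a) - 1) (frontier \<Omega>) < top"
proof -
  let ?H = "hausdorff_outer (DIM('a) - 1)"
  have loc: "\<exists>r>0. ?H (frontier \<Omega> \<inter> ball x r) < top" if "x \<in> frontier \<Omega>" for x
  proof -
    obtain r e \<gamma> L where r: "0 < r" and e: "norm e = 1" and lip: "lipschitz_on L {y. e \<bullet> y = 0} \<gamma>"
      and graph: "\<Omega> \<inter> ball x r = {y \<in> ball x r. e \<bullet> y < \<gamma> (y - (e \<bullet> y) *\<^sub>R e)}"
      using lb \<open>x \<in> frontier \<Omega>\<close> unfolding lipschitz_boundary_def by blast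
    have ee: "e \<bullet> e = 1" using e by (simp add: norm_eq_1)
    have "?H (frontier \<Omega> \<inter> ball x r) < top"
    proof (rule lipschitz_graph_finite_hausdorff[OF e lipschitz_on_nonneg[OF lip]])
      fix y z assume yz: "y \<in> frontier \<Omega> \<inter> ball x r" "z \<in> frontier \<Omega> \<inter> ball x r"
      let ?\<pi> = "\<lambda>y. y - (e \<bullet> y) *\<^sub>R e"
      have "e \<bullet> y = \<gamma> (?\<pi> y)" "e \<bullet> z = \<gamma> (?\<pi> z)"
        using yz by (auto intro: subgraph_frontier[OF \<Omega>(1) e lip graph])
      then have "\<bar>e \<bullet> (y - z)\<bar> = dist (\<gamma> (?\<pi> y)) (\<gamma> (?\<pi> z))"
        by (simp add: inner_diff_right dist_real_def)
      also have "\<dots> \<le> L * dist (?\<pi> y) (?\<pi> z)"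
        by (rule lipschitz_onD[OF lip]) (auto simp: inner_diff_right ee)
      also have "dist (?\<pi> y) (?\<pi> z) = norm ((y - z) - (e \<bullet> (y - z)) *\<^sub>R e)"
        by (simp add: dist_norm inner_diff_right algebra_simps)
      finally show "\<bar>e \<bullet> (y - z)\<bar> \<le> L * norm ((y - z) - (e \<bullet> (y - z)) *\<^sub>R e)" .
    qed (auto intro: bounded_subset[OF bounded_ball])
    with r show ?thesis by blast
  qed
  have comp: "compact (frontier \<Omega>)"
    using \<Omega>(2) by (rule compact_frontier_bounded)
  have "\<forall>x. \<exists>r. x \<in> frontier \<Omega> \<longrightarrow> 0 < r \<and> ?H (frontier \<Omega> \<inter> ball x r) < top"
    using loc by blast
  then obtain r where r: "\<And>x. x \<in> frontier \<Omega> \<Longrightarrow> 0 < r x \<and> ?H (frontier \<Omega> \<inter> ball x (r x)) < top"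
    by metis
  have "\<forall>B\<in>(\<lambda>x. ball x (r x)) ` frontier \<Omega>. open B" by auto
  moreover have "frontier \<Omega> \<subseteq> \<Union>((\<lambda>x. ball x (r x)) ` frontier \<Omega>)" using r by force
  ultimately obtain I where I: "I \<subseteq> frontier \<Omega>" "finite I" "frontier \<Omega> \<subseteq> (\<Union>x\<in>I. ball x (r x))"
    using compactE_image[OF comp, of "frontier \<Omega>" "\<lambda>x. ball x (r x)"] by auto
  have "?H (\<Union>x\<in>I. frontier \<Omega> \<inter> ball x (r x)) < top"
    using I(2,1)
  proof (induction rule: finite_induct)
    case (insert x I)
    have "?H (\<Union>x\<in>insert x I. frontier \<Omega> \<inter> ball x (r x)) \<le> ?H (frontier \<Omega> \<inter> ball x (r x)) + ?H (\<Union>x\<in>I. frontier \<Omega> \<inter> ball x (r x))"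
      by (simp add: hausdorff_outer_Un)
    also have "\<dots> < top" using insert r[of x] by simp
    finally show ?case .
  qed simp
  moreover have "frontier \<Omega> \<subseteq> (\<Union>x\<in>I. frontier \<Omega> \<inter> ball x (r x))" using I(3) by blast
  ultimately show ?thesis
    using hausdorff_outer_mono by (metis le_less_trans)
qed

section \<open>Equal traces\<close>

lemma weak_gradient_AE:
  assumes "open \<Omega>" "has_weak_gradient \<Omega> u G"
  shows "AE x in lebesgue_on \<Omega>. weak_gradient \<Omega> u x = G x"
proof -
  have "has_weak_gradient \<Omega> u (weak_gradient \<Omega> u)"
    unfolding weak_gradient_def using assms(2) by (rule someI[of "has_weak_gradient \<Omega> u"])
  then show ?thesis by (rule has_weak_gradient_unique[OF assms(1) _ assms(2)])
qed

lemma weak_divergence_AE: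
  assumes "open \<Omega>" "has_weak_divergence \<Omega> p D"
  shows "AE x in lebesgue_on \<Omega>. weak_divergence \<Omega> p x = D x"
proof -
  have "has_weak_divergence \<Omega> p (weak_divergence \<Omega> p)"
    unfolding weak_divergence_def using assms(2) by (rule someI[of "has_weak_divergence \<Omega> p"])
  then show ?thesis by (rule has_weak_divergence_unique[OF assms(1) _ assms(2)])
qed

lemma has_weak_gradient_diff:
  assumes \<Omega>: "open \<Omega>" and u: "has_weak_gradient \<Omega> u G" and v: "has_weak_gradient \<Omega> v H"
  shows "has_weak_gradient \<Omega> (\<lambda>x. u x - v x) (\<lambda>x. G x - H x)"
  unfolding has_weak_gradient_def
proof (intro conjI ballI)
  have l: "locally_integrable \<Omega> u" "locally_integrable \<Omega> G" "locally_integrable \<Omega> v" "locally_integrable \<Omega> H"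
    using u v unfolding has_weak_gradient_def by auto
  show "locally_integrable \<Omega> (\<lambda>x. u x - v x)" "locally_integrable \<Omega> (\<lambda>x. G x - H x)"
    by (intro locally_integrable_diff l)+
  fix \<phi> b assume \<phi>: "\<phi> \<in> test_functions \<Omega>" and b: "(b::'a) \<in> Basis"
  have "(\<integral>x. (u x - v x) * (gradient \<phi> x \<bullet> b) \<partial>lebesgue_on \<Omega>)
      = (\<integral>x. u x * (gradient \<phi> x \<bullet> b) \<partial>lebesgue_on \<Omega>) - (\<integral>x. v x * (gradient \<phi> x \<bullet> b) \<partial>lebesgue_on \<Omega>)"
    using integrable_times_test(2)[OF l(1) \<phi> \<Omega> b] integrable_times_test(2)[OF l(3) \<phi> \<Omega> b]
    by (simp add: left_diff_distrib)
  also have "\<dots> = - ((\<integral>x. (G x \<bullet> b) * \<phi> x \<partial>lebesgue_on \<Omega>) - (\<integral>x. (H x \<bullet> b) * \<phi> x \<partial>lebesgue_on \<Omega>))"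
    using u v \<phi> b unfolding has_weak_gradient_def by simp
  also have "\<dots> = - (\<integral>x. ((G x - H x) \<bullet> b) * \<phi> x \<partial>lebesgue_on \<Omega>)"
    using integrable_times_test(1)[OF locally_integrable_inner[OF l(2)] \<phi> \<Omega>, of b]
      integrable_times_test(1)[OF locally_integrable_inner[OF l(4)] \<phi> \<Omega>, of b]
    by (simp add: left_diff_distrib inner_diff_left)
  finally show "(\<integral>x. (u x - v x) * (gradient \<phi> x \<bullet> b) \<partial>lebesgue_on \<Omega>) = - (\<integral>x. ((G x - H x) \<bullet> b) * \<phi> x \<partial>lebesgue_on \<Omega>)" .
qed

lemma L2_continuous_bounded:
  fixes f :: "'a::euclidean_space \<Rightarrow> 'b::euclidean_space"
  assumes f: "continuous_on UNIV f" and \<Omega>: "open \<Omega>" "bounded \<Omega>"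
  shows "f \<in> L2 (lebesgue_on \<Omega>)"
proof -
  interpret finite_measure "lebesgue_on \<Omega>"
    using \<Omega> by (intro finite_measure_lebesgue_on_bounded) auto
  have "bounded (f ` closure \<Omega>)"
    using \<Omega>(2) by (intro compact_imp_bounded compact_continuous_image continuous_on_subset[OF f]) auto
  then obtain C where "\<forall>y\<in>f ` closure \<Omega>. norm y \<le> C" unfolding bounded_iff ..
  then have C: "norm (f x) \<le> C" if "x \<in> \<Omega>" for x
    using that closure_subset[of \<Omega>] by blast
  have m: "f \<in> borel_measurable (lebesgue_on \<Omega>)"
    using f by (intro borel_imp_lebesgue_on borel_measurable_continuous_onI)
  have "integrable (lebesgue_on \<Omega>) (\<lambda>x. (norm (f x))\<^sup>2)"
  proof (rule integrable_const_bound)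
    show "AE x in lebesgue_on \<Omega>. norm ((norm (f x))\<^sup>2) \<le> C\<^sup>2"
      using C by (intro AE_I2) (auto intro!: power_mono)
  qed (use m in simp)
  with m show ?thesis by (simp add: L2_def)
qed

text \<open>Young's inequality with a weight that depends on the norm of \<open>h\<close>.\<close>
lemma L2_pairing_tendsto:
  fixes f :: "nat \<Rightarrow> 'a \<Rightarrow> real"
  assumes f: "\<And>n. f n \<in> L2 M" and f0: "f0 \<in> L2 M" and h: "h \<in> L2 M"
    and lim: "(\<lambda>n. \<integral>x. (f n x - f0 x)\<^sup>2 \<partial>M) \<longlonglongrightarrow> 0"
  shows "(\<lambda>n. \<integral>x. f n x * h x \<partial>M) \<longlonglongrightarrow> (\<integral>x. f0 x * h x \<partial>M)"
proof (rule LIMSEQ_I)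
  fix e :: real assume e: "0 < e"
  define I where "I = (\<integral>x. (h x)\<^sup>2 \<partial>M)"
  have I: "0 \<le> I" by (simp add: I_def)
  define \<delta> where "\<delta> = e / (I + 1)"
  have \<delta>: "0 < \<delta>" "\<delta> * I \<le> e"
    using e I by (auto simp: \<delta>_def field_simps)
  have "\<forall>\<^sub>F n in sequentially. (\<integral>x. (f n x - f0 x)\<^sup>2 \<partial>M) < \<delta> * e"
    using lim \<delta> e by (intro order_tendstoD(2)) auto
  then obtain N where N: "\<And>n. n \<ge> N \<Longrightarrow> (\<integral>x. (f n x - f0 x)\<^sup>2 \<partial>M) < \<delta> * e"
    by (auto simp: eventually_sequentially)
  show "\<exists>N. \<forall>n\<ge>N. norm ((\<integral>x. f n x * h x \<partial>M) - (\<integral>x. f0 x * h x \<partial>M)) < e"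
  proof (intro exI allI impI)
    fix n assume n: "n \<ge> N"
    have d: "(\<lambda>x. f n x - f0 x) \<in> L2 M" by (rule L2_diff[OF f f0])
    have sq: "integrable M (\<lambda>x. (f n x - f0 x)\<^sup>2)" "integrable M (\<lambda>x. (h x)\<^sup>2)"
      using d h by (auto simp: L2_def)
    have young: "\<bar>a * b\<bar> \<le> a\<^sup>2 / (2 * \<delta>) + \<delta> / 2 * b\<^sup>2" for a b :: real
    proof -
      have "0 \<le> (\<bar>a\<bar> - \<delta> * \<bar>b\<bar>)\<^sup>2 / (2 * \<delta>)" using \<delta> by simp
      also have "\<dots> = a\<^sup>2 / (2 * \<delta>) + \<delta> / 2 * b\<^sup>2 - \<bar>a\<bar> * \<bar>b\<bar>"
        using \<delta> by (simp add: power2_diff power_mult_distrib field_simps) (simp add: power2_eq_square)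
      finally show ?thesis by (simp add: abs_mult)
    qed
    have "(\<integral>x. f n x * h x \<partial>M) - (\<integral>x. f0 x * h x \<partial>M) = (\<integral>x. (f n x - f0 x) * h x \<partial>M)"
      using L2_integrable_mult[OF f h] L2_integrable_mult[OF f0 h] by (simp add: left_diff_distrib)
    also have "\<bar>\<dots>\<bar> \<le> (\<integral>x. \<bar>(f n x - f0 x) * h x\<bar> \<partial>M)" by (rule integral_abs_bound)
    also have "\<dots> \<le> (\<integral>x. (f n x - f0 x)\<^sup>2 / (2 * \<delta>) + \<delta> / 2 * (h x)\<^sup>2 \<partial>M)"
      using sq L2_integrable_mult[OF d h] by (intro integral_mono young integrable_abs) auto
    also have "\<dots> = (\<integral>x. (f n x - f0 x)\<^sup>2 \<partial>M) / (2 * \<delta>) + \<delta> / 2 * I"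
      using sq by (simp add: I_def)
    also have "\<dots> < (\<delta> * e) / (2 * \<delta>) + e / 2"
      using N[OF n] \<delta> by (intro add_less_le_mono divide_strict_right_mono) auto
    also have "\<dots> = e" using \<delta> by simp
    finally show "norm ((\<integral>x. f n x * h x \<partial>M) - (\<integral>x. f0 x * h x \<partial>M)) < e" by simp
  qed
qed

lemma H1_norm_tendsto:
  assumes \<Omega>: "open \<Omega>" "bounded \<Omega>" and w: "w \<in> H1 \<Omega>" and \<phi>: "\<And>n. smooth (\<phi> n)"
    and lim: "(\<lambda>n. H1_norm \<Omega> (\<lambda>x. \<phi> n x - w x)) \<longlonglongrightarrow> 0"
  shows "(\<lambda>n. \<integral>x. (\<phi> n x - w x)\<^sup>2 \<partial>lebesgue_on \<Omega>) \<longlonglongrightarrow> 0"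
    and "b \<in> Basis \<Longrightarrow> (\<lambda>n. \<integral>x. (gradient (\<phi> n) x \<bullet> b - weak_gradient \<Omega> w x \<bullet> b)\<^sup>2 \<partial>lebesgue_on \<Omega>) \<longlonglongrightarrow> 0"
proof -
  let ?M = "lebesgue_on \<Omega>"
  let ?v = "\<lambda>n x. \<phi> n x - w x"
  let ?G = "\<lambda>n x. gradient (\<phi> n) x - weak_gradient \<Omega> w x"
  note G = weak_gradient_props[OF \<Omega>(1) w]
  have GL: "?G n \<in> L2 ?M" for n
    by (intro L2_diff L2_continuous_bounded continuous_on_gradient \<phi> \<Omega> G)
  have ae: "AE x in ?M. weak_gradient \<Omega> (?v n) x = ?G n x" for n
    by (rule weak_gradient_AE[OF \<Omega>(1) has_weak_gradient_diff[OF \<Omega>(1) has_weak_gradient_smooth[OF \<Omega>(1) \<phi>] G(1)]])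
  have wm: "weak_gradient \<Omega> (?v n) \<in> borel_measurable ?M" for n
    by (rule measurable_lebesgue_on_cong_AE[OF L2_measurable[OF GL[of n]]]) (use \<Omega> ae[of n] in \<open>auto elim: AE_mp\<close>)
  have GI: "L2_inner \<Omega> (weak_gradient \<Omega> (?v n)) (weak_gradient \<Omega> (?v n)) = (\<integral>x. (norm (?G n x))\<^sup>2 \<partial>?M)" for n
    unfolding L2_inner_def power2_norm_eq_inner
  proof (rule integral_cong_AE)
    show "(\<lambda>x. ?G n x \<bullet> ?G n x) \<in> borel_measurable ?M"
      using L2_measurable[OF GL[of n]] by measurable
    show "AE x in ?M. weak_gradient \<Omega> (?v n) x \<bullet> weak_gradient \<Omega> (?v n) x = ?G n x \<bullet> ?G n x"
      using ae[of n] by eventually_elim simp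
  qed (use wm[of n] in measurable)
  have vI: "L2_inner \<Omega> (?v n) (?v n) = (\<integral>x. (?v n x)\<^sup>2 \<partial>?M)" for n
    by (simp add: L2_inner_def power2_eq_square)
  have sq: "(H1_norm \<Omega> (?v n))\<^sup>2 = (\<integral>x. (?v n x)\<^sup>2 \<partial>?M) + (\<integral>x. (norm (?G n x))\<^sup>2 \<partial>?M)" for n
    unfolding H1_norm_def vI GI by (rule real_sqrt_pow2) (intro add_nonneg_nonneg integral_nonneg; simp)
  have lim2: "(\<lambda>n. (H1_norm \<Omega> (?v n))\<^sup>2) \<longlonglongrightarrow> 0"
    using tendsto_power[OF lim, of 2] by simp
  show "(\<lambda>n. \<integral>x. (?v n x)\<^sup>2 \<partial>?M) \<longlonglongrightarrow> 0"
    by (rule tendsto_sandwich[OF _ _ tendsto_const lim2]) (auto simp: sq)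
  show "(\<lambda>n. \<integral>x. (gradient (\<phi> n) x \<bullet> b - weak_gradient \<Omega> w x \<bullet> b)\<^sup>2 \<partial>?M) \<longlonglongrightarrow> 0" if b: "b \<in> Basis"
  proof (rule tendsto_sandwich[OF _ _ tendsto_const lim2])
    have le: "(\<integral>x. (gradient (\<phi> n) x \<bullet> b - weak_gradient \<Omega> w x \<bullet> b)\<^sup>2 \<partial>?M) \<le> (\<integral>x. (norm (?G n x))\<^sup>2 \<partial>?M)" for n
    proof (rule integral_mono)
      show "integrable ?M (\<lambda>x. (gradient (\<phi> n) x \<bullet> b - weak_gradient \<Omega> w x \<bullet> b)\<^sup>2)"
        using L2_component[OF GL[of n], of b] by (simp add: L2_def inner_diff_left)
      show "integrable ?M (\<lambda>x. (norm (?G n x))\<^sup>2)" using GL[of n] by (simp add: L2_def)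
      fix x
      have "\<bar>?G n x \<bullet> b\<bar>\<^sup>2 \<le> (norm (?G n x))\<^sup>2"
        using b by (intro power_mono Basis_le_norm) auto
      then show "(gradient (\<phi> n) x \<bullet> b - weak_gradient \<Omega> w x \<bullet> b)\<^sup>2 \<le> (norm (?G n x))\<^sup>2"
        by (simp add: inner_diff_left)
    qed
    have nn: "0 \<le> (\<integral>x. (?v n x)\<^sup>2 \<partial>?M)" for n by simp
    have "(\<integral>x. (gradient (\<phi> n) x \<bullet> b - weak_gradient \<Omega> w x \<bullet> b)\<^sup>2 \<partial>?M) \<le> (H1_norm \<Omega> (?v n))\<^sup>2" for n
      using le[of n] nn[of n] unfolding sq by linarith
    then show "\<forall>\<^sub>F n in sequentially. (\<integral>x. (gradient (\<phi> n) x \<bullet> b - weak_gradient \<Omega> w x \<bullet> b)\<^sup>2 \<partial>?M) \<le> (H1_norm \<Omega> (?v n))\<^sup>2"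
      by simp
  qed simp
qed

text \<open>The test functions may be nonzero on the boundary, so the condition says that the extensions of \<open>w\<close> and
  \<open>G\<close> by zero are a function and its weak gradient on the whole space. This is the form in which a
  vanishing trace is used.\<close>
definition zero_extension_gradient :: "'a::euclidean_space set \<Rightarrow> ('a \<Rightarrow> real) \<Rightarrow> ('a \<Rightarrow> 'a) \<Rightarrow> bool" where
  "zero_extension_gradient \<Omega> w G \<longleftrightarrow> w \<in> L2 (lebesgue_on \<Omega>) \<and> G \<in> L2 (lebesgue_on \<Omega>) \<and>
    (\<forall>\<psi>\<in>test_functions UNIV. \<forall>b\<in>Basis.
      (\<integral>x. w x * (gradient \<psi> x \<bullet> b) \<partial>lebesgue_on \<Omega>) = - (\<integral>x. (G x \<bullet> b) * \<psi> x \<partial>lebesgue_on \<Omega>))"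

text \<open>The boundary has finite measure, so smallness in \<open>L2\<close> gives smallness in \<open>L1\<close>, here through
  \<open>\<bar>t\<bar> \<le> \<delta> + t\<^sup>2 / \<delta>\<close>.\<close>
lemma same_trace_boundary_L1:
  fixes g :: "'a::euclidean_space \<Rightarrow> real"
  assumes fin: "hausdorff_outer (DIM('a) - 1) (frontier \<Omega>) < top"
    and g: "g \<in> borel_measurable (boundary_measure \<Omega>)"
    and \<phi>1: "\<And>n. continuous_on UNIV (\<phi>1 n)" and \<phi>2: "\<And>n. continuous_on UNIV (\<phi>2 n)"
    and l1: "(\<lambda>n. \<integral>\<^sup>+x. ennreal ((\<phi>1 n x - g x)\<^sup>2) \<partial>boundary_measure \<Omega>) \<longlonglongrightarrow> 0"
    and l2: "(\<lambda>n. \<integral>\<^sup>+x. ennreal ((\<phi>2 n x - g x)\<^sup>2) \<partial>boundary_measure \<Omega>) \<longlonglongrightarrow> 0"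
    and e: "0 < e"
  shows "\<forall>\<^sub>F n in sequentially. (\<integral>\<^sup>+x. ennreal \<bar>\<phi>1 n x - \<phi>2 n x\<bar> \<partial>boundary_measure \<Omega>) \<le> ennreal e"
proof -
  let ?B = "boundary_measure \<Omega>"
  interpret B: finite_measure ?B by (rule finite_boundary_measure[OF fin])
  define h where "h = measure ?B (frontier \<Omega>)"
  have h: "emeasure ?B (space ?B) = ennreal h" "0 \<le> h"
    by (auto simp: h_def B.emeasure_eq_measure)
  define \<delta> where "\<delta> = e / (3 * (h + 1))"
  have \<delta>: "0 < \<delta>" "\<delta> * h \<le> e / 3"
    using e h by (auto simp: \<delta>_def field_simps)
  have [measurable]: "g \<in> borel_measurable ?B" "\<phi>1 n \<in> borel_measurable ?B" "\<phi>2 n \<in> borel_measurable ?B" for n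
    using g \<phi>1 \<phi>2 by (auto intro!: borel_measurable_boundary borel_measurable_continuous_onI)
  have c: "0 < \<delta> / 2 * (e / 3)" using \<delta> e by simp
  have "\<forall>\<^sub>F n in sequentially. (\<integral>\<^sup>+x. ennreal ((\<phi>1 n x - g x)\<^sup>2) \<partial>?B) < ennreal (\<delta> / 2 * (e / 3))"
    "\<forall>\<^sub>F n in sequentially. (\<integral>\<^sup>+x. ennreal ((\<phi>2 n x - g x)\<^sup>2) \<partial>?B) < ennreal (\<delta> / 2 * (e / 3))"
    using l1 l2 c by (auto intro!: order_tendstoD(2))
  then show ?thesis
  proof eventually_elim
    case (elim n)
    have pt: "\<bar>\<phi>1 n x - \<phi>2 n x\<bar> \<le> \<delta> + (2 / \<delta> * (\<phi>1 n x - g x)\<^sup>2 + 2 / \<delta> * (\<phi>2 n x - g x)\<^sup>2)" for x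
    proof -
      define p q where "p = \<phi>1 n x - g x" and "q = \<phi>2 n x - g x"
      have "\<bar>p - q\<bar> * \<delta> \<le> \<delta> * \<delta> + (p - q)\<^sup>2"
      proof (cases "\<bar>p - q\<bar> \<le> \<delta>")
        case True
        then show ?thesis using \<delta> by (intro order_trans[OF mult_right_mono[OF True]]) auto
      next
        case False
        then have "\<bar>p - q\<bar> * \<delta> \<le> \<bar>p - q\<bar> * \<bar>p - q\<bar>" by (intro mult_left_mono) auto
        then have "\<bar>p - q\<bar> * \<delta> \<le> (p - q)\<^sup>2" by (simp add: power2_eq_square)
        moreover have "0 \<le> \<delta> * \<delta>" by simp
        ultimately show ?thesis by linarith
      qed
      also have "(p - q)\<^sup>2 \<le> 2 * p\<^sup>2 + 2 * q\<^sup>2"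
        using zero_le_power2[of "p + q"] by (simp add: power2_sum power2_diff)
      finally have "\<bar>p - q\<bar> * \<delta> / \<delta> \<le> (\<delta> * \<delta> + (2 * p\<^sup>2 + 2 * q\<^sup>2)) / \<delta>"
        using \<delta> by (intro divide_right_mono) auto
      then show ?thesis using \<delta> by (simp add: p_def q_def add_divide_distrib)
    qed
    have k: "0 \<le> 2 / \<delta>" using \<delta> by simp
    have "(\<integral>\<^sup>+x. ennreal \<bar>\<phi>1 n x - \<phi>2 n x\<bar> \<partial>?B)
      \<le> (\<integral>\<^sup>+x. ennreal \<delta> + (ennreal (2 / \<delta>) * ennreal ((\<phi>1 n x - g x)\<^sup>2) + ennreal (2 / \<delta>) * ennreal ((\<phi>2 n x - g x)\<^sup>2)) \<partial>?B)"
      using pt k \<delta> by (intro nn_integral_mono) (simp flip: ennreal_mult ennreal_plus add: ennreal_leI)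
    also have "\<dots> = ennreal \<delta> * ennreal h + (ennreal (2 / \<delta>) * (\<integral>\<^sup>+x. ennreal ((\<phi>1 n x - g x)\<^sup>2) \<partial>?B)
        + ennreal (2 / \<delta>) * (\<integral>\<^sup>+x. ennreal ((\<phi>2 n x - g x)\<^sup>2) \<partial>?B))"
      using h by (simp add: nn_integral_add nn_integral_cmult)
    also have "\<dots> \<le> ennreal (e / 3) + (ennreal (2 / \<delta>) * ennreal (\<delta> / 2 * (e / 3)) + ennreal (2 / \<delta>) * ennreal (\<delta> / 2 * (e / 3)))"
      using elim \<delta> h by (intro add_mono mult_left_mono) (auto simp flip: ennreal_mult intro!: ennreal_leI)
    also have "\<dots> = ennreal (e / 3) + (ennreal (e / 3) + ennreal (e / 3))"
    proof -
      have "ennreal (2 / \<delta>) * ennreal (\<delta> / 2 * (e / 3)) = ennreal (2 / \<delta> * (\<delta> / 2 * (e / 3)))"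
        using \<delta> e by (intro ennreal_mult[symmetric]) auto
      also have "2 / \<delta> * (\<delta> / 2 * (e / 3)) = e / 3" using \<delta> by simp
      finally show ?thesis by simp
    qed
    also have "\<dots> = ennreal e" using e by (simp flip: ennreal_plus)
    finally show ?case .
  qed
qed

text \<open>For smooth \<open>r\<close> the sum of the two integrals in question is the integral of \<open>\<partial>\<^sub>b (r \<psi>)\<close> over \<open>\<Omega>\<close>. Apply this
  to the difference \<open>r\<close> of approximations of the two functions: the left-hand side converges by \<open>L2\<close>
  convergence in \<open>\<Omega>\<close>, and the right-hand side tends to zero by \<open>boundary_integral_bound\<close>.\<close>
lemma same_trace_zero_extension:
  fixes \<Omega> :: "'a::euclidean_space set"
  assumes \<Omega>: "open \<Omega>" "bounded \<Omega>"
    and fin: "hausdorff_outer (DIM('a) - 1) (frontier \<Omega>) < top"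
    and t1: "has_trace \<Omega> w1 g" and t2: "has_trace \<Omega> w2 g"
  shows "zero_extension_gradient \<Omega> (\<lambda>x. w1 x - w2 x) (\<lambda>x. weak_gradient \<Omega> w1 x - weak_gradient \<Omega> w2 x)"
proof -
  let ?M = "lebesgue_on \<Omega>" and ?B = "boundary_measure \<Omega>" and ?T = "tube_constant TYPE('a)"
  interpret B: finite_measure ?B by (rule finite_boundary_measure[OF fin])
  have w: "w1 \<in> H1 \<Omega>" "w2 \<in> H1 \<Omega>" using t1 t2 by (auto simp: has_trace_def)
  then have wL: "w1 \<in> L2 ?M" "w2 \<in> L2 ?M" by (auto simp: H1_def)
  note GL = weak_gradient_props(2)[OF \<Omega>(1) w(1)] weak_gradient_props(2)[OF \<Omega>(1) w(2)]
  have g: "g \<in> borel_measurable ?B" using t1 by (auto simp: has_trace_def L2_def)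
  obtain p where p: "\<forall>n. smooth (p n)" "(\<lambda>n. H1_norm \<Omega> (\<lambda>x. p n x - w1 x)) \<longlonglongrightarrow> 0"
      "(\<lambda>n. \<integral>\<^sup>+x. ennreal ((p n x - g x)\<^sup>2) \<partial>?B) \<longlonglongrightarrow> 0"
    using t1 unfolding has_trace_def by blast
  obtain q where q: "\<forall>n. smooth (q n)" "(\<lambda>n. H1_norm \<Omega> (\<lambda>x. q n x - w2 x)) \<longlonglongrightarrow> 0"
      "(\<lambda>n. \<integral>\<^sup>+x. ennreal ((q n x - g x)\<^sup>2) \<partial>?B) \<longlonglongrightarrow> 0"
    using t2 unfolding has_trace_def by blast
  have ps: "smooth (p n)" and qs: "smooth (q n)" for n using p q by auto
  have green: "(\<integral>x. (w1 x - w2 x) * (gradient \<psi> x \<bullet> b) \<partial>?M)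
      = - (\<integral>x. ((weak_gradient \<Omega> w1 x - weak_gradient \<Omega> w2 x) \<bullet> b) * \<psi> x \<partial>?M)"
    if \<psi>: "\<psi> \<in> test_functions UNIV" and b: "b \<in> Basis" for \<psi> b
  proof -
    have \<psi>s: "smooth \<psi>" using \<psi> by (rule test_functions_smooth)
    have cL: "f \<in> L2 ?M" if "continuous_on UNIV f" for f :: "'a \<Rightarrow> real"
      using that \<Omega> by (rule L2_continuous_bounded)
    have \<psi>L: "\<psi> \<in> L2 ?M" "(\<lambda>x. gradient \<psi> x \<bullet> b) \<in> L2 ?M"
      by (intro cL smooth_continuous \<psi>s smooth_gradient_inner b)+
    have lim: "(\<lambda>n. (\<integral>x. r n x * (gradient \<psi> x \<bullet> b) \<partial>?M) + (\<integral>x. (gradient (r n) x \<bullet> b) * \<psi> x \<partial>?M))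
        \<longlonglongrightarrow> (\<integral>x. w x * (gradient \<psi> x \<bullet> b) \<partial>?M) + (\<integral>x. (weak_gradient \<Omega> w x \<bullet> b) * \<psi> x \<partial>?M)"
      if r: "\<And>n. smooth (r n)" "(\<lambda>n. H1_norm \<Omega> (\<lambda>x. r n x - w x)) \<longlonglongrightarrow> 0" and w: "w \<in> H1 \<Omega>" for r w
    proof (intro tendsto_add L2_pairing_tendsto \<psi>L H1_norm_tendsto[OF \<Omega> w r] b)
      show "w \<in> L2 ?M" using w by (simp add: H1_def)
      show "(\<lambda>x. weak_gradient \<Omega> w x \<bullet> b) \<in> L2 ?M"
        by (rule L2_component[OF weak_gradient_props(2)[OF \<Omega>(1) w]])
    qed (intro cL smooth_continuous smooth_gradient_inner r b)+
    let ?E = "\<lambda>r. (\<integral>x. r x * (gradient \<psi> x \<bullet> b) \<partial>?M) + (\<integral>x. (gradient r x \<bullet> b) * \<psi> x \<partial>?M)"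
    have E: "?E r = (\<integral>x. gradient (\<lambda>x. r x * \<psi> x) x \<bullet> b \<partial>?M)" if r: "smooth r" for r
    proof -
      have i: "integrable ?M (\<lambda>x. r x * (gradient \<psi> x \<bullet> b))" "integrable ?M (\<lambda>x. (gradient r x \<bullet> b) * \<psi> x)"
        by (intro L2_integrable_mult \<psi>L cL smooth_continuous smooth_gradient_inner r b)+
      have "gradient (\<lambda>x. r x * \<psi> x) x \<bullet> b = r x * (gradient \<psi> x \<bullet> b) + (gradient r x \<bullet> b) * \<psi> x" for x
        by (simp add: gradient_mult[OF r \<psi>s] inner_add_left)
      then show ?thesis using i by simp
    qed
    obtain C where "0 < C \<and> (\<forall>x. \<bar>\<psi> x\<bar> \<le> C \<and> norm (gradient \<psi> x) \<le> C)"
      using test_function_bounded[OF \<psi>] ..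
    then have C: "0 < C" "\<And>x. \<bar>\<psi> x\<bar> \<le> C" by auto
    have T: "0 < ?T" by (rule tube_constant_pos)
    have "(\<lambda>n. ?E (p n) - ?E (q n)) \<longlonglongrightarrow> 0"
    proof (rule LIMSEQ_I)
      fix e :: real assume e: "0 < e"
      define \<epsilon> where "\<epsilon> = e / (2 * ?T * C)"
      have \<epsilon>: "0 < \<epsilon>" "?T * (C * \<epsilon>) < e" using e C T by (auto simp: \<epsilon>_def)
      have "\<forall>\<^sub>F n in sequentially. (\<integral>\<^sup>+x. ennreal \<bar>p n x - q n x\<bar> \<partial>?B) \<le> ennreal \<epsilon>"
        by (intro same_trace_boundary_L1[OF fin g _ _ p(3) q(3) \<epsilon>(1)] smooth_continuous ps qs)
      then obtain N where N: "\<And>n. n \<ge> N \<Longrightarrow> (\<integral>\<^sup>+x. ennreal \<bar>p n x - q n x\<bar> \<partial>?B) \<le> ennreal \<epsilon>"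
        by (auto simp: eventually_sequentially)
      show "\<exists>N. \<forall>n\<ge>N. norm (?E (p n) - ?E (q n) - 0) < e"
      proof (intro exI allI impI)
        fix n assume n: "n \<ge> N"
        have pq: "smooth (\<lambda>x. p n x - q n x)" by (intro smooth_minus ps qs)
        have t: "(\<lambda>x. (p n x - q n x) * \<psi> x) \<in> test_functions UNIV"
          by (rule test_functions_mult[OF \<psi> pq])
        have L: "integrable ?M (\<lambda>x. p n x * (gradient \<psi> x \<bullet> b))" "integrable ?M (\<lambda>x. (gradient (p n) x \<bullet> b) * \<psi> x)"
            "integrable ?M (\<lambda>x. q n x * (gradient \<psi> x \<bullet> b))" "integrable ?M (\<lambda>x. (gradient (q n) x \<bullet> b) * \<psi> x)"
          by (intro L2_integrable_mult \<psi>L cL smooth_continuous smooth_gradient_inner ps qs b)+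
        have "?E (p n) - ?E (q n) = ?E (\<lambda>x. p n x - q n x)"
          using L by (simp add: gradient_diff[OF ps qs] left_diff_distrib inner_diff_left)
        also have "\<dots> = (\<integral>x. gradient (\<lambda>x. (p n x - q n x) * \<psi> x) x \<bullet> b \<partial>?M)"
          by (rule E[OF pq])
        also have "\<bar>\<dots>\<bar> \<le> ?T * (\<integral>y. \<bar>(p n y - q n y) * \<psi> y\<bar> \<partial>?B)"
          by (rule boundary_integral_bound[OF \<Omega>(1) fin t b])
        also have "\<dots> \<le> ?T * (C * \<epsilon>)"
        proof (rule mult_left_mono)
          have [measurable]: "p n \<in> borel_measurable ?B" "q n \<in> borel_measurable ?B" "\<psi> \<in> borel_measurable ?B"
            by (intro borel_measurable_boundary borel_measurable_continuous_onI smooth_continuous ps qs \<psi>s)+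
          have i: "integrable ?B (\<lambda>y. \<bar>p n y - q n y\<bar>)"
            using N[OF n] by (intro integrableI_bounded) (auto simp: less_top[symmetric] top_unique)
          have "(\<integral>y. \<bar>(p n y - q n y) * \<psi> y\<bar> \<partial>?B) \<le> (\<integral>y. C * \<bar>p n y - q n y\<bar> \<partial>?B)"
          proof (rule integral_mono_AE')
            show "AE y in ?B. \<bar>(p n y - q n y) * \<psi> y\<bar> \<le> C * \<bar>p n y - q n y\<bar>"
              using C by (intro AE_I2) (simp add: abs_mult mult.commute mult_right_mono)
          qed (use i C in auto)
          also have "\<dots> = C * (\<integral>y. \<bar>p n y - q n y\<bar> \<partial>?B)" by simp
          also have "(\<integral>y. \<bar>p n y - q n y\<bar> \<partial>?B) \<le> \<epsilon>"
            using N[OF n] \<epsilon> i by (simp add: nn_integral_eq_integral)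
          finally show "(\<integral>y. \<bar>(p n y - q n y) * \<psi> y\<bar> \<partial>?B) \<le> C * \<epsilon>" using C by simp
        qed (use T in simp)
        also have "\<dots> < e" by (rule \<epsilon>(2))
        finally show "norm (?E (p n) - ?E (q n) - 0) < e" by simp
      qed
    qed
    moreover have "(\<lambda>n. ?E (p n) - ?E (q n)) \<longlonglongrightarrow>
      ((\<integral>x. w1 x * (gradient \<psi> x \<bullet> b) \<partial>?M) + (\<integral>x. (weak_gradient \<Omega> w1 x \<bullet> b) * \<psi> x \<partial>?M)) -
      ((\<integral>x. w2 x * (gradient \<psi> x \<bullet> b) \<partial>?M) + (\<integral>x. (weak_gradient \<Omega> w2 x \<bullet> b) * \<psi> x \<partial>?M))"
      by (intro tendsto_diff lim ps qs p(2) q(2) w)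
    ultimately have "((\<integral>x. w1 x * (gradient \<psi> x \<bullet> b) \<partial>?M) + (\<integral>x. (weak_gradient \<Omega> w1 x \<bullet> b) * \<psi> x \<partial>?M)) -
      ((\<integral>x. w2 x * (gradient \<psi> x \<bullet> b) \<partial>?M) + (\<integral>x. (weak_gradient \<Omega> w2 x \<bullet> b) * \<psi> x \<partial>?M)) = 0"
      by (blast intro: LIMSEQ_unique)
    moreover have "integrable ?M (\<lambda>x. w1 x * (gradient \<psi> x \<bullet> b))" "integrable ?M (\<lambda>x. w2 x * (gradient \<psi> x \<bullet> b))"
       "integrable ?M (\<lambda>x. (weak_gradient \<Omega> w1 x \<bullet> b) * \<psi> x)" "integrable ?M (\<lambda>x. (weak_gradient \<Omega> w2 x \<bullet> b) * \<psi> x)"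
      by (intro L2_integrable_mult \<psi>L wL L2_component GL)+
    ultimately show ?thesis
      by (simp add: left_diff_distrib inner_diff_left)
  qed
  show ?thesis
    unfolding zero_extension_gradient_def
    by (intro conjI ballI green L2_diff wL GL)
qed

section \<open>Green's formula for functions with vanishing trace\<close>

text \<open>At an interior point the trivial direction \<open>e = 0\<close> works. At a boundary point, moving down by \<open>t\<close> and
  then anywhere by at most \<open>t k\<close> keeps a point below the graph as soon as \<open>k (L + 1) \<le> 1\<close>.\<close>
lemma inward_cone:
  fixes \<Omega> :: "'a::euclidean_space set"
  assumes \<Omega>: "open \<Omega>" and lb: "lipschitz_boundary \<Omega>" and x0: "x0 \<in> closure \<Omega>"
  shows "\<exists>\<rho>>0. \<exists>e. \<exists>k>0. \<exists>t0>0. \<forall>t. 0 < t \<and> t < t0 \<longrightarrow> (\<forall>y\<in>\<Omega> \<inter> ball x0 \<rho>. cball (y - t *\<^sub>R e) (t * k) \<subseteq> \<Omega>)"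
proof (cases "x0 \<in> \<Omega>")
  case True
  then obtain r where r: "0 < r" "ball x0 r \<subseteq> \<Omega>" using \<Omega> openE by blast
  have "cball (y - t *\<^sub>R 0) (t * 1) \<subseteq> \<Omega>" if "0 < t \<and> t < r / 2" "y \<in> \<Omega> \<inter> ball x0 (r / 2)" for t y
  proof
    fix z assume "z \<in> cball (y - t *\<^sub>R 0) (t * 1)"
    then have "dist x0 z < r" using that dist_triangle[of x0 z y] by simp
    then show "z \<in> \<Omega>" using r by auto
  qed
  then show ?thesis
    using r by (intro exI[of _ "r / 2"] exI[of _ 0] exI[of _ 1] conjI) auto
next
  case False
  then have "x0 \<in> frontier \<Omega>" using x0 \<Omega> by (simp add: frontier_def interior_open)
  then obtain r e \<gamma> L where r: "0 < r" and e: "norm e = 1" and lip: "lipschitz_on L {y. e \<bullet> y = 0} \<gamma>"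
    and graph: "\<Omega> \<inter> ball x0 r = {y \<in> ball x0 r. e \<bullet> y < \<gamma> (y - (e \<bullet> y) *\<^sub>R e)}"
    using lb unfolding lipschitz_boundary_def by blast
  have L: "0 \<le> L" by (rule lipschitz_on_nonneg[OF lip])
  have ee: "e \<bullet> e = 1" using e by (simp add: norm_eq_1)
  define k where "k = 1 / (2 * (L + 1))"
  have k: "0 < k" "k \<le> 1 / 2" "k * (L + 1) \<le> 1" using L by (auto simp: k_def field_simps)
  let ?\<pi> = "\<lambda>y. y - (e \<bullet> y) *\<^sub>R e"
  have "cball (y - t *\<^sub>R e) (t * k) \<subseteq> \<Omega>" if t: "0 < t" "t < r / 4" and y: "y \<in> \<Omega> \<inter> ball x0 (r / 2)" for t y
  proof
    fix z assume z: "z \<in> cball (y - t *\<^sub>R e) (t * k)"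
    define v where "v = z - (y - t *\<^sub>R e)"
    have v: "norm v \<le> t * k" using z by (simp add: v_def dist_norm norm_minus_commute)
    have zv: "z = y - t *\<^sub>R e + v" by (simp add: v_def)
    have tk: "t * k \<le> t * (1 / 2)" using k t by (intro mult_left_mono) auto
    have yr: "y \<in> \<Omega> \<inter> ball x0 r" using y r by auto
    have "dist y z \<le> norm (t *\<^sub>R e) + norm v"
      unfolding zv dist_norm using norm_triangle_ineq4[of "t *\<^sub>R e" v] by simp
    also have "\<dots> \<le> t + t * k" using v t e by simp
    finally have "dist y z \<le> t + t * k" .
    moreover have "dist x0 y < r / 2" using y by simp
    ultimately have "dist x0 z < r" using dist_triangle[of x0 z y] t tk by linarith
    then have zr: "z \<in> ball x0 r" by simp
    have "norm (?\<pi> v) \<le> norm v" by (rule norm_orthogonal_part_le[OF e])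
    then have pv: "norm (?\<pi> v) \<le> t * k" using v by simp
    have pz: "?\<pi> z - ?\<pi> y = ?\<pi> v"
      unfolding zv using ee by (simp add: inner_add_right inner_diff_right algebra_simps)
    have "dist (\<gamma> (?\<pi> z)) (\<gamma> (?\<pi> y)) \<le> L * dist (?\<pi> z) (?\<pi> y)"
      by (rule lipschitz_onD[OF lip]) (auto simp: inner_diff_right ee)
    also have "\<dots> \<le> L * (t * k)"
      using pv L unfolding dist_norm pz by (intro mult_left_mono)
    finally have g: "\<gamma> (?\<pi> y) - L * (t * k) \<le> \<gamma> (?\<pi> z)" by (simp add: dist_real_def)
    have "e \<bullet> y < \<gamma> (?\<pi> y)" using yr unfolding graph by simp
    moreover have "e \<bullet> z = e \<bullet> y - t + e \<bullet> v" unfolding zv using ee by (simp add: inner_add_right inner_diff_right)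
    moreover have "e \<bullet> v \<le> t * k" using Cauchy_Schwarz_ineq2[of e v] e v by simp
    moreover have "t * (k * (L + 1)) \<le> t * 1" using k t by (intro mult_left_mono) auto
    ultimately have "e \<bullet> z < \<gamma> (?\<pi> z)" using g by (simp add: algebra_simps)
    then have "z \<in> \<Omega> \<inter> ball x0 r" unfolding graph using zr by simp
    then show "z \<in> \<Omega>" by simp
  qed
  then show ?thesis
    using r k by (intro exI[of _ "r / 2"] exI[of _ e] exI[of _ k] exI[of _ "r / 4"] conjI) auto
qed

lemma integral_representative:
  fixes f f' k :: "'a::euclidean_space \<Rightarrow> real"
  assumes S: "S \<in> sets borel" and f: "f \<in> borel_measurable (lebesgue_on S)"
    and f': "f' \<in> borel_measurable borel" "\<And>x. x \<notin> S \<Longrightarrow> f' x = 0" "AE x in lebesgue_on S. f x = f' x"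
    and k: "k \<in> borel_measurable borel"
  shows "(\<integral>x. f x * k x \<partial>lebesgue_on S) = (\<integral>x. f' x * k x \<partial>lborel)"
proof -
  have "(\<integral>x. f x * k x \<partial>lebesgue_on S) = (\<integral>x. f' x * k x \<partial>lebesgue_on S)"
  proof (rule integral_cong_AE)
    show "(\<lambda>x. f x * k x) \<in> borel_measurable (lebesgue_on S)"
      by (intro borel_measurable_times f borel_imp_lebesgue_on k)
    show "(\<lambda>x. f' x * k x) \<in> borel_measurable (lebesgue_on S)"
      by (intro borel_measurable_times borel_imp_lebesgue_on f' k)
    show "AE x in lebesgue_on S. f x * k x = f' x * k x"
      using f'(3) by eventually_elim simp
  qed
  also have "\<dots> = (\<integral>x. f' x * k x \<partial>lborel)"
    using f' k by (intro integrable_lebesgue_on_borel(2)[OF S]) auto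
  finally show ?thesis .
qed

lemma L2_representative:
  fixes f :: "'a::euclidean_space \<Rightarrow> real"
  assumes f: "f \<in> L2 (lebesgue_on S)" and S: "S \<in> sets borel" "bounded S"
  shows "\<exists>f'. f' \<in> borel_measurable borel \<and> (\<forall>x. x \<notin> S \<longrightarrow> f' x = 0) \<and> (AE x in lebesgue_on S. f x = f' x)
    \<and> integrable lborel f' \<and> integrable lborel (\<lambda>x. (f' x)\<^sup>2)"
proof -
  obtain f' where f': "f' \<in> borel_measurable borel" "\<And>x. x \<notin> S \<Longrightarrow> f' x = 0" "AE x in lebesgue_on S. f x = f' x"
    using borel_representative[OF L2_measurable[OF f] S(1)] by blast
  have m: "f' \<in> borel_measurable (lebesgue_on S)" using f'(1) by (rule borel_imp_lebesgue_on)
  have L: "f' \<in> L2 (lebesgue_on S)" by (rule L2_cong_AE[OF f m f'(3)])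
  have "integrable (lebesgue_on S) f'"
    using L finite_measure_lebesgue_on_bounded[OF S(2)] S(1) by (intro L2_integrable) auto
  then have "integrable lborel f'"
    using integrable_lebesgue_on_borel(1)[OF S(1) f'(1,2)] by simp
  moreover have "integrable lborel (\<lambda>x. (f' x)\<^sup>2)"
  proof -
    have "integrable (lebesgue_on S) (\<lambda>x. (f' x)\<^sup>2)" using L by (simp add: L2_def)
    then show ?thesis using integrable_lebesgue_on_borel(1)[OF S(1), of "\<lambda>x. (f' x)\<^sup>2"] f'(1,2) by simp
  qed
  ultimately show ?thesis using f' by blast
qed

lemma eventually_at_right_0I:
  fixes P :: "'a::real_normed_vector \<Rightarrow> bool"
  assumes "\<exists>d>0. \<forall>z. norm z < d \<longrightarrow> P z"
  shows "\<forall>\<^sub>F d in at_right (0::real). \<forall>z. norm z < d \<longrightarrow> P z"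
proof -
  obtain d where "0 < d" "\<forall>z. norm z < d \<longrightarrow> P z" using assms by blast
  then show ?thesis
    unfolding eventually_at_right_field by (intro exI[of _ d]) auto
qed

text \<open>The double integral described at the top, with a kernel supported in the ball of radius \<open>t k\<close> around
  \<open>t e\<close>. For \<open>y\<close> outside the ball of radius \<open>\<rho>\<close> the factor \<open>w(y)\<close> vanishes; inside it the
  cone condition places the support of \<open>\<eta> (y - \<cdot>)\<close> in \<open>\<Omega>\<close>.\<close>
lemma local_zero_extension_pairing:
  fixes \<Omega> :: "'a::euclidean_space set"
  assumes \<Omega>: "open \<Omega>" "bounded \<Omega>"
    and q: "q \<in> L2 (lebesgue_on \<Omega>)" and D: "D \<in> L2 (lebesgue_on \<Omega>)" and div: "has_weak_divergence \<Omega> q D"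
    and z: "zero_extension_gradient \<Omega> w G" and supp: "\<And>y. y \<notin> ball x0 \<rho> \<Longrightarrow> w y = 0"
    and k: "0 < k" and t0: "0 < t0"
    and cone: "\<And>t y. 0 < t \<Longrightarrow> t < t0 \<Longrightarrow> y \<in> \<Omega> \<inter> ball x0 \<rho> \<Longrightarrow> cball (y - t *\<^sub>R e) (t * k) \<subseteq> \<Omega>"
  shows "(\<integral>x. q x \<bullet> G x \<partial>lebesgue_on \<Omega>) + (\<integral>x. D x * w x \<partial>lebesgue_on \<Omega>) = 0"
proof -
  let ?M = "lebesgue_on \<Omega>"
  have [measurable]: "\<Omega> \<in> sets borel" using \<Omega> by simp
  have w: "w \<in> L2 ?M" and G: "G \<in> L2 ?M"
    and zero_ext: "\<And>\<psi> b. \<psi> \<in> test_functions UNIV \<Longrightarrow> b \<in> Basis \<Longrightarrow>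
      (\<integral>x. w x * (gradient \<psi> x \<bullet> b) \<partial>?M) = - (\<integral>x. (G x \<bullet> b) * \<psi> x \<partial>?M)"
    using z by (auto simp: zero_extension_gradient_def)
  define rep where "rep f f' \<longleftrightarrow> f' \<in> borel_measurable borel \<and> (\<forall>x. x \<notin> \<Omega> \<longrightarrow> f' x = 0) \<and> (AE x in ?M. f x = f' x)
    \<and> integrable lborel f' \<and> integrable lborel (\<lambda>x. (f' x)\<^sup>2)" for f f' :: "'a \<Rightarrow> real"
  have ex: "\<exists>f'. rep f f'" if "f \<in> L2 ?M" for f
    unfolding rep_def using that \<Omega> by (intro L2_representative) auto
  have "\<forall>b. \<exists>f'. rep (\<lambda>x. q x \<bullet> b) f'" "\<forall>b. \<exists>f'. rep (\<lambda>x. G x \<bullet> b) f'"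
    using ex L2_component[OF q] L2_component[OF G] by auto
  then obtain Q H where Q: "\<And>b. rep (\<lambda>x. q x \<bullet> b) (Q b)" and H: "\<And>b. rep (\<lambda>x. G x \<bullet> b) (H b)"
    by metis
  obtain E where E: "rep D E" using ex[OF D] by blast
  obtain w0 where w0: "rep w w0" using ex[OF w] by blast
  define W where "W x = indicator (ball x0 \<rho>) x * w0 x" for x
  have W: "rep w W"
  proof -
    have [measurable]: "w0 \<in> borel_measurable borel" using w0 by (simp add: rep_def)
    have "W \<in> borel_measurable borel"
      unfolding W_def by (intro borel_measurable_times borel_measurable_indicator) auto
    moreover have "\<forall>x. x \<notin> \<Omega> \<longrightarrow> W x = 0" using w0 by (simp add: rep_def W_def)
    moreover have "AE x in ?M. w x = W x"
    proof -
      have "AE x in ?M. w x = w0 x" using w0 by (simp add: rep_def)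
      then show ?thesis by eventually_elim (use supp in \<open>auto simp: W_def indicator_def\<close>)
    qed
    moreover have "integrable lborel W"
      unfolding W_def using w0 integrable_mult_indicator[of "ball x0 \<rho>" lborel w0] by (simp add: rep_def)
    moreover have "integrable lborel (\<lambda>x. (W x)\<^sup>2)"
    proof -
      have "integrable lborel (\<lambda>x. indicator (ball x0 \<rho>) x *\<^sub>R (w0 x)\<^sup>2)"
        using w0 by (intro integrable_mult_indicator) (auto simp: rep_def)
      also have "(\<lambda>x. indicator (ball x0 \<rho>) x *\<^sub>R (w0 x)\<^sup>2) = (\<lambda>x. (W x)\<^sup>2)"
        by (auto simp: W_def indicator_def)
      finally show ?thesis .
    qed
    ultimately show ?thesis unfolding rep_def by blast
  qed
  have Wsupp: "W y = 0" if "y \<notin> \<Omega> \<inter> ball x0 \<rho>" for y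
    using that W by (auto simp: rep_def W_def)
  have repm: "f' \<in> borel_measurable borel" if "rep f f'" for f f' using that by (simp add: rep_def)
  have repi: "integrable lborel f'" "integrable lborel (\<lambda>x. (f' x)\<^sup>2)" if "rep f f'" for f f'
    using that by (simp_all add: rep_def)
  have repI: "(\<integral>x. f x * h x \<partial>?M) = (\<integral>x. f' x * h x \<partial>lborel)"
    if "rep f f'" "f \<in> L2 ?M" "h \<in> borel_measurable borel" for f f' h
    using that(1) by (intro integral_representative[OF _ L2_measurable[OF that(2)] _ _ _ that(3)]) (auto simp: rep_def)
  have repP: "(\<integral>x. f x * h x \<partial>?M) = (\<integral>x. f' x * h' x \<partial>lborel)" "integrable lborel (\<lambda>x. f' x * h' x)"
    if f: "rep f f'" "f \<in> L2 ?M" and h: "rep h h'" "h \<in> L2 ?M" for f f' h h'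
  proof -
    have m: "f' \<in> borel_measurable ?M" "h' \<in> borel_measurable ?M"
      using f h by (auto simp: rep_def intro: borel_imp_lebesgue_on)
    have ae: "AE x in ?M. f x = f' x" "AE x in ?M. h x = h' x" using f h by (auto simp: rep_def)
    have "(\<integral>x. f x * h x \<partial>?M) = (\<integral>x. f x * h' x \<partial>?M)"
    proof (rule integral_cong_AE)
      show "(\<lambda>x. f x * h x) \<in> borel_measurable ?M" "(\<lambda>x. f x * h' x) \<in> borel_measurable ?M"
        by (intro borel_measurable_times L2_measurable[OF f(2)] L2_measurable[OF h(2)] m(2))+
      show "AE x in ?M. f x * h x = f x * h' x" using ae(2) by eventually_elim simp
    qed
    also have "\<dots> = (\<integral>x. f' x * h' x \<partial>lborel)" by (rule repI[OF f repm[OF h(1)]])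
    finally show "(\<integral>x. f x * h x \<partial>?M) = (\<integral>x. f' x * h' x \<partial>lborel)" .
    have "integrable ?M (\<lambda>x. f' x * h' x)"
      by (intro L2_integrable_mult L2_cong_AE[OF f(2) m(1) ae(1)] L2_cong_AE[OF h(2) m(2) ae(2)])
    then show "integrable lborel (\<lambda>x. f' x * h' x)"
      using integrable_lebesgue_on_borel(1)[of \<Omega> "\<lambda>x. f' x * h' x"] f h repm[OF f(1)] repm[OF h(1)]
      by (auto simp: rep_def)
  qed
  let ?T = "(\<Sum>b\<in>Basis. \<integral>x. Q b x * H b x \<partial>lborel) + (\<integral>x. E x * W x \<partial>lborel)"
  have T: "(\<integral>x. q x \<bullet> G x \<partial>?M) + (\<integral>x. D x * w x \<partial>?M) = ?T"
  proof -
    have "(\<integral>x. q x \<bullet> G x \<partial>?M) = (\<integral>x. (\<Sum>b\<in>Basis. (q x \<bullet> b) * (G x \<bullet> b)) \<partial>?M)"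
      by (simp add: euclidean_inner[symmetric])
    also have "\<dots> = (\<Sum>b\<in>Basis. \<integral>x. (q x \<bullet> b) * (G x \<bullet> b) \<partial>?M)"
      by (intro Bochner_Integration.integral_sum L2_integrable_mult L2_component q G)
    also have "\<dots> = (\<Sum>b\<in>Basis. \<integral>x. Q b x * H b x \<partial>lborel)"
      by (intro sum.cong refl repP(1)[OF Q _ H] L2_component q G)
    finally show ?thesis using repP(1)[OF E D W w] by simp
  qed
  have "\<bar>?T\<bar> \<le> (real DIM('a) + 1) * \<epsilon>" if \<epsilon>: "0 < \<epsilon>" for \<epsilon>
  proof -
    let ?small = "\<lambda>f g d. \<forall>z. norm z < d \<longrightarrow> (\<integral>\<^sup>+x. ennreal (\<bar>f x\<bar> * \<bar>g (x + z) - g x\<bar>) \<partial>lborel) \<le> ennreal \<epsilon>"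
    have sm: "\<forall>\<^sub>F d in at_right 0. ?small f' g' d" if "rep f f'" "rep g g'" for f f' g g'
      by (intro eventually_at_right_0I translation_pairing_square_integrable[OF repm[OF that(1)] repi(2)[OF that(1)] repi[OF that(2)] \<epsilon>])
    have "\<forall>\<^sub>F d in at_right 0. (\<forall>b\<in>Basis. ?small (Q b) (H b) d) \<and> ?small E W d \<and> 0 < d"
      by (intro eventually_conj eventually_ball_finite ballI finite_Basis sm[OF Q H] sm[OF E W] eventually_at_right_less)
    then obtain d where d: "\<And>b. b \<in> Basis \<Longrightarrow> ?small (Q b) (H b) d" "?small E W d" "0 < d"
      using eventually_happens'[OF trivial_limit_at_right_real] by blast
    \<comment> \<open>the kernel is supported in the ball of radius \<open>t (norm e + k) \<le> d\<close> around the origin\<close>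
    define t where "t = min (t0 / 2) (d / (norm e + k))"
    have ek: "0 < norm e + k" using k by (simp add: add_nonneg_pos)
    have t: "0 < t" "t < t0" using t0 d(3) ek by (auto simp: t_def)
    have td: "t * (norm e + k) \<le> d"
    proof -
      have "t * (norm e + k) \<le> d / (norm e + k) * (norm e + k)"
        using ek by (intro mult_right_mono) (auto simp: t_def)
      then show ?thesis using ek by simp
    qed
    obtain \<eta> where \<eta>: "smooth \<eta>" "\<And>x. 0 \<le> \<eta> x" "\<And>x. x \<notin> ball (t *\<^sub>R e) (t * k) \<Longrightarrow> \<eta> x = 0"
        "integrable lborel \<eta>" "integral\<^sup>L lborel \<eta> = 1"
      using exists_mollifier[of "t * k" "t *\<^sub>R e"] t k by auto
    have \<eta>t: "\<eta> \<in> test_functions UNIV"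
      using \<eta>(3) by (intro test_functionsI[OF \<eta>(1), of "cball (t *\<^sub>R e) (t * k)"]) auto
    obtain C where "0 < C \<and> (\<forall>x. \<bar>\<eta> x\<bar> \<le> C \<and> norm (gradient \<eta> x) \<le> C)"
      using test_function_bounded[OF \<eta>t] ..
    then have C: "\<bar>\<eta> x\<bar> \<le> C" "norm (gradient \<eta> x) \<le> C" for x by auto
    have dC: "\<bar>gradient \<eta> x \<bullet> b\<bar> \<le> C" if "b \<in> Basis" for b x
      using Basis_le_norm[OF that, of "gradient \<eta> x"] C(2)[of x] by linarith
    have far: "\<eta> z = 0" if "d \<le> norm z" for z
    proof (rule \<eta>(3))
      have "norm z \<le> norm (t *\<^sub>R e) + norm (z - t *\<^sub>R e)" by (rule norm_triangle_sub)
      then show "z \<notin> ball (t *\<^sub>R e) (t * k)"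
        using that td t by (simp add: dist_norm norm_minus_commute distrib_left)
    qed
    have \<eta>m [measurable]: "\<eta> \<in> borel_measurable borel"
      by (intro borel_measurable_continuous_onI smooth_continuous \<eta>)
    have d\<eta>m [measurable]: "(\<lambda>x. gradient \<eta> x \<bullet> b) \<in> borel_measurable borel" if "b \<in> Basis" for b
      by (intro borel_measurable_continuous_onI smooth_continuous smooth_gradient_inner \<eta> that)
    let ?I = "\<lambda>\<eta> f g. \<integral>x. (\<integral>y. \<eta> (y - x) * (f x * g y) \<partial>lborel) \<partial>lborel"
    have err: "\<bar>?I \<eta> f' g' - (\<integral>x. f' x * g' x \<partial>lborel)\<bar> \<le> \<epsilon>"
      if f: "rep f f'" "f \<in> L2 ?M" and g: "rep g g'" "g \<in> L2 ?M" and s: "?small f' g' d" for f f' g g'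
      using s \<epsilon> far
      by (intro mollified_pairing_error[OF repi(1)[OF f(1)] repi(1)[OF g(1)] repP(2)[OF f g] \<eta>(4,2,5) C(1), of d]) auto
    have grad1: "gradient (\<lambda>y. \<eta> (y - x)) y = gradient \<eta> (y - x)" for x y
      using gradient_affine[OF \<eta>(1), of 1 "-x" y] by simp
    have grad2: "gradient (\<lambda>x. \<eta> (y - x)) x = - gradient \<eta> (y - x)" for x y
      using gradient_affine[OF \<eta>(1), of "-1" y x] by simp
    \<comment> \<open>first integrate in \<open>y\<close>, where the zero extension of \<open>w\<close> may be tested with any translate of the kernel\<close>
    have 1: "?I \<eta> (Q b) (H b) = - ?I (\<lambda>z. gradient \<eta> z \<bullet> b) (Q b) W" if b: "b \<in> Basis" for b
    proof -
      have "(\<integral>y. \<eta> (y - x) * (Q b x * H b y) \<partial>lborel) = - (\<integral>y. (gradient \<eta> (y - x) \<bullet> b) * (Q b x * W y) \<partial>lborel)" for x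
      proof -
        have "(\<lambda>y. \<eta> (y - x)) \<in> test_functions UNIV"
          using \<eta>(3) by (intro mollifier_in_test_functions(1)[OF \<eta>(1), of "t *\<^sub>R e" "t * k"]) auto
        from zero_ext[OF this b]
        have "(\<integral>y. W y * (gradient \<eta> (y - x) \<bullet> b) \<partial>lborel) = - (\<integral>y. H b y * \<eta> (y - x) \<partial>lborel)"
          using b by (subst (asm) repI[OF W w], simp add: grad1, subst (asm) repI[OF H L2_component[OF G]])
            (auto simp: grad1)
        then have "Q b x * (\<integral>y. H b y * \<eta> (y - x) \<partial>lborel) = - (Q b x * (\<integral>y. W y * (gradient \<eta> (y - x) \<bullet> b) \<partial>lborel))"
          by simp
        then have "(\<integral>y. Q b x * (H b y * \<eta> (y - x)) \<partial>lborel) = - (\<integral>y. Q b x * (W y * (gradient \<eta> (y - x) \<bullet> b)) \<partial>lborel)"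
          by simp
        then show ?thesis by (simp add: mult_ac)
      qed
      then show ?thesis by simp
    qed
    \<comment> \<open>then in \<open>x\<close>, where the kernel is a test function in \<open>\<Omega>\<close> by the cone condition\<close>
    have 2: "?I \<eta> E W = (\<Sum>b\<in>Basis. ?I (\<lambda>z. gradient \<eta> z \<bullet> b) (Q b) W)"
    proof -
      have fub: "?I h f g = (\<integral>y. (\<integral>x. h (y - x) * (f x * g y) \<partial>lborel) \<partial>lborel)"
        if "integrable lborel f" "integrable lborel g" "h \<in> borel_measurable borel" "\<And>z. \<bar>h z\<bar> \<le> C" for f g h :: "'a \<Rightarrow> real"
        using lborel_pair.Fubini_integral[OF mollified_integrable[OF that]] by simp
      have ii: "integrable lborel (\<lambda>y. \<integral>x. h (y - x) * (f x * g y) \<partial>lborel)"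
        if "integrable lborel f" "integrable lborel g" "h \<in> borel_measurable borel" "\<And>z. \<bar>h z\<bar> \<le> C" for f g h :: "'a \<Rightarrow> real"
        using lborel_pair.integrable_snd[OF mollified_integrable[OF that]] by simp
      have pt: "(\<integral>x. \<eta> (y - x) * (E x * W y) \<partial>lborel) = (\<Sum>b\<in>Basis. \<integral>x. (gradient \<eta> (y - x) \<bullet> b) * (Q b x * W y) \<partial>lborel)" for y
      proof (cases "y \<in> \<Omega> \<inter> ball x0 \<rho>")
        case True
        have sub: "cball (y - t *\<^sub>R e) (t * k) \<subseteq> \<Omega>" by (rule cone[OF t True])
        have "(\<lambda>x. \<eta> (y - x)) \<in> test_functions \<Omega>"
          using \<eta>(3) sub by (intro mollifier_in_test_functions(2)[OF \<eta>(1), of "t *\<^sub>R e" "t * k"]) auto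
        then have "(\<integral>x. q x \<bullet> gradient (\<lambda>x. \<eta> (y - x)) x \<partial>?M) = - (\<integral>x. D x * \<eta> (y - x) \<partial>?M)"
          using div unfolding has_weak_divergence_def by blast
        then have "(\<integral>x. D x * \<eta> (y - x) \<partial>?M) = (\<integral>x. q x \<bullet> gradient \<eta> (y - x) \<partial>?M)"
          by (simp add: grad2)
        also have "\<dots> = (\<integral>x. (\<Sum>b\<in>Basis. (q x \<bullet> b) * (gradient \<eta> (y - x) \<bullet> b)) \<partial>?M)"
          by (simp add: euclidean_inner[symmetric])
        also have "\<dots> = (\<Sum>b\<in>Basis. \<integral>x. (q x \<bullet> b) * (gradient \<eta> (y - x) \<bullet> b) \<partial>?M)"
        proof (rule Bochner_Integration.integral_sum)
          fix b :: 'a assume b: "b \<in> Basis"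
          have "continuous_on UNIV (\<lambda>x. gradient \<eta> (y - x) \<bullet> b)"
            using smooth_continuous[OF smooth_affine[OF smooth_gradient_inner[OF \<eta>(1) b], of "-1" y], of UNIV] by simp
          then show "integrable ?M (\<lambda>x. (q x \<bullet> b) * (gradient \<eta> (y - x) \<bullet> b))"
            by (intro L2_integrable_mult L2_component q L2_continuous_bounded \<Omega>)
        qed
        also have "\<dots> = (\<Sum>b\<in>Basis. \<integral>x. Q b x * (gradient \<eta> (y - x) \<bullet> b) \<partial>lborel)"
        proof (intro sum.cong refl)
          fix b :: 'a assume b: "b \<in> Basis"
          have "(\<lambda>x. gradient \<eta> (y - x) \<bullet> b) \<in> borel_measurable borel"
            by (rule measurable_compose[OF _ d\<eta>m[OF b]]) measurable
          then show "(\<integral>x. (q x \<bullet> b) * (gradient \<eta> (y - x) \<bullet> b) \<partial>?M) = (\<integral>x. Q b x * (gradient \<eta> (y - x) \<bullet> b) \<partial>lborel)"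
            by (rule repI[OF Q L2_component[OF q]])
        qed
        finally have "(\<integral>x. E x * \<eta> (y - x) \<partial>lborel) = (\<Sum>b\<in>Basis. \<integral>x. Q b x * (gradient \<eta> (y - x) \<bullet> b) \<partial>lborel)"
          by (subst (asm) repI[OF E D]) measurable
        then have "W y * (\<integral>x. E x * \<eta> (y - x) \<partial>lborel) = (\<Sum>b\<in>Basis. W y * (\<integral>x. Q b x * (gradient \<eta> (y - x) \<bullet> b) \<partial>lborel))"
          by (simp add: sum_distrib_left)
        then have "(\<integral>x. W y * (E x * \<eta> (y - x)) \<partial>lborel) = (\<Sum>b\<in>Basis. (\<integral>x. W y * (Q b x * (gradient \<eta> (y - x) \<bullet> b)) \<partial>lborel))"
          by simp
        then show ?thesis by (simp add: mult_ac)
      next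
        case False
        then show ?thesis by (simp add: Wsupp)
      qed
      have "?I \<eta> E W = (\<integral>y. (\<integral>x. \<eta> (y - x) * (E x * W y) \<partial>lborel) \<partial>lborel)"
        by (rule fub[OF repi(1)[OF E] repi(1)[OF W] \<eta>m C(1)])
      also have "\<dots> = (\<integral>y. (\<Sum>b\<in>Basis. \<integral>x. (gradient \<eta> (y - x) \<bullet> b) * (Q b x * W y) \<partial>lborel) \<partial>lborel)"
        by (simp only: pt)
      also have "\<dots> = (\<Sum>b\<in>Basis. \<integral>y. (\<integral>x. (gradient \<eta> (y - x) \<bullet> b) * (Q b x * W y) \<partial>lborel) \<partial>lborel)"
        by (intro Bochner_Integration.integral_sum ii[OF repi(1)[OF Q] repi(1)[OF W] d\<eta>m dC])
      also have "\<dots> = (\<Sum>b\<in>Basis. ?I (\<lambda>z. gradient \<eta> z \<bullet> b) (Q b) W)"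
        by (intro sum.cong refl fub[OF repi(1)[OF Q] repi(1)[OF W] d\<eta>m dC, symmetric])
      finally show ?thesis .
    qed
    have split: "?T = (\<Sum>b\<in>Basis. (\<integral>x. Q b x * H b x \<partial>lborel) - ?I \<eta> (Q b) (H b)) + ((\<integral>x. E x * W x \<partial>lborel) - ?I \<eta> E W)"
      using 1 2 by (simp add: sum.distrib)
    have "\<bar>?T\<bar> \<le> (\<Sum>b\<in>Basis. \<bar>(\<integral>x. Q b x * H b x \<partial>lborel) - ?I \<eta> (Q b) (H b)\<bar>) + \<bar>(\<integral>x. E x * W x \<partial>lborel) - ?I \<eta> E W\<bar>"
      by (subst split) (intro order_trans[OF abs_triangle_ineq] add_mono sum_abs order_refl)
    also have "\<dots> \<le> (\<Sum>b\<in>(Basis::'a set). \<epsilon>) + \<epsilon>"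
    proof (intro add_mono sum_mono)
      show "\<bar>(\<integral>x. Q b x * H b x \<partial>lborel) - ?I \<eta> (Q b) (H b)\<bar> \<le> \<epsilon>" if "b \<in> Basis" for b
        using err[OF Q L2_component[OF q] H L2_component[OF G] d(1)[OF that]] by (simp add: abs_minus_commute)
      show "\<bar>(\<integral>x. E x * W x \<partial>lborel) - ?I \<eta> E W\<bar> \<le> \<epsilon>"
        using err[OF E D W w d(2)] by (simp add: abs_minus_commute)
    qed
    also have "\<dots> = (real DIM('a) + 1) * \<epsilon>" by (simp add: algebra_simps)
    finally show ?thesis .
  qed
  note small = this
  have "\<bar>?T\<bar> \<le> 0"
  proof (rule field_le_epsilon)
    fix e' :: real assume "0 < e'"
    then have "\<bar>?T\<bar> \<le> (real DIM('a) + 1) * (e' / (real DIM('a) + 1))"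
      by (intro small divide_pos_pos) auto
    then show "\<bar>?T\<bar> \<le> 0 + e'" by simp
  qed
  then show ?thesis unfolding T by simp
qed

lemma L2_add:
  assumes f: "f \<in> L2 M" and g: "g \<in> L2 M"
  shows "(\<lambda>x. f x + g x) \<in> L2 M"
proof -
  have "(\<lambda>x. (-1) *\<^sub>R g x) \<in> L2 M" by (rule L2_mult_bounded[OF g, of _ 1]) auto
  from L2_diff[OF f this] show ?thesis by simp
qed

lemma L2_mult_smooth:
  fixes f :: "'a::euclidean_space \<Rightarrow> 'b::euclidean_space"
  assumes f: "f \<in> L2 (lebesgue_on \<Omega>)" and h: "continuous_on UNIV h" and \<Omega>: "bounded \<Omega>"
  shows "(\<lambda>x. h x *\<^sub>R f x) \<in> L2 (lebesgue_on \<Omega>)"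
proof -
  have "bounded (h ` closure \<Omega>)"
    using \<Omega> by (intro compact_imp_bounded compact_continuous_image continuous_on_subset[OF h]) auto
  then obtain C where "\<forall>y\<in>h ` closure \<Omega>. norm y \<le> C" unfolding bounded_iff ..
  then have C: "\<bar>h x\<bar> \<le> C" if "x \<in> \<Omega>" for x
    using that closure_subset[of \<Omega>] by auto
  show ?thesis
    using C by (intro L2_mult_bounded[OF f, of _ C] borel_imp_lebesgue_on borel_measurable_continuous_onI h) auto
qed

text \<open>The product rule, obtained by testing \<open>w\<close> with \<open>h \<psi>\<close>.\<close>
lemma zero_extension_gradient_mult:
  fixes \<Omega> :: "'a::euclidean_space set"
  assumes \<Omega>: "open \<Omega>" "bounded \<Omega>" and z: "zero_extension_gradient \<Omega> w G" and h: "smooth h"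
  shows "zero_extension_gradient \<Omega> (\<lambda>x. h x * w x) (\<lambda>x. h x *\<^sub>R G x + w x *\<^sub>R gradient h x)"
  unfolding zero_extension_gradient_def
proof (intro conjI ballI)
  let ?M = "lebesgue_on \<Omega>"
  have w: "w \<in> L2 ?M" and G: "G \<in> L2 ?M" using z by (auto simp: zero_extension_gradient_def)
  have hc: "continuous_on UNIV h" by (rule smooth_continuous[OF h])
  show "(\<lambda>x. h x * w x) \<in> L2 ?M" using L2_mult_smooth[OF w hc \<Omega>(2)] by simp
  have wg: "(\<lambda>x. w x *\<^sub>R gradient h x) \<in> L2 ?M"
  proof -
    have "bounded (gradient h ` closure \<Omega>)"
      using \<Omega> by (intro compact_imp_bounded compact_continuous_image continuous_on_gradient h) auto
    then obtain C where "\<forall>y\<in>gradient h ` closure \<Omega>. norm y \<le> C" unfolding bounded_iff ..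
    then have C: "norm (gradient h x) \<le> C" if "x \<in> \<Omega>" for x
      using that closure_subset[of \<Omega>] by auto
    have m: "(\<lambda>x. w x *\<^sub>R gradient h x) \<in> borel_measurable ?M"
      by (intro borel_measurable_scaleR L2_measurable[OF w] borel_imp_lebesgue_on
          borel_measurable_continuous_onI continuous_on_gradient h)
    have "integrable ?M (\<lambda>x. (norm (w x *\<^sub>R gradient h x))\<^sup>2)"
    proof (rule Bochner_Integration.integrable_bound)
      show "integrable ?M (\<lambda>x. C\<^sup>2 * (w x)\<^sup>2)" using w by (auto simp: L2_def)
      show "AE x in ?M. norm ((norm (w x *\<^sub>R gradient h x))\<^sup>2) \<le> norm (C\<^sup>2 * (w x)\<^sup>2)"
      proof (rule AE_I2)
        fix x assume "x \<in> space ?M"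
        then have "(norm (gradient h x))\<^sup>2 * (w x)\<^sup>2 \<le> C\<^sup>2 * (w x)\<^sup>2"
          using C[of x] by (intro mult_right_mono power_mono) auto
        then show "norm ((norm (w x *\<^sub>R gradient h x))\<^sup>2) \<le> norm (C\<^sup>2 * (w x)\<^sup>2)"
          by (simp add: power_mult_distrib mult.commute)
      qed
    qed (use m in measurable)
    with m show ?thesis by (simp add: L2_def)
  qed
  show "(\<lambda>x. h x *\<^sub>R G x + w x *\<^sub>R gradient h x) \<in> L2 ?M"
    by (intro L2_add L2_mult_smooth[OF G hc \<Omega>(2)] wg)
  fix \<psi> :: "'a \<Rightarrow> real" and b :: 'a
  assume \<psi>: "\<psi> \<in> test_functions UNIV" and b: "b \<in> Basis"
  have \<psi>s: "smooth \<psi>" using \<psi> by (rule test_functions_smooth)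
  have h\<psi>: "(\<lambda>x. h x * \<psi> x) \<in> test_functions UNIV" by (rule test_functions_mult[OF \<psi> h])
  have cL: "f \<in> L2 ?M" if "smooth f" for f
    by (rule L2_continuous_bounded[OF smooth_continuous[OF that] \<Omega>])
  have gh: "smooth (\<lambda>x. gradient h x \<bullet> b)" by (rule smooth_gradient_inner[OF h b])
  have i: "integrable ?M (\<lambda>x. w x * (h x * (gradient \<psi> x \<bullet> b)))" "integrable ?M (\<lambda>x. w x * (\<psi> x * (gradient h x \<bullet> b)))"
      "integrable ?M (\<lambda>x. (G x \<bullet> b) * (h x * \<psi> x))"
    by (intro L2_integrable_mult w cL smooth_mult h \<psi>s smooth_gradient_inner b L2_component G)+
  have "(\<integral>x. w x * (h x * (gradient \<psi> x \<bullet> b)) \<partial>?M) + (\<integral>x. w x * (\<psi> x * (gradient h x \<bullet> b)) \<partial>?M)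
      = (\<integral>x. w x * (gradient (\<lambda>x. h x * \<psi> x) x \<bullet> b) \<partial>?M)"
    using i by (simp add: gradient_mult[OF h \<psi>s] inner_add_left distrib_left)
  also have "\<dots> = - (\<integral>x. (G x \<bullet> b) * (h x * \<psi> x) \<partial>?M)"
    using z h\<psi> b unfolding zero_extension_gradient_def by blast
  finally have "(\<integral>x. w x * (h x * (gradient \<psi> x \<bullet> b)) \<partial>?M)
      = - ((\<integral>x. (G x \<bullet> b) * (h x * \<psi> x) \<partial>?M) + (\<integral>x. w x * (\<psi> x * (gradient h x \<bullet> b)) \<partial>?M))" by simp
  also have "\<dots> = - (\<integral>x. (G x \<bullet> b) * (h x * \<psi> x) + w x * (\<psi> x * (gradient h x \<bullet> b)) \<partial>?M)"
    using i by simp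
  also have "(\<lambda>x. (G x \<bullet> b) * (h x * \<psi> x) + w x * (\<psi> x * (gradient h x \<bullet> b)))
      = (\<lambda>x. ((h x *\<^sub>R G x + w x *\<^sub>R gradient h x) \<bullet> b) * \<psi> x)"
    by (auto simp: inner_add_left algebra_simps)
  finally show "(\<integral>x. h x * w x * (gradient \<psi> x \<bullet> b) \<partial>?M)
      = - (\<integral>x. ((h x *\<^sub>R G x + w x *\<^sub>R gradient h x) \<bullet> b) * \<psi> x \<partial>?M)"
    by (simp add: mult_ac)
qed

lemma zero_extension_gradient_diff:
  fixes \<Omega> :: "'a::euclidean_space set"
  assumes \<Omega>: "open \<Omega>" "bounded \<Omega>" and 1: "zero_extension_gradient \<Omega> w G" and 2: "zero_extension_gradient \<Omega> v H"
  shows "zero_extension_gradient \<Omega> (\<lambda>x. w x - v x) (\<lambda>x. G x - H x)"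
  unfolding zero_extension_gradient_def
proof (intro conjI ballI)
  let ?M = "lebesgue_on \<Omega>"
  have L: "w \<in> L2 ?M" "G \<in> L2 ?M" "v \<in> L2 ?M" "H \<in> L2 ?M"
    using 1 2 by (auto simp: zero_extension_gradient_def)
  show "(\<lambda>x. w x - v x) \<in> L2 ?M" "(\<lambda>x. G x - H x) \<in> L2 ?M" by (intro L2_diff L)+
  fix \<psi> :: "'a \<Rightarrow> real" and b :: 'a
  assume \<psi>: "\<psi> \<in> test_functions UNIV" and b: "b \<in> Basis"
  have \<psi>s: "smooth \<psi>" using \<psi> by (rule test_functions_smooth)
  have cL: "f \<in> L2 ?M" if "smooth f" for f
    by (rule L2_continuous_bounded[OF smooth_continuous[OF that] \<Omega>])
  have i: "integrable ?M (\<lambda>x. w x * (gradient \<psi> x \<bullet> b))" "integrable ?M (\<lambda>x. v x * (gradient \<psi> x \<bullet> b))"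
      "integrable ?M (\<lambda>x. (G x \<bullet> b) * \<psi> x)" "integrable ?M (\<lambda>x. (H x \<bullet> b) * \<psi> x)"
    by (intro L2_integrable_mult L cL smooth_gradient_inner \<psi>s b L2_component)+
  have "(\<integral>x. w x * (gradient \<psi> x \<bullet> b) \<partial>?M) = - (\<integral>x. (G x \<bullet> b) * \<psi> x \<partial>?M)"
    "(\<integral>x. v x * (gradient \<psi> x \<bullet> b) \<partial>?M) = - (\<integral>x. (H x \<bullet> b) * \<psi> x \<partial>?M)"
    using 1 2 \<psi> b unfolding zero_extension_gradient_def by blast+
  then show "(\<integral>x. (w x - v x) * (gradient \<psi> x \<bullet> b) \<partial>?M) = - (\<integral>x. ((G x - H x) \<bullet> b) * \<psi> x \<partial>?M)"
    using i by (simp add: left_diff_distrib inner_diff_left)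
qed

text \<open>Localisation without a partition of unity: multiplying \<open>w\<close> by \<open>1 - h\<close>, where \<open>h\<close> is a bump function that
  is one near a point and supported where the cone condition holds, does not change the pairing, by the
  local result for \<open>h w\<close>. After finitely many such cuts \<open>w\<close> has become zero on all of \<open>\<Omega>\<close>.\<close>
lemma zero_extension_pairing:
  fixes \<Omega> :: "'a::euclidean_space set"
  assumes \<Omega>: "open \<Omega>" "bounded \<Omega>" and lb: "lipschitz_boundary \<Omega>"
    and q: "q \<in> L2 (lebesgue_on \<Omega>)" and D: "D \<in> L2 (lebesgue_on \<Omega>)" and div: "has_weak_divergence \<Omega> q D"
    and z: "zero_extension_gradient \<Omega> w G"
  shows "(\<integral>x. q x \<bullet> G x \<partial>lebesgue_on \<Omega>) + (\<integral>x. D x * w x \<partial>lebesgue_on \<Omega>) = 0"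
proof -
  let ?M = "lebesgue_on \<Omega>"
  define T where "T w G = (\<integral>x. q x \<bullet> G x \<partial>?M) + (\<integral>x. D x * w x \<partial>?M)" for w :: "'a \<Rightarrow> real" and G :: "'a \<Rightarrow> 'a"
  have "\<forall>x0\<in>closure \<Omega>. \<exists>\<rho>>0. \<exists>e. \<exists>k>0. \<exists>t0>0. \<forall>t. 0 < t \<and> t < t0 \<longrightarrow>
      (\<forall>y\<in>\<Omega> \<inter> ball x0 \<rho>. cball (y - t *\<^sub>R e) (t * k) \<subseteq> \<Omega>)"
    using inward_cone[OF \<Omega>(1) lb] by blast
  then obtain \<rho> where \<rho>: "\<forall>x0\<in>closure \<Omega>. 0 < \<rho> x0 \<and> (\<exists>e. \<exists>k>0. \<exists>t0>0. \<forall>t. 0 < t \<and> t < t0 \<longrightarrow>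
      (\<forall>y\<in>\<Omega> \<inter> ball x0 (\<rho> x0). cball (y - t *\<^sub>R e) (t * k) \<subseteq> \<Omega>))"
    by metis
  have loc: "T v H = 0" if v: "zero_extension_gradient \<Omega> v H" "\<And>y. y \<notin> ball x0 (\<rho> x0) \<Longrightarrow> v y = 0"
    and x0: "x0 \<in> closure \<Omega>" for v H x0
  proof -
    obtain e k t0 where kt: "0 < k" "0 < t0" and cone: "\<forall>t. 0 < t \<and> t < t0 \<longrightarrow>
      (\<forall>y\<in>\<Omega> \<inter> ball x0 (\<rho> x0). cball (y - t *\<^sub>R e) (t * k) \<subseteq> \<Omega>)"
      using bspec[OF \<rho> x0] by blast
    then show ?thesis
      unfolding T_def by (intro local_zero_extension_pairing[OF \<Omega> q D div v kt]) blast+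
  qed
  have Tdiff: "T (\<lambda>x. v x - v' x) (\<lambda>x. H x - H' x) = T v H - T v' H'"
    if "zero_extension_gradient \<Omega> v H" "zero_extension_gradient \<Omega> v' H'" for v H v' H'
  proof -
    have L: "v \<in> L2 ?M" "H \<in> L2 ?M" "v' \<in> L2 ?M" "H' \<in> L2 ?M"
      using that by (auto simp: zero_extension_gradient_def)
    have "integrable ?M (\<lambda>x. q x \<bullet> H x)" "integrable ?M (\<lambda>x. q x \<bullet> H' x)"
      "integrable ?M (\<lambda>x. D x * v x)" "integrable ?M (\<lambda>x. D x * v' x)"
      by (intro L2_integrable_inner L2_integrable_mult q D L)+
    then show ?thesis by (simp add: T_def inner_diff_right right_diff_distrib)
  qed
  \<comment> \<open>cut away the part of \<open>w\<close> near finitely many points\<close>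
  have cut: "\<exists>v H. zero_extension_gradient \<Omega> v H \<and> T v H = T w G \<and> (\<forall>i\<in>I. \<forall>y\<in>ball i (\<rho> i / 2). v y = 0) \<and> (\<forall>y. w y = 0 \<longrightarrow> v y = 0)"
    if "finite I" "I \<subseteq> closure \<Omega>" for I
    using that
  proof (induction I rule: finite_induct)
    case empty
    then show ?case using z by blast
  next
    case (insert i I)
    then obtain v H where v: "zero_extension_gradient \<Omega> v H" "T v H = T w G"
      "\<forall>i\<in>I. \<forall>y\<in>ball i (\<rho> i / 2). v y = 0" "\<forall>y. w y = 0 \<longrightarrow> v y = 0" by blast
    have i: "i \<in> closure \<Omega>" using insert by blast
    then have \<rho>i: "0 < \<rho> i / 2" using \<rho> by simp
    obtain h where h: "smooth h"
        "\<And>x. x \<in> cball i (\<rho> i / 2) \<Longrightarrow> h x = 1" "\<And>x. x \<notin> ball i (2 * (\<rho> i / 2)) \<Longrightarrow> h x = 0"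
      using exists_bump[OF \<rho>i, of i] by metis
    let ?v = "\<lambda>x. h x * v x" and ?H = "\<lambda>x. h x *\<^sub>R H x + v x *\<^sub>R gradient h x"
    have z1: "zero_extension_gradient \<Omega> ?v ?H" by (rule zero_extension_gradient_mult[OF \<Omega> v(1) h(1)])
    have "T ?v ?H = 0" using h(3) by (intro loc[OF z1 _ i]) simp
    then have "T (\<lambda>x. v x - ?v x) (\<lambda>x. H x - ?H x) = T w G"
      using Tdiff[OF v(1) z1] v(2) by simp
    moreover have "zero_extension_gradient \<Omega> (\<lambda>x. v x - ?v x) (\<lambda>x. H x - ?H x)"
      by (rule zero_extension_gradient_diff[OF \<Omega> v(1) z1])
    moreover have "\<forall>j\<in>insert i I. \<forall>y\<in>ball j (\<rho> j / 2). v y - ?v y = 0"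
      using v(3) h(2) by auto
    moreover have "\<forall>y. w y = 0 \<longrightarrow> v y - ?v y = 0" using v(4) by simp
    ultimately show ?case by (intro exI conjI)
  qed
  have comp: "compact (closure \<Omega>)" using \<Omega> by simp
  obtain I where I: "I \<subseteq> closure \<Omega>" "finite I" "closure \<Omega> \<subseteq> (\<Union>x\<in>I. ball x (\<rho> x / 2))"
  proof (rule compactE_image[OF comp, of "closure \<Omega>" "\<lambda>x. ball x (\<rho> x / 2)"])
    show "closure \<Omega> \<subseteq> (\<Union>x\<in>closure \<Omega>. ball x (\<rho> x / 2))" using \<rho> by force
  qed auto
  obtain v H where v: "zero_extension_gradient \<Omega> v H" "T v H = T w G" "\<forall>i\<in>I. \<forall>y\<in>ball i (\<rho> i / 2). v y = 0"
    using cut[OF I(2,1)] by blast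
  have v0: "v y = 0" if "y \<in> \<Omega>" for y
    using that I(3) v(3) closure_subset[of \<Omega>] by blast
  have HL: "H \<in> L2 ?M" using v(1) by (simp add: zero_extension_gradient_def)
  have "AE x in ?M. H x = 0"
  proof (rule has_weak_gradient_unique[OF \<Omega>(1), of "\<lambda>x. 0" H "\<lambda>x. 0"])
    show "has_weak_gradient \<Omega> (\<lambda>x. 0) (\<lambda>x. 0)"
      unfolding has_weak_gradient_def by (auto simp: locally_integrable_def)
    show "has_weak_gradient \<Omega> (\<lambda>x. 0) H"
      unfolding has_weak_gradient_def
    proof (intro conjI ballI)
      show "locally_integrable \<Omega> H" using HL \<Omega> by (intro L2_locally_integrable) auto
      fix \<phi> b assume \<phi>: "\<phi> \<in> test_functions \<Omega>" and b: "(b::'a) \<in> Basis"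
      have "(\<integral>x. v x * (gradient \<phi> x \<bullet> b) \<partial>?M) = - (\<integral>x. (H x \<bullet> b) * \<phi> x \<partial>?M)"
        using v(1) test_functions_mono[OF \<phi>, of UNIV] b unfolding zero_extension_gradient_def by blast
      moreover have "(\<integral>x. v x * (gradient \<phi> x \<bullet> b) \<partial>?M) = (\<integral>x. 0 * (gradient \<phi> x \<bullet> b) \<partial>?M)"
        by (rule Bochner_Integration.integral_cong) (auto simp: v0)
      ultimately show "(\<integral>x. 0 * (gradient \<phi> x \<bullet> b) \<partial>?M) = - (\<integral>x. (H x \<bullet> b) * \<phi> x \<partial>?M)" by simp
    qed (simp add: locally_integrable_def)
  qed
  then have "(\<integral>x. q x \<bullet> H x \<partial>?M) = 0"
    by (intro integral_eq_zero_AE) (auto elim: AE_mp)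
  moreover have "(\<integral>x. D x * v x \<partial>?M) = (\<integral>x. 0 \<partial>?M)"
    by (rule Bochner_Integration.integral_cong) (auto simp: v0)
  ultimately have "T v H = 0" by (simp add: T_def)
  then show ?thesis using v(2) by (simp add: T_def)
qed

lemma normal_trace_eq:
  fixes \<Omega> :: "'a::euclidean_space set"
  assumes \<Omega>: "open \<Omega>" "bounded \<Omega>" and lb: "lipschitz_boundary \<Omega>"
    and q: "q \<in> Hdiv \<Omega>" and t: "has_trace \<Omega> u g"
  shows "normal_trace \<Omega> q g = L2_inner \<Omega> q (weak_gradient \<Omega> u) + L2_inner \<Omega> (weak_divergence \<Omega> q) u"
  unfolding normal_trace_def
proof (rule the_equality)
  let ?r = "L2_inner \<Omega> q (weak_gradient \<Omega> u) + L2_inner \<Omega> (weak_divergence \<Omega> q) u"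
  have qL: "q \<in> L2 (lebesgue_on \<Omega>)" using q by (simp add: Hdiv_def)
  note D = weak_divergence_props[OF \<Omega>(1) q]
  show "\<forall>w. has_trace \<Omega> w g \<longrightarrow> ?r = L2_inner \<Omega> q (weak_gradient \<Omega> w) + L2_inner \<Omega> (weak_divergence \<Omega> q) w"
  proof (intro allI impI)
    fix w assume w: "has_trace \<Omega> w g"
    have H1: "u \<in> H1 \<Omega>" "w \<in> H1 \<Omega>" using t w by (auto simp: has_trace_def)
    have L: "u \<in> L2 (lebesgue_on \<Omega>)" "w \<in> L2 (lebesgue_on \<Omega>)" using H1 by (auto simp: H1_def)
    note GL = weak_gradient_props(2)[OF \<Omega>(1) H1(1)] weak_gradient_props(2)[OF \<Omega>(1) H1(2)]
    have "zero_extension_gradient \<Omega> (\<lambda>x. u x - w x) (\<lambda>x. weak_gradient \<Omega> u x - weak_gradient \<Omega> w x)"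
      by (rule same_trace_zero_extension[OF \<Omega> lipschitz_boundary_finite_measure[OF \<Omega> lb] t w])
    from zero_extension_pairing[OF \<Omega> lb qL D(2,1) this]
    show "?r = L2_inner \<Omega> q (weak_gradient \<Omega> w) + L2_inner \<Omega> (weak_divergence \<Omega> q) w"
      using L2_integrable_inner[OF qL GL(1)] L2_integrable_inner[OF qL GL(2)]
        L2_integrable_mult[OF D(2) L(1)] L2_integrable_mult[OF D(2) L(2)]
      by (simp add: L2_inner_def inner_diff_right right_diff_distrib)
  qed
  then show "r = ?r" if "\<forall>w. has_trace \<Omega> w g \<longrightarrow> r = L2_inner \<Omega> q (weak_gradient \<Omega> w) + L2_inner \<Omega> (weak_divergence \<Omega> q) w" for r
    using that t by blast
qed

section \<open>The mixed formulation\<close>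

lemma has_weak_gradient_subset:
  assumes u: "has_weak_gradient \<Omega> u G" and S: "S \<subseteq> \<Omega>" "open S" "open \<Omega>"
  shows "has_weak_gradient S u G"
  unfolding has_weak_gradient_def
proof (intro conjI ballI)
  have l: "locally_integrable \<Omega> u" "locally_integrable \<Omega> G"
    using u unfolding has_weak_gradient_def by auto
  show "locally_integrable S u" "locally_integrable S G"
    by (rule locally_integrable_subset[OF l(1) S(1)], rule locally_integrable_subset[OF l(2) S(1)])
  fix \<phi> b assume \<phi>: "\<phi> \<in> test_functions S" and b: "(b::'a) \<in> Basis"
  obtain K where K: "compact K" "K \<subseteq> S" "\<forall>x. x \<notin> K \<longrightarrow> \<phi> x = 0 \<and> gradient \<phi> x = 0"
    using test_functions_support[OF \<phi>] .
  have off: "\<phi> x = 0" "gradient \<phi> x = 0" if "x \<in> \<Omega> - S" for x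
    using that K by auto
  have "(\<integral>x. u x * (gradient \<phi> x \<bullet> b) \<partial>lebesgue_on S) = (\<integral>x. u x * (gradient \<phi> x \<bullet> b) \<partial>lebesgue_on \<Omega>)"
    using S off by (intro integrable_lebesgue_on_subset(2)[symmetric]) auto
  also have "\<dots> = - (\<integral>x. (G x \<bullet> b) * \<phi> x \<partial>lebesgue_on \<Omega>)"
    using u test_functions_mono[OF \<phi> S(1)] b unfolding has_weak_gradient_def by blast
  also have "(\<integral>x. (G x \<bullet> b) * \<phi> x \<partial>lebesgue_on \<Omega>) = (\<integral>x. (G x \<bullet> b) * \<phi> x \<partial>lebesgue_on S)"
    using S off by (intro integrable_lebesgue_on_subset(2)) auto
  finally show "(\<integral>x. u x * (gradient \<phi> x \<bullet> b) \<partial>lebesgue_on S) = - (\<integral>x. (G x \<bullet> b) * \<phi> x \<partial>lebesgue_on S)" .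
qed

lemma H1_subset:
  assumes u: "u \<in> H1 \<Omega>" and S: "S \<subseteq> \<Omega>" "open S" "open \<Omega>"
  shows "u \<in> H1 S"
proof -
  note G = weak_gradient_props[OF S(3) u]
  have uL: "u \<in> L2 (lebesgue_on \<Omega>)" using u by (simp add: H1_def)
  have "u \<in> L2 (lebesgue_on S)" by (rule L2_restrict[OF uL S(1)]) (use S in auto)
  moreover have "weak_gradient \<Omega> u \<in> L2 (lebesgue_on S)" by (rule L2_restrict[OF G(2) S(1)]) (use S in auto)
  ultimately show ?thesis
    using has_weak_gradient_subset[OF G(1) S] by (auto simp: H1_def)
qed

text \<open>The constant sequence approximates \<open>\<phi>\<close>; its error is the zero function, whose chosen weak gradient is
  only almost everywhere zero.\<close>
lemma test_functions_H1_0: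
  fixes \<Omega> :: "'a::euclidean_space set"
  assumes \<Omega>: "open \<Omega>" "bounded \<Omega>" and \<phi>: "\<phi> \<in> test_functions \<Omega>"
  shows "\<phi> \<in> H1_0 \<Omega>"
proof -
  have s: "smooth \<phi>" using \<phi> by (rule test_functions_smooth)
  have "\<phi> \<in> H1 \<Omega>"
    using has_weak_gradient_smooth[OF \<Omega>(1) s] L2_continuous_bounded[OF smooth_continuous[OF s] \<Omega>]
      L2_continuous_bounded[OF continuous_on_gradient[OF s] \<Omega>] by (auto simp: H1_def)
  moreover have "H1_norm \<Omega> (\<lambda>x. \<phi> x - \<phi> x) = 0"
  proof -
    have "has_weak_gradient \<Omega> (\<lambda>x. 0) (\<lambda>x. 0)"
      unfolding has_weak_gradient_def by (auto simp: locally_integrable_def)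
    from weak_gradient_AE[OF \<Omega>(1) this]
    have "L2_inner \<Omega> (weak_gradient \<Omega> (\<lambda>x. 0)) (weak_gradient \<Omega> (\<lambda>x. 0)) = 0"
      unfolding L2_inner_def by (intro integral_eq_zero_AE) (auto elim: AE_mp)
    then show ?thesis by (simp add: H1_norm_def L2_inner_def)
  qed
  ultimately show ?thesis
    unfolding H1_0_def using \<phi> by (auto intro!: exI[of _ "\<lambda>_. \<phi>"])
qed

lemma AE_lebesgue_on_two_pieces:
  fixes \<Omega> :: "'a::euclidean_space set"
  assumes \<Omega>: "open \<Omega>" "open \<Omega>1" "open \<Omega>2" and N: "negligible (\<Omega> - (\<Omega>1 \<union> \<Omega>2))"
    and 1: "AE x in lebesgue_on \<Omega>1. P x" and 2: "AE x in lebesgue_on \<Omega>2. P x"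
  shows "AE x in lebesgue_on \<Omega>. P x"
proof -
  have "AE x in lebesgue. x \<in> \<Omega>1 \<longrightarrow> P x" "AE x in lebesgue. x \<in> \<Omega>2 \<longrightarrow> P x"
    using 1 2 \<Omega> by (simp_all add: AE_restrict_space_iff)
  moreover have "AE x in lebesgue. x \<notin> \<Omega> - (\<Omega>1 \<union> \<Omega>2)"
    using N by (intro AE_not_in) (simp add: negligible_iff_null_sets)
  ultimately have "AE x in lebesgue. x \<in> \<Omega> \<longrightarrow> P x"
    by eventually_elim auto
  then show ?thesis using \<Omega> by (simp add: AE_restrict_space_iff)
qed

lemma measurable_two_pieces:
  fixes \<Omega> :: "'a::euclidean_space set" and v :: "'a \<Rightarrow> real"
  assumes \<Omega>: "open \<Omega>" "open \<Omega>1" "open \<Omega>2" "\<Omega>1 \<inter> \<Omega>2 = {}" and N: "negligible (\<Omega> - (\<Omega>1 \<union> \<Omega>2))"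
    and v: "v \<in> borel_measurable (lebesgue_on \<Omega>1)" "v \<in> borel_measurable (lebesgue_on \<Omega>2)"
  shows "v \<in> borel_measurable (lebesgue_on \<Omega>)"
proof (rule measurable_lebesgue_on_cong_AE)
  let ?h = "\<lambda>x. (if x \<in> \<Omega>1 then v x else 0) + (if x \<in> \<Omega>2 then v x else 0)"
  show "?h \<in> borel_measurable (lebesgue_on \<Omega>)"
    using \<Omega> by (intro measurable_restrict_space1 borel_measurable_add borel_measurable_if_I v) auto
  show "AE x in lebesgue_on \<Omega>. ?h x = v x"
    using \<Omega> by (intro AE_lebesgue_on_two_pieces[OF \<Omega>(1-3) N] AE_I2) auto
qed (use \<Omega> in auto)

theorem proposition2p1:
  fixes \<Omega> \<Omega>1 \<Omega>2 :: "'a::euclidean_space set"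
    and a c f g u :: "'a \<Rightarrow> real" and p :: "'a \<Rightarrow> 'a" and a1 a2 :: real
  assumes "open \<Omega>" "bounded \<Omega>" "connected \<Omega>" "\<Omega> \<noteq> {}" "lipschitz_boundary \<Omega>"
    and "open \<Omega>1" "connected \<Omega>1" "\<Omega>1 \<noteq> {}" "\<Omega>1 \<subseteq> \<Omega>"
    and "open \<Omega>2" "connected \<Omega>2" "\<Omega>2 \<noteq> {}" "\<Omega>2 \<subseteq> \<Omega>"
    and "\<Omega>1 \<inter> \<Omega>2 = {}" "closure \<Omega> = closure \<Omega>1 \<union> closure \<Omega>2"
    and "negligible (\<Omega> - (\<Omega>1 \<union> \<Omega>2))"
    and "0 < a1" "0 < a2" "\<And>x. x \<in> \<Omega>1 \<Longrightarrow> a x = a1" "\<And>x. x \<in> \<Omega>2 \<Longrightarrow> a x = a2"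
    and "c \<in> L_infty (lebesgue_on \<Omega>)" "AE x in lebesgue_on \<Omega>. 0 \<le> c x"
    and "f \<in> L2 (lebesgue_on \<Omega>)"
    and "g \<in> H_half \<Omega>"
    and "weak_solution \<Omega> a c f g u"
    and "p = (\<lambda>x. a x *\<^sub>R weak_gradient \<Omega> u x)"
  shows "(u, p) \<in> mixed_space \<Omega> \<Omega>1 \<Omega>2 \<and>
    (\<forall>(v, q) \<in> mixed_space \<Omega> \<Omega>1 \<Omega>2.
      L2_inner \<Omega> (\<lambda>x. a x *\<^sub>R broken_gradient \<Omega>1 \<Omega>2 u x - p x) (broken_gradient \<Omega>1 \<Omega>2 v)
        + L2_inner \<Omega> (\<lambda>x. - weak_divergence \<Omega> p x + c x * u x) v
        = L2_inner \<Omega> f v \<and>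
      L2_inner \<Omega> (\<lambda>x. inverse (a x) *\<^sub>R p x) q
        + L2_inner \<Omega> (\<lambda>x. inverse (1 + c x) * weak_divergence \<Omega> p x + inverse (1 + c x) * u x)
            (weak_divergence \<Omega> q)
        = duality_pairing g (normal_trace \<Omega> q)
          - L2_inner \<Omega> (\<lambda>x. inverse (1 + c x) * f x) (weak_divergence \<Omega> q))"
proof -
  let ?M = "lebesgue_on \<Omega>" and ?G = "weak_gradient \<Omega> u"
  note \<Omega> = \<open>open \<Omega>\<close> \<open>bounded \<Omega>\<close> and opens = \<open>open \<Omega>1\<close> \<open>open \<Omega>2\<close>
  note pieces = AE_lebesgue_on_two_pieces[OF \<open>open \<Omega>\<close> opens \<open>negligible (\<Omega> - (\<Omega>1 \<union> \<Omega>2))\<close>]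
  note fL = \<open>f \<in> L2 ?M\<close> and c0 = \<open>AE x in ?M. 0 \<le> c x\<close> and p = \<open>p = (\<lambda>x. a x *\<^sub>R ?G x)\<close>
  have uH: "u \<in> H1 \<Omega>" and tr: "has_trace \<Omega> u g"
    and weak: "\<And>w. w \<in> H1_0 \<Omega> \<Longrightarrow>
      (\<integral>x. a x *\<^sub>R ?G x \<bullet> weak_gradient \<Omega> w x + c x * u x * w x \<partial>?M) = (\<integral>x. f x * w x \<partial>?M)"
    using \<open>weak_solution \<Omega> a c f g u\<close> by (auto simp: weak_solution_def)
  have uL: "u \<in> L2 ?M" using uH by (simp add: H1_def)
  note G = weak_gradient_props[OF \<Omega>(1) uH]
  have a_AE: "AE x in ?M. a x = (if x \<in> \<Omega>1 then a1 else a2)"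
    using assms by (intro pieces AE_I2) auto
  have a_meas: "a \<in> borel_measurable ?M"
  proof (rule measurable_lebesgue_on_cong_AE[where f = "\<lambda>x. if x \<in> \<Omega>1 then a1 else a2"])
    show "(\<lambda>x. if x \<in> \<Omega>1 then a1 else a2) \<in> borel_measurable ?M"
      using opens by (intro borel_imp_lebesgue_on) auto
    show "AE x in ?M. (if x \<in> \<Omega>1 then a1 else a2) = a x"
      using a_AE by eventually_elim simp
  qed (use \<Omega> in auto)
  have pL: "p \<in> L2 ?M"
    unfolding p
  proof (rule L2_mult_bounded[OF G(2) a_meas])
    show "AE x in ?M. \<bar>a x\<bar> \<le> max a1 a2"
      using a_AE by eventually_elim (use \<open>0 < a1\<close> \<open>0 < a2\<close> in auto)
  qed
  obtain C where cm: "c \<in> borel_measurable ?M" and C: "AE x in ?M. \<bar>c x\<bar> \<le> C"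
    using \<open>c \<in> L_infty ?M\<close> by (auto simp: L_infty_def)
  have cuL: "(\<lambda>x. c x * u x) \<in> L2 ?M"
    using L2_mult_bounded[OF uL cm C] by simp
  have EL: "(\<lambda>x. c x * u x - f x) \<in> L2 ?M" by (rule L2_diff[OF cuL fL])
  \<comment> \<open>the equation, tested with smooth functions, identifies the divergence of the flux\<close>
  have divp: "has_weak_divergence \<Omega> p (\<lambda>x. c x * u x - f x)"
    unfolding has_weak_divergence_def
  proof (intro conjI ballI)
    show "locally_integrable \<Omega> p" "locally_integrable \<Omega> (\<lambda>x. c x * u x - f x)"
      using \<Omega> by (auto intro!: L2_locally_integrable pL EL)
    fix \<phi> assume \<phi>: "\<phi> \<in> test_functions \<Omega>"
    have s: "smooth \<phi>" using \<phi> by (rule test_functions_smooth)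
    have \<phi>L: "\<phi> \<in> L2 ?M" "gradient \<phi> \<in> L2 ?M"
      by (intro L2_continuous_bounded \<Omega> smooth_continuous continuous_on_gradient s)+
    have \<phi>0: "\<phi> \<in> H1_0 \<Omega>" by (rule test_functions_H1_0[OF \<Omega> \<phi>])
    then have "\<phi> \<in> H1 \<Omega>" by (simp add: H1_0_def)
    note W = weak_gradient_props(2)[OF \<Omega>(1) this]
    have ae: "AE x in ?M. weak_gradient \<Omega> \<phi> x = gradient \<phi> x"
      by (rule weak_gradient_AE[OF \<Omega>(1) has_weak_gradient_smooth[OF \<Omega>(1) s]])
    have i: "integrable ?M (\<lambda>x. p x \<bullet> gradient \<phi> x)" "integrable ?M (\<lambda>x. c x * u x * \<phi> x)"
        "integrable ?M (\<lambda>x. f x * \<phi> x)" "integrable ?M (\<lambda>x. p x \<bullet> weak_gradient \<Omega> \<phi> x)"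
      by (rule L2_integrable_inner[OF pL \<phi>L(2)], rule L2_integrable_mult[OF cuL \<phi>L(1)],
          rule L2_integrable_mult[OF fL \<phi>L(1)], rule L2_integrable_inner[OF pL W])
    have "(\<integral>x. p x \<bullet> gradient \<phi> x \<partial>?M) = (\<integral>x. p x \<bullet> weak_gradient \<Omega> \<phi> x \<partial>?M)"
    proof (rule integral_cong_AE)
      show "AE x in ?M. p x \<bullet> gradient \<phi> x = p x \<bullet> weak_gradient \<Omega> \<phi> x"
        using ae by eventually_elim simp
    qed (use i in auto)
    moreover have "(\<integral>x. p x \<bullet> weak_gradient \<Omega> \<phi> x \<partial>?M) + (\<integral>x. c x * u x * \<phi> x \<partial>?M) = (\<integral>x. f x * \<phi> x \<partial>?M)"
      using weak[OF \<phi>0] i by (simp add: p)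
    ultimately show "(\<integral>x. p x \<bullet> gradient \<phi> x \<partial>?M) = - (\<integral>x. (c x * u x - f x) * \<phi> x \<partial>?M)"
      using i by (simp add: left_diff_distrib)
  qed
  have pH: "p \<in> Hdiv \<Omega>"
    using pL EL divp unfolding Hdiv_def by blast
  have divAE: "AE x in ?M. weak_divergence \<Omega> p x = c x * u x - f x"
    by (rule weak_divergence_AE[OF \<Omega>(1) divp])
  have divm: "weak_divergence \<Omega> p \<in> borel_measurable ?M"
    by (rule L2_measurable[OF weak_divergence_props(2)[OF \<Omega>(1) pH]])
  have um: "u \<in> borel_measurable ?M" and fm: "f \<in> borel_measurable ?M"
    using uL fL by (auto simp: L2_def)
  have in_space: "(u, p) \<in> mixed_space \<Omega> \<Omega>1 \<Omega>2"
    unfolding mixed_space_def broken_H1_def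
    using H1_subset[OF uH \<open>\<Omega>1 \<subseteq> \<Omega>\<close> opens(1) \<Omega>(1)] H1_subset[OF uH \<open>\<Omega>2 \<subseteq> \<Omega>\<close> opens(2) \<Omega>(1)] pH by simp
  \<comment> \<open>the piecewise gradient of \<open>u\<close> is its gradient on the whole domain\<close>
  have bg: "AE x in ?M. broken_gradient \<Omega>1 \<Omega>2 u x = ?G x"
  proof (rule pieces)
    have *: "AE x in lebesgue_on S. weak_gradient S u x = ?G x" if "S \<subseteq> \<Omega>" "open S" for S
      by (rule weak_gradient_AE[OF that(2) has_weak_gradient_subset[OF G(1) that \<Omega>(1)]])
    show "AE x in lebesgue_on \<Omega>1. broken_gradient \<Omega>1 \<Omega>2 u x = ?G x"
      using *[OF \<open>\<Omega>1 \<subseteq> \<Omega>\<close> opens(1)]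
      by (rule AE_mp) (auto intro!: AE_I2 simp: broken_gradient_def)
    show "AE x in lebesgue_on \<Omega>2. broken_gradient \<Omega>1 \<Omega>2 u x = ?G x"
      using *[OF \<open>\<Omega>2 \<subseteq> \<Omega>\<close> opens(2)]
      by (rule AE_mp) (use \<open>\<Omega>1 \<inter> \<Omega>2 = {}\<close> in \<open>auto intro!: AE_I2 simp: broken_gradient_def\<close>)
  qed
  have first: "L2_inner \<Omega> (\<lambda>x. a x *\<^sub>R broken_gradient \<Omega>1 \<Omega>2 u x - p x) (broken_gradient \<Omega>1 \<Omega>2 v)
        + L2_inner \<Omega> (\<lambda>x. - weak_divergence \<Omega> p x + c x * u x) v = L2_inner \<Omega> f v"
    if v: "v \<in> broken_H1 \<Omega>1 \<Omega>2" for v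
  proof -
    have vm: "v \<in> borel_measurable ?M"
      using v \<open>\<Omega>1 \<inter> \<Omega>2 = {}\<close> \<open>negligible (\<Omega> - (\<Omega>1 \<union> \<Omega>2))\<close>
      by (intro measurable_two_pieces[OF \<Omega>(1) opens]) (auto simp: broken_H1_def H1_def L2_def)
    have "L2_inner \<Omega> (\<lambda>x. a x *\<^sub>R broken_gradient \<Omega>1 \<Omega>2 u x - p x) (broken_gradient \<Omega>1 \<Omega>2 v) = 0"
      unfolding L2_inner_def
    proof (rule integral_eq_zero_AE)
      show "AE x in ?M. (a x *\<^sub>R broken_gradient \<Omega>1 \<Omega>2 u x - p x) \<bullet> broken_gradient \<Omega>1 \<Omega>2 v x = 0"
        using bg by eventually_elim (simp add: p)
    qed
    moreover have "L2_inner \<Omega> (\<lambda>x. - weak_divergence \<Omega> p x + c x * u x) v = L2_inner \<Omega> f v"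
      unfolding L2_inner_def
    proof (rule integral_cong_AE)
      show "AE x in ?M. (- weak_divergence \<Omega> p x + c x * u x) \<bullet> v x = f x \<bullet> v x"
        using divAE by eventually_elim simp
    qed (use vm divm cm um fm in measurable)
    ultimately show ?thesis by simp
  qed
  have second: "L2_inner \<Omega> (\<lambda>x. inverse (a x) *\<^sub>R p x) q
        + L2_inner \<Omega> (\<lambda>x. inverse (1 + c x) * weak_divergence \<Omega> p x + inverse (1 + c x) * u x) (weak_divergence \<Omega> q)
        = duality_pairing g (normal_trace \<Omega> q) - L2_inner \<Omega> (\<lambda>x. inverse (1 + c x) * f x) (weak_divergence \<Omega> q)"
    if q: "q \<in> Hdiv \<Omega>" for q
  proof -
    let ?D = "weak_divergence \<Omega> q"
    have qL: "q \<in> L2 ?M" using q by (simp add: Hdiv_def)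
    have DL: "?D \<in> L2 ?M" by (rule weak_divergence_props(2)[OF \<Omega>(1) q])
    note Dm = L2_measurable[OF DL] and qm = L2_measurable[OF qL] and Gm = L2_measurable[OF G(2)] and pm = L2_measurable[OF pL]
    have 1: "L2_inner \<Omega> (\<lambda>x. inverse (a x) *\<^sub>R p x) q = L2_inner \<Omega> q ?G"
      unfolding L2_inner_def
    proof (rule integral_cong_AE)
      show "AE x in ?M. (inverse (a x) *\<^sub>R p x) \<bullet> q x = q x \<bullet> ?G x"
        using a_AE
      proof eventually_elim
        case (elim x)
        then have "a x \<noteq> 0" using \<open>0 < a1\<close> \<open>0 < a2\<close> by auto
        then show ?case by (simp add: p inner_commute)
      qed
    qed (use a_meas pm qm Gm in measurable)
    have hm: "(\<lambda>x. inverse (1 + c x)) \<in> borel_measurable ?M" using cm by measurable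
    have hfL: "(\<lambda>x. inverse (1 + c x) * f x) \<in> L2 ?M"
    proof -
      have "AE x in ?M. \<bar>inverse (1 + c x)\<bar> \<le> 1"
        using c0
      proof eventually_elim
        case (elim x)
        then show ?case by (simp add: inverse_le_1_iff)
      qed
      from L2_mult_bounded[OF fL hm this] show ?thesis by simp
    qed
    have "L2_inner \<Omega> (\<lambda>x. inverse (1 + c x) * weak_divergence \<Omega> p x + inverse (1 + c x) * u x) ?D
        = (\<integral>x. u x * ?D x - (inverse (1 + c x) * f x) * ?D x \<partial>?M)"
      unfolding L2_inner_def
    proof (rule integral_cong_AE)
      show "AE x in ?M. (inverse (1 + c x) * weak_divergence \<Omega> p x + inverse (1 + c x) * u x) \<bullet> ?D x
          = u x * ?D x - (inverse (1 + c x) * f x) * ?D x"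
        using divAE c0
      proof eventually_elim
        case (elim x)
        have "inverse (1 + c x) * (1 + c x) = 1" using elim(2) by (intro left_inverse) linarith
        moreover have "k * (c x * u x - f x) + k * u x = (k * (1 + c x)) * u x - k * f x" for k :: real
          by (simp add: algebra_simps)
        ultimately have "inverse (1 + c x) * (c x * u x - f x) + inverse (1 + c x) * u x = u x - inverse (1 + c x) * f x"
          by simp
        then show ?case by (simp add: elim(1) left_diff_distrib)
      qed
    qed (use divm cm um fm Dm in measurable)
    also have "\<dots> = L2_inner \<Omega> ?D u - L2_inner \<Omega> (\<lambda>x. inverse (1 + c x) * f x) ?D"
      using L2_integrable_mult[OF uL DL] L2_integrable_mult[OF hfL DL]
      by (simp add: L2_inner_def mult.commute)
    finally show ?thesis
      using 1 normal_trace_eq[OF \<Omega> \<open>lipschitz_boundary \<Omega>\<close> q tr] by (simp add: duality_pairing_def)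
  qed
  show ?thesis
    using in_space first second unfolding mixed_space_def by auto
qed

end
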